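(* Under the standing setting below, for all $h>0$: (a) $\sigma(\mathcal A_h)\subset\Sigma(-\hat\nu;\theta_0)$ and there exists $C>0$ independent of $\mu$ and $h$ such that $\|R(\mu,\mathcal A_h)\|_{\mathcal L(V_h)}\le\frac{C}{|\mu+\hat\nu|}$ for all $\mu\in\Sigma^c(-\hat\nu;\theta_0)$, $\mu\ne-\hat\nu$; (b) $\mathcal A_h$ generates a (uniformly in $h$) analytic semigroup on $V_h$ with $e^{t\mathcal A_h}=\frac{1}{2\pi i}\int_\Gamma e^{\mu t}R(\mu,\mathcal A_h)\,d\mu$, $t>0$, for any curve $\Gamma$ from $-\infty$ to $\infty$ lying entirely in $\Sigma^c(-\hat\nu;\theta_0)$; (c) $\|e^{t\mathcal A_h}\|_{\mathcal L(V_h)}\le Ce^{-\hat\nu t}$ for all $t>0$, with $C>0$ independent of $h$.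
   Context: Let $\Omega\subset\mathbb R^d$, $d\in\{1,2,3\}$, be a bounded open domain with smooth boundary; $L^2(\Omega)$ is the complex Hilbert space with $\langle\phi,\psi\rangle=\int_\Omega\phi\bar\psi\,dx$ and norm $\|\cdot\|$. Fix $\eta>0$, $\mathbf v\in\mathbb R^d$, $\nu_0\in\mathbb R$, $f_s\in L^2(\Omega)$, and $y_s\in H^2(\Omega)\cap H^1_0(\Omega)$ solving $-\eta\Delta y_s+y_s\,\mathbf v\cdot\nabla y_s+\nu_0y_s=f_s$ in $\Omega$, $y_s=0$ on $\partial\Omega$. Let $s_0$ be the constant of the embedding $H^1(\Omega)\hookrightarrow L^4(\Omega)$ and $C_a$ the constant in Agmon's inequality $\|z\|_{L^\infty(\Omega)}\le C_a\|z\|_{H^1(\Omega)}^{1/2}\|z\|_{H^2(\Omega)}^{1/2}$ for $z\in H^2(\Omega)\cap H^1_0(\Omega)$. Assume $\hat\nu:=\nu_0-\frac{|\mathbf v|^2}{\eta}(C_a^2+s_0^4)\|y_s\|_{H^2(\Omega)}^2>0$. Let $a(z,\phi)=\eta\langle\nabla z,\nabla\phi\rangle+\langle y_s\mathbf v\cdot\nabla z,\phi\rangle+\langle(\mathbf v\cdot\nabla y_s)z,\phi\rangle+\nu_0\langle z,\phi\rangle$ for $z,\phi\in H^1_0(\Omega)$, let $\alpha_1>0$ be a constant with $|a(z,\phi)|\le\alpha_1\|\nabla z\|\|\nabla\phi\|$ for all $z,\phi\in H^1_0(\Omega)$, and set $\theta_0:=\pi-\arctan(2\alpha_1/\eta)\in(\pi/2,\pi)$.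 For $a\in\mathbb R$, $\Sigma(a;\theta_0):=\{a+re^{\pm i\theta}: r>0,\ \theta\in(-\pi,\pi],\ |\theta|\ge\theta_0\}$, $\Sigma^c(a;\theta_0)$ its complement in $\mathbb C$. For each $h>0$, $V_h\subset H^1_0(\Omega)$ is a finite-dimensional conforming finite element space on a triangulation $\mathcal T_h$ of $\bar\Omega$ with mesh size $h$, and $\mathcal A_h:V_h\to V_h$ is defined by $\langle-\mathcal A_hz_h,\phi_h\rangle=a(z_h,\phi_h)$ for all $z_h,\phi_h\in V_h$. *)

theory Defs
  imports "HOL-Analysis.Analysis"
begin

definition pderiv_i :: "'n::finite \<Rightarrow> (real^'n \<Rightarrow> real) \<Rightarrow> real^'n \<Rightarrow> real" where
  "pderiv_i i f x = frechet_derivative f (at x) (axis i 1)"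

fun Ck :: "nat \<Rightarrow> (real^'n::finite \<Rightarrow> real) \<Rightarrow> bool" where
  "Ck 0 f = continuous_on UNIV f"
| "Ck (Suc k) f = (continuous_on UNIV f \<and> (\<forall>x. f differentiable (at x)) \<and>
                   (\<forall>i. Ck k (pderiv_i i f)))"

definition smooth_fun :: "(real^'n::finite \<Rightarrow> real) \<Rightarrow> bool" where
  "smooth_fun f \<longleftrightarrow> (\<forall>k. Ck k f)"

definition smooth_boundary :: "(real^'n::finite) set \<Rightarrow> bool" where
  "smooth_boundary \<Omega> \<longleftrightarrow>
     (\<forall>p\<in>frontier \<Omega>. \<exists>U \<rho>. open U \<and> p \<in> U \<and> smooth_fun \<rho> \<and>
        (\<forall>x\<in>U. x \<in> \<Omega> \<longleftrightarrow> \<rho> x < 0) \<and>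
        (\<forall>x\<in>U. frechet_derivative \<rho> (at x) \<noteq> (\<lambda>_. 0)))"

definition test_fun :: "(real^'n::finite) set \<Rightarrow> (real^'n \<Rightarrow> real) \<Rightarrow> bool" where
  "test_fun \<Omega> \<phi> \<longleftrightarrow> smooth_fun \<phi> \<and> compact (closure {x. \<phi> x \<noteq> 0})
                      \<and> closure {x. \<phi> x \<noteq> 0} \<subseteq> \<Omega>"

definition ctest_fun :: "(real^'n::finite) set \<Rightarrow> (real^'n \<Rightarrow> complex) \<Rightarrow> bool" where
  "ctest_fun \<Omega> \<phi> \<longleftrightarrow> test_fun \<Omega> (\<lambda>x. Re (\<phi> x)) \<and> test_fun \<Omega> (\<lambda>x. Im (\<phi> x))"

definition L2 :: "(real^'n::finite) set \<Rightarrow> (real^'n \<Rightarrow> complex) \<Rightarrow> bool" where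
  "L2 \<Omega> u \<longleftrightarrow> set_borel_measurable lebesgue \<Omega> u \<and>
                set_integrable lebesgue \<Omega> (\<lambda>x. (cmod (u x))\<^sup>2)"

definition L2ip :: "(real^'n::finite) set \<Rightarrow> (real^'n \<Rightarrow> complex) \<Rightarrow> (real^'n \<Rightarrow> complex) \<Rightarrow> complex" where
  "L2ip \<Omega> u w = (LINT x:\<Omega>|lebesgue. u x * cnj (w x))"

definition L2norm :: "(real^'n::finite) set \<Rightarrow> (real^'n \<Rightarrow> complex) \<Rightarrow> real" where
  "L2norm \<Omega> u = sqrt (LINT x:\<Omega>|lebesgue. (cmod (u x))\<^sup>2)"

definition weak_partial :: "(real^'n::finite) set \<Rightarrow> (real^'n \<Rightarrow> complex) \<Rightarrow> 'n \<Rightarrow> (real^'n \<Rightarrow> complex) \<Rightarrow> bool" where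
  "weak_partial \<Omega> u i g \<longleftrightarrow> L2 \<Omega> g \<and>
     (\<forall>\<phi>. test_fun \<Omega> \<phi> \<longrightarrow>
        (LINT x:\<Omega>|lebesgue. u x * complex_of_real (pderiv_i i \<phi> x)) =
        - (LINT x:\<Omega>|lebesgue. g x * complex_of_real (\<phi> x)))"

(* the weak partial derivative (unique up to null sets) *)
definition wd :: "(real^'n::finite) set \<Rightarrow> (real^'n \<Rightarrow> complex) \<Rightarrow> 'n \<Rightarrow> (real^'n \<Rightarrow> complex)" where
  "wd \<Omega> u i = (SOME g. weak_partial \<Omega> u i g)"

definition H1 :: "(real^'n::finite) set \<Rightarrow> (real^'n \<Rightarrow> complex) \<Rightarrow> bool" where
  "H1 \<Omega> u \<longleftrightarrow> L2 \<Omega> u \<and> (\<forall>i. \<exists>g. weak_partial \<Omega> u i g)"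

definition H2 :: "(real^'n::finite) set \<Rightarrow> (real^'n \<Rightarrow> complex) \<Rightarrow> bool" where
  "H2 \<Omega> u \<longleftrightarrow> H1 \<Omega> u \<and> (\<forall>i. H1 \<Omega> (wd \<Omega> u i))"

definition grad_norm :: "(real^'n::finite) set \<Rightarrow> (real^'n \<Rightarrow> complex) \<Rightarrow> real" where
  "grad_norm \<Omega> u = sqrt (\<Sum>i\<in>UNIV. (L2norm \<Omega> (wd \<Omega> u i))\<^sup>2)"

definition H1norm :: "(real^'n::finite) set \<Rightarrow> (real^'n \<Rightarrow> complex) \<Rightarrow> real" where
  "H1norm \<Omega> u = sqrt ((L2norm \<Omega> u)\<^sup>2 + (\<Sum>i\<in>UNIV. (L2norm \<Omega> (wd \<Omega> u i))\<^sup>2))"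

definition H2norm :: "(real^'n::finite) set \<Rightarrow> (real^'n \<Rightarrow> complex) \<Rightarrow> real" where
  "H2norm \<Omega> u = sqrt ((L2norm \<Omega> u)\<^sup>2 + (\<Sum>i\<in>UNIV. (L2norm \<Omega> (wd \<Omega> u i))\<^sup>2)
                     + (\<Sum>i\<in>UNIV. \<Sum>j\<in>UNIV. (L2norm \<Omega> (wd \<Omega> (wd \<Omega> u i) j))\<^sup>2))"

definition H10 :: "(real^'n::finite) set \<Rightarrow> (real^'n \<Rightarrow> complex) \<Rightarrow> bool" where
  "H10 \<Omega> u \<longleftrightarrow> H1 \<Omega> u \<and>
     (\<exists>\<phi>. (\<forall>n. ctest_fun \<Omega> (\<phi> n)) \<and> (\<lambda>n. H1norm \<Omega> (\<lambda>x. \<phi> n x - u x)) \<longlonglongrightarrow> 0)"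

definition vgrad :: "(real^'n::finite) set \<Rightarrow> real^'n \<Rightarrow> (real^'n \<Rightarrow> complex) \<Rightarrow> (real^'n \<Rightarrow> complex)" where
  "vgrad \<Omega> v u = (\<lambda>x. \<Sum>i\<in>UNIV. complex_of_real (v $ i) * wd \<Omega> u i x)"

definition laplace :: "(real^'n::finite) set \<Rightarrow> (real^'n \<Rightarrow> complex) \<Rightarrow> (real^'n \<Rightarrow> complex)" where
  "laplace \<Omega> u = (\<lambda>x. \<Sum>i\<in>UNIV. wd \<Omega> (wd \<Omega> u i) i x)"

definition aform :: "(real^'n::finite) set \<Rightarrow> real \<Rightarrow> real^'n \<Rightarrow> real \<Rightarrow> (real^'n \<Rightarrow> complex)
                     \<Rightarrow> (real^'n \<Rightarrow> complex) \<Rightarrow> (real^'n \<Rightarrow> complex) \<Rightarrow> complex" where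
  "aform \<Omega> \<eta> v \<nu>0 ys z \<phi> =
     complex_of_real \<eta> * (\<Sum>i\<in>UNIV. L2ip \<Omega> (wd \<Omega> z i) (wd \<Omega> \<phi> i))
     + L2ip \<Omega> (\<lambda>x. ys x * vgrad \<Omega> v z x) \<phi>
     + L2ip \<Omega> (\<lambda>x. vgrad \<Omega> v ys x * z x) \<phi>
     + complex_of_real \<nu>0 * L2ip \<Omega> z \<phi>"

definition sector :: "real \<Rightarrow> real \<Rightarrow> complex set" where
  "sector a \<theta>0 = {\<mu>. \<exists>r \<theta>. r > 0 \<and> -pi < \<theta> \<and> \<theta> \<le> pi \<and> \<bar>\<theta>\<bar> \<ge> \<theta>0 \<and>
                    (\<mu> = complex_of_real a + complex_of_real r * cis \<theta> \<or>
                     \<mu> = complex_of_real a + complex_of_real r * cis (-\<theta>))}"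

definition fin_dim_space :: "(real^'n::finite \<Rightarrow> complex) set \<Rightarrow> bool" where
  "fin_dim_space V \<longleftrightarrow> (\<exists>B. finite B \<and> B \<subseteq> V \<and>
       V = {(\<lambda>x. \<Sum>b\<in>B. c b * b x) | c. True})"

definition spectrum_on :: "(real^'n::finite \<Rightarrow> complex) set \<Rightarrow>
     ((real^'n \<Rightarrow> complex) \<Rightarrow> (real^'n \<Rightarrow> complex)) \<Rightarrow> complex set" where
  "spectrum_on V T = {\<mu>. \<not> bij_betw (\<lambda>z x. \<mu> * z x - T z x) V V}"

definition resolvent_on :: "(real^'n::finite \<Rightarrow> complex) set \<Rightarrow>
     ((real^'n \<Rightarrow> complex) \<Rightarrow> (real^'n \<Rightarrow> complex)) \<Rightarrow> complex \<Rightarrow>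
     (real^'n \<Rightarrow> complex) \<Rightarrow> (real^'n \<Rightarrow> complex)" where
  "resolvent_on V T \<mu> = inv_into V (\<lambda>z x. \<mu> * z x - T z x)"

definition opnorm_le :: "(real^'n::finite) set \<Rightarrow> (real^'n \<Rightarrow> complex) set \<Rightarrow>
     ((real^'n \<Rightarrow> complex) \<Rightarrow> (real^'n \<Rightarrow> complex)) \<Rightarrow> real \<Rightarrow> bool" where
  "opnorm_le \<Omega> V T K \<longleftrightarrow> (\<forall>z\<in>V. L2norm \<Omega> (T z) \<le> K * L2norm \<Omega> z)"

definition op_exp :: "((real^'n::finite \<Rightarrow> complex) \<Rightarrow> (real^'n \<Rightarrow> complex)) \<Rightarrow> complex \<Rightarrow>
     (real^'n \<Rightarrow> complex) \<Rightarrow> (real^'n \<Rightarrow> complex)" where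
  "op_exp T \<zeta> z = (\<lambda>x. \<Sum>k. \<zeta> ^ k / of_nat (fact k) * (T ^^ k) z x)"

(* \<gamma> : R \<rightarrow> S, piecewise C^1 on compacts, going from \<infinity> e^{-i\<theta>} (Im \<rightarrow> -\<infinity>) to
   \<infinity> e^{i\<theta>} (Im \<rightarrow> +\<infinity>) with Re \<rightarrow> -\<infinity> at both ends *)
definition curve_in :: "(real \<Rightarrow> complex) \<Rightarrow> complex set \<Rightarrow> bool" where
  "curve_in \<gamma> S \<longleftrightarrow> (\<forall>a b. \<gamma> piecewise_C1_differentiable_on {a..b}) \<and> range \<gamma> \<subseteq> S \<and>
     filterlim (\<lambda>s. Re (\<gamma> s)) at_bot at_bot \<and> filterlim (\<lambda>s. Re (\<gamma> s)) at_bot at_top \<and>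
     filterlim (\<lambda>s. Im (\<gamma> s)) at_bot at_bot \<and> filterlim (\<lambda>s. Im (\<gamma> s)) at_top at_top"

definition improper_cintegral :: "(real \<Rightarrow> complex) \<Rightarrow> (complex \<Rightarrow> complex) \<Rightarrow> complex \<Rightarrow> bool" where
  "improper_cintegral \<gamma> f I \<longleftrightarrow>
     (\<forall>a b. (\<lambda>s. f (\<gamma> s) * vector_derivative \<gamma> (at s)) integrable_on {a..b}) \<and>
     ((\<lambda>(a, b). integral {a..b} (\<lambda>s. f (\<gamma> s) * vector_derivative \<gamma> (at s))) \<longlongrightarrow> I)
        (at_bot \<times>\<^sub>F at_top)"

end

theory Submission
  imports Defs "HOL-Complex_Analysis.Complex_Analysis" "HOL-Library.Function_Algebras"
begin

text \<open>
  Integrating \<open>\<langle>(v \<cdot> \<nabla>y\<^sub>s) z, z\<rangle>\<close> by parts, the two first-order terms of \<open>a(z,z)\<close> add up to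
  \<open>- \<integral> y\<^sub>s z v \<cdot> \<nabla>(cnj z)\<close>, so Young's inequality and Agmon's bound on \<open>y\<^sub>s\<close> give
  \<open>Re a(z,z) \<ge> (3/4) \<eta> \<parallel>\<nabla>z\<parallel>\<^sup>2 + \<nu> \<parallel>z\<parallel>\<^sup>2\<close>, where \<open>\<nu>\<close> stands for \<open>\<nu>hat\<close>. Estimating \<open>\<langle>(v \<cdot> \<nabla>y\<^sub>s) z, z\<rangle>\<close> through \<open>L\<^sup>4\<close>
  instead would lose a multiple of \<open>\<parallel>z\<parallel>\<^sup>2\<close>. Together with \<open>|a(z,z)| \<le> \<alpha> \<parallel>\<nabla>z\<parallel>\<^sup>2\<close> the values
  \<open>b = a(z,z) - \<nu> \<parallel>z\<parallel>\<^sup>2\<close> satisfy \<open>Re b \<ge> c \<parallel>z\<parallel>\<^sup>2\<close> with \<open>c > 0\<close>, and \<open>|Im b| \<le> (2/3) k Re b\<close> with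
  \<open>k = 2 \<alpha> / \<eta>\<close>. The factor \<open>2/3\<close> keeps the numerical range at a positive angle from the
  boundary of the sector, which makes the resolvent bound uniform up to that boundary.

  The semigroup bounds follow from the energy identity for \<open>\<parallel>e\<^bsup>s\<zeta>A\<^esup> z\<parallel>\<^sup>2\<close>. For the Dunford integral
  let \<open>G\<close> be a primitive of the integrand on the slightly enlarged complement of the sector. Moving
  the end points of the curve along rays parallel to the boundary of the sector shows that only the
  two limits of \<open>G\<close> at infinity matter, and these are found by comparison with a large circle,
  on which the Neumann series of the resolvent can be integrated term by term.
\<close>

section \<open>Finite-dimensional inner product spaces of functions\<close>

text \<open>The sector omits its vertex, so \<open>-nu\<close> lies in the complement without being
  an interior point of it, and it has to be a regular point although the resolvent bound blows up
  there. Hence the need for a gap: \<open>nu\<close> times the squared norm of \<open>z\<close> is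
  at most Re a(z,z), thus at most \<open>\<alpha>\<close> times the squared gradient norm, and this
  substitute for Poincare's inequality turns the surplus gradient term into a multiple of the
  squared norm. The gap moves the vertex to the left and yields an open set on which the resolvent
  is holomorphic and which contains every admissible curve.

  An admissible curve is arbitrary near infinity: it may hug the boundary or wander, so the
  integrand need not be absolutely integrable along it. This is why the argument rests on end-point
  values of a primitive and not on estimates along the curve.

  Uniformity in \<open>h\<close> holds because the final constants come from \<open>k\<close> and
  \<open>nu\<close>. Bounds that depend on the finite element space only make series converge,
  control point values and fix the radius of the circle.\<close>

lemma sum_fun_apply: "(\<Sum>b\<in>B. f b) x = (\<Sum>b\<in>B. (f b x :: complex))"
  by (induction B rule: infinite_finite_induct) auto

text \<open>Dimension count: the images of a maximal independent subset of \<open>B\<close> stay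
  independent, so a vector of \<open>V\<close> outside their span would give one independent vector
  too many. Interpreting \<open>vector_space\<close> locally makes the generic dimension theory
  available for pointwise scaling of complex functions.\<close>

lemma inj_imp_surj_on_spanned:
  fixes V :: "('x \<Rightarrow> complex) set"
  assumes B: "finite B" "V = {(\<lambda>x. \<Sum>b\<in>B. c b * b x) | c. True}"
    and T_in: "\<And>u. u \<in> V \<Longrightarrow> T u \<in> V"
    and T_add: "\<And>u w. u \<in> V \<Longrightarrow> w \<in> V \<Longrightarrow> T (\<lambda>x. u x + w x) = (\<lambda>x. T u x + T w x)"
    and T_scale: "\<And>c u. u \<in> V \<Longrightarrow> T (\<lambda>x. c * u x) = (\<lambda>x. c * T u x)"
    and ker: "\<And>u. u \<in> V \<Longrightarrow> T u = (\<lambda>_. 0) \<Longrightarrow> u = (\<lambda>_. 0)"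
  shows "T ` V = V"
proof -
  define sc where "sc = (\<lambda>(c::complex) (f::'x\<Rightarrow>complex) x. c * f x)"
  interpret vs: vector_space sc
    by unfold_locales (auto simp: sc_def fun_eq_iff algebra_simps)
  have sum_sc: "(\<Sum>b\<in>S. sc (c b) (g b)) = (\<lambda>x. \<Sum>b\<in>S. c b * g b x)" for S c and g :: "('x\<Rightarrow>complex) \<Rightarrow> 'x \<Rightarrow> complex"
    by (auto simp: fun_eq_iff sum_fun_apply sc_def)
  have V: "V = vs.span B"
    unfolding vs.span_finite[OF B(1)] sum_sc B(2) by (auto simp: full_SetCompr_eq)
  obtain B0 where B0: "B0 \<subseteq> B" "vs.independent B0" "B \<subseteq> vs.span B0"
    using vs.maximal_independent_subset by blast
  have finB0: "finite B0" using B0 B finite_subset by blast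
  have V0: "V = vs.span B0"
    using V B0 by (simp add: vs.span_eq vs.span_superset vs.span_mono order_trans[OF _ vs.span_superset])
  have B0V: "B0 \<subseteq> V" using V0 vs.span_superset by auto
  have Tsum: "T (\<Sum>b\<in>S. sc (c b) b) = (\<Sum>b\<in>S. sc (c b) (T b))" if "S \<subseteq> V" "finite S" for S c
    using that(2,1)
  proof (induction S)
    case empty
    have "T (\<lambda>x. 0 * (\<lambda>_. 0) x) = (\<lambda>x. 0 * T (\<lambda>_. 0) x)"
      by (rule T_scale) (use V vs.span_zero in \<open>simp add: zero_fun_def\<close>)
    then show ?case by (simp add: zero_fun_def)
  next
    case (insert b S)
    have 1: "sc (c b) b \<in> V" "(\<Sum>b\<in>S. sc (c b) b) \<in> V"
      using insert V by (auto intro!: vs.span_scale vs.span_sum)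
    have "T (sc (c b) b) = sc (c b) (T b)" using T_scale[of b "c b"] insert by (simp add: sc_def)
    then show ?case using insert T_add[OF 1] by (simp add: plus_fun_def)
  qed
  have Tdiff: "T (u - w) = T u - T w" if "u \<in> V" "w \<in> V" for u w
  proof -
    have "sc (-1) w \<in> V" using V that vs.span_scale by blast
    then have "T (\<lambda>x. u x + (sc (-1) w) x) = (\<lambda>x. T u x + T (sc (-1) w) x)"
      using T_add that by blast
    moreover have "T (sc (-1) w) = sc (-1) (T w)" using T_scale[of w "-1"] that by (simp add: sc_def)
    moreover have "u - w = (\<lambda>x. u x + (sc (-1) w) x)" by (auto simp: sc_def)
    ultimately have "T (u - w) = (\<lambda>x. T u x + sc (-1) (T w) x)" by simp
    then show ?thesis by (auto simp: sc_def)
  qed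
  have inj: "inj_on T V"
  proof (rule inj_onI)
    fix u w assume uw: "u \<in> V" "w \<in> V" "T u = T w"
    then have "u - w \<in> V" using V vs.span_diff by auto
    moreover have "T (u - w) = (\<lambda>_. 0)" using Tdiff uw by (auto simp: zero_fun_def)
    ultimately have "u - w = (\<lambda>_. 0)" using ker by blast
    then show "u = w" by (auto simp: fun_eq_iff)
  qed
  then have inj0: "inj_on T B0" using B0V inj_on_subset by blast
  have fin: "finite (T ` B0)" using finB0 by simp
  have indep: "vs.independent (T ` B0)"
  proof (rule vs.independent_if_scalars_zero[OF fin])
    fix f y assume s: "(\<Sum>y\<in>T ` B0. sc (f y) y) = 0" and y: "y \<in> T ` B0"
    have "(\<Sum>y\<in>T ` B0. sc (f y) y) = (\<Sum>b\<in>B0. sc (f (T b)) (T b))"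
      by (simp add: sum.reindex[OF inj0])
    also have "\<dots> = T (\<Sum>b\<in>B0. sc (f (T b)) b)" using Tsum[OF B0V finB0, of "\<lambda>b. f (T b)"] by simp
    finally have "T (\<Sum>b\<in>B0. sc (f (T b)) b) = (\<lambda>_. 0)" using s by (simp add: zero_fun_def)
    moreover have "(\<Sum>b\<in>B0. sc (f (T b)) b) \<in> V" unfolding V0 by (intro vs.span_sum vs.span_scale vs.span_base)
    ultimately have s0: "(\<Sum>b\<in>B0. sc (f (T b)) b) = 0" using ker by (simp add: zero_fun_def)
    have "\<forall>b\<in>B0. f (T b) = 0"
    proof (rule ccontr)
      assume "\<not> ?thesis"
      then have "vs.dependent B0"
        unfolding vs.dependent_finite[OF finB0] using s0 by (intro exI[of _ "\<lambda>b. f (T b)"]) blast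
      then show False using B0(2) by simp
    qed
    then show "f y = 0" using y by auto
  qed
  have "V \<subseteq> vs.span (T ` B0)"
  proof (rule ccontr)
    assume "\<not> ?thesis"
    then obtain y where y: "y \<in> V" "y \<notin> vs.span (T ` B0)" by auto
    then have yn: "y \<notin> T ` B0" using vs.span_base by blast
    have "vs.independent (insert y (T ` B0))" using y indep vs.independent_insert by auto
    moreover have "insert y (T ` B0) \<subseteq> vs.span B0" using y V0 B0V T_in by auto
    ultimately have "card (insert y (T ` B0)) \<le> card B0" using vs.independent_span_bound finB0 by blast
    then show False using yn fin by (simp add: card_image[OF inj0])
  qed
  moreover have "vs.span (T ` B0) \<subseteq> T ` V"
  proof
    fix y assume "y \<in> vs.span (T ` B0)"
    then obtain c where "y = (\<Sum>y\<in>T ` B0. sc (c y) y)" using vs.span_finite[OF fin] by auto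
    also have "\<dots> = T (\<Sum>b\<in>B0. sc (c (T b)) b)" 
      using Tsum[OF B0V finB0, of "\<lambda>b. c (T b)"] by (simp add: sum.reindex[OF inj0])
    finally show "y \<in> T ` V" unfolding V0 by (auto intro!: imageI vs.span_sum vs.span_scale intro: vs.span_base)
  qed
  ultimately show ?thesis using T_in by auto
qed

text \<open>\<open>V\<close> is a set of functions and not a type, so all laws are relative to
  \<open>V\<close>. Definiteness refers to functions, not to classes modulo null sets; for the
  \<open>L2\<close> product it will come from the continuity of finite element functions.\<close>

locale fin_dim_ip =
  fixes V :: "('x \<Rightarrow> complex) set" and ip :: "('x \<Rightarrow> complex) \<Rightarrow> ('x \<Rightarrow> complex) \<Rightarrow> complex"
  assumes spanned: "\<exists>B. finite B \<and> B \<subseteq> V \<and> V = {(\<lambda>x. \<Sum>b\<in>B. c b * b x) | c. True}"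
    and ip_add: "u \<in> V \<Longrightarrow> w \<in> V \<Longrightarrow> y \<in> V \<Longrightarrow> ip (\<lambda>x. u x + w x) y = ip u y + ip w y"
    and ip_scale: "u \<in> V \<Longrightarrow> y \<in> V \<Longrightarrow> ip (\<lambda>x. c * u x) y = c * ip u y"
    and ip_cnj: "u \<in> V \<Longrightarrow> y \<in> V \<Longrightarrow> ip y u = cnj (ip u y)"
    and ip_pos: "u \<in> V \<Longrightarrow> u \<noteq> (\<lambda>_. 0) \<Longrightarrow> Re (ip u u) > 0"
begin

definition nrm :: "('x \<Rightarrow> complex) \<Rightarrow> real" where "nrm u = sqrt (Re (ip u u))"

lemma V_add: "u \<in> V \<Longrightarrow> w \<in> V \<Longrightarrow> (\<lambda>x. u x + w x) \<in> V"
proof -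
  obtain B where B: "V = {(\<lambda>x. \<Sum>b\<in>B. c b * b x) | c. True}" using spanned by auto
  assume "u \<in> V" "w \<in> V"
  then obtain c d where "u = (\<lambda>x. \<Sum>b\<in>B. c b * b x)" "w = (\<lambda>x. \<Sum>b\<in>B. d b * b x)" using B by auto
  then have "(\<lambda>x. u x + w x) = (\<lambda>x. \<Sum>b\<in>B. (c b + d b) * b x)" by (auto simp: sum.distrib algebra_simps)
  then show ?thesis using B by (auto intro!: exI[of _ "\<lambda>b. c b + d b"])
qed

lemma V_scale: "u \<in> V \<Longrightarrow> (\<lambda>x. a * u x) \<in> V"
proof -
  obtain B where B: "V = {(\<lambda>x. \<Sum>b\<in>B. c b * b x) | c. True}" using spanned by auto
  assume "u \<in> V"
  then obtain c where "u = (\<lambda>x. \<Sum>b\<in>B. c b * b x)" using B by auto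
  then have "(\<lambda>x. a * u x) = (\<lambda>x. \<Sum>b\<in>B. (a * c b) * b x)" by (auto simp: sum_distrib_left algebra_simps)
  then show ?thesis using B by (auto intro!: exI[of _ "\<lambda>b. a * c b"])
qed

lemma V_zero: "(\<lambda>_. 0) \<in> V"
proof -
  obtain B where "V = {(\<lambda>x. \<Sum>b\<in>B. c b * b x) | c. True}" using spanned by auto
  then show ?thesis by (auto intro!: exI[of _ "\<lambda>b. 0"])
qed

lemma V_diff: "u \<in> V \<Longrightarrow> w \<in> V \<Longrightarrow> (\<lambda>x. u x - w x) \<in> V"
  using V_add[OF _ V_scale[of w "-1"], of u] by simp

lemma V_sum: "finite S \<Longrightarrow> (\<And>i. i \<in> S \<Longrightarrow> f i \<in> V) \<Longrightarrow> (\<lambda>x. \<Sum>i\<in>S. f i x) \<in> V"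
  by (induction S rule: finite_induct) (auto simp: V_zero intro: V_add)

lemma ip_zero: "y \<in> V \<Longrightarrow> ip (\<lambda>_. 0) y = 0"
  using ip_scale[OF V_zero, of y 0] by simp

lemma ip_diff: "u \<in> V \<Longrightarrow> w \<in> V \<Longrightarrow> y \<in> V \<Longrightarrow> ip (\<lambda>x. u x - w x) y = ip u y - ip w y"
  using ip_add[OF _ V_scale[of w "-1"], of u] ip_scale[of w y "-1"] by simp

lemma ip_sum: "finite S \<Longrightarrow> (\<And>i. i \<in> S \<Longrightarrow> f i \<in> V) \<Longrightarrow> y \<in> V \<Longrightarrow> ip (\<lambda>x. \<Sum>i\<in>S. c i * f i x) y = (\<Sum>i\<in>S. c i * ip (f i) y)"
proof (induction S rule: finite_induct)
  case (insert i S)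
  then show ?case 
    using ip_add[OF V_scale[of "f i" "c i"] V_sum[of S "\<lambda>i x. c i * f i x"], of y]
    by (auto simp: ip_scale V_scale)
qed (auto simp: ip_zero)

lemma ip_self: "u \<in> V \<Longrightarrow> ip u u = of_real (Re (ip u u))"
  using ip_cnj[of u u] by (simp add: complex_eq_iff)

lemma ip_self_ge_0: "u \<in> V \<Longrightarrow> Re (ip u u) \<ge> 0"
  using ip_pos[of u] ip_zero[OF V_zero] by (cases "u = (\<lambda>_. 0)") auto

lemma nrm_sq: "u \<in> V \<Longrightarrow> (nrm u)\<^sup>2 = Re (ip u u)"
  by (simp add: nrm_def ip_self_ge_0)

lemma ip_self_nrm: "u \<in> V \<Longrightarrow> ip u u = of_real ((nrm u)\<^sup>2)"
  using ip_self nrm_sq by metis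

lemma nrm_ge_0: "u \<in> V \<Longrightarrow> nrm u \<ge> 0"
  by (simp add: nrm_def ip_self_ge_0)

lemma nrm_eq_0: "u \<in> V \<Longrightarrow> nrm u = 0 \<Longrightarrow> u = (\<lambda>_. 0)"
  using nrm_sq[of u] ip_pos[of u] by force

lemma nrm_scale: "u \<in> V \<Longrightarrow> nrm (\<lambda>x. c * u x) = cmod c * nrm u"
proof -
  assume u: "u \<in> V"
  have "ip (\<lambda>x. c * u x) (\<lambda>x. c * u x) = c * cnj c * ip u u"
    using u ip_scale[OF u V_scale[OF u], of c] ip_cnj[OF V_scale[OF u] u, of c] ip_scale[OF u u, of c] ip_cnj[OF u u]
    by (simp add: ip_cnj[OF V_scale[OF u] u])
  also have "\<dots> = of_real ((cmod c)\<^sup>2 * Re (ip u u))" using ip_self[OF u] complex_norm_square[of c]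
    by (metis of_real_mult)
  finally have "Re (ip (\<lambda>x. c * u x) (\<lambda>x. c * u x)) = (cmod c)\<^sup>2 * Re (ip u u)" by simp
  then show ?thesis by (simp add: nrm_def real_sqrt_mult)
qed

text \<open>\<open>B\<close> may be dependent: a vector with zero residual adds nothing to
  \<open>E\<close>. Recording the expansions of the elements of \<open>B\<close> keeps the induction
  going, because a new basis vector is orthogonal to everything already expanded.\<close>

lemma gram_schmidt:
  assumes "finite B" "B \<subseteq> V"
  shows "\<exists>E. finite E \<and> E \<subseteq> V \<and> (\<forall>e\<in>E. \<forall>e'\<in>E. ip e e' = (if e = e' then 1 else 0)) \<and>
             (\<forall>b\<in>B. \<forall>x. (\<Sum>e\<in>E. ip b e * e x) = b x)"
  using assms
proof (induction B rule: finite_induct)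
  case empty
  then show ?case by (auto intro!: exI[of _ "{}"])
next
  case (insert b B)
  from insert.prems have "B \<subseteq> V" by simp
  from insert.IH[OF this] obtain E where "finite E \<and> E \<subseteq> V \<and>
      (\<forall>e\<in>E. \<forall>e'\<in>E. ip e e' = (if e = e' then 1 else 0)) \<and> (\<forall>b\<in>B. \<forall>x. (\<Sum>e\<in>E. ip b e * e x) = b x)" ..
  then have E: "finite E" "E \<subseteq> V"
    "\<And>e e'. e\<in>E \<Longrightarrow> e'\<in>E \<Longrightarrow> ip e e' = (if e = e' then 1 else 0)"
    "\<And>b x. b\<in>B \<Longrightarrow> (\<Sum>e\<in>E. ip b e * e x) = b x" by simp_all
  have b: "b \<in> V" using insert by auto
  define p where "p = (\<lambda>x. \<Sum>e\<in>E. ip b e * e x)"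
  define r where "r = (\<lambda>x. b x - p x)"
  have p: "p \<in> V" unfolding p_def using E by (auto intro!: V_sum V_scale)
  have r: "r \<in> V" unfolding r_def using b p by (rule V_diff)
  have pe: "ip p e = ip b e" if "e \<in> E" for e
  proof -
    have "ip p e = (\<Sum>e'\<in>E. ip b e' * ip e' e)" unfolding p_def using E that by (intro ip_sum) auto
    also have "\<dots> = (\<Sum>e'\<in>E. if e' = e then ip b e' else 0)" using E(3) that by (intro sum.cong) auto
    finally show ?thesis using that E by simp
  qed
  have re: "ip r e = 0" if "e \<in> E" for e
    unfolding r_def using ip_diff[OF b p, of e] pe that E by auto
  have er: "ip e r = 0" if "e \<in> E" for e using ip_cnj[OF r, of e] re that E by auto
  show ?case
  proof (cases "r = (\<lambda>_. 0)")
    case True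
    then have "(\<Sum>e\<in>E. ip b e * e x) = b x" for x by (auto simp: r_def p_def fun_eq_iff)
    then show ?thesis using E by (intro exI[of _ E]) auto
  next
    case False
    define n where "n = nrm r"
    have n: "n > 0" using False r nrm_eq_0 nrm_ge_0 unfolding n_def by (metis order_le_less)
    define e0 where "e0 = (\<lambda>x. complex_of_real (1/n) * r x)"
    have e0: "e0 \<in> V" unfolding e0_def using r by (rule V_scale)
    have ee0: "ip e0 e = 0" "ip e e0 = 0" if "e \<in> E" for e
    proof -
      show "ip e0 e = 0" unfolding e0_def using that E(2) re ip_scale[OF r, of e "complex_of_real (1/n)"] by (metis mult_zero_right subsetD)
      then show "ip e e0 = 0" using ip_cnj[OF e0, of e] that E by auto
    qed
    have "nrm e0 = 1" unfolding e0_def using nrm_scale[OF r, of "complex_of_real (1/n)"] n by (simp add: n_def norm_divide)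
    then have e00: "ip e0 e0 = 1" using ip_self_nrm[OF e0] by simp
    have e0n: "e0 \<notin> E" using ee0 e00 by force
    have ibr: "ip b r = of_real (n\<^sup>2)"
    proof -
      have "ip p r = (\<Sum>e\<in>E. ip b e * ip e r)" unfolding p_def using E r by (intro ip_sum) auto
      then have "ip p r = 0" using er by simp
      moreover have "ip r r = ip b r - ip p r" using ip_diff[OF b p r] by (simp add: r_def[symmetric])
      ultimately show ?thesis using ip_self_nrm[OF r] by (simp add: n_def)
    qed
    have "ip e0 b = complex_of_real (1/n) * ip r b" unfolding e0_def by (rule ip_scale[OF r b])
    then have "ip b e0 = complex_of_real (1/n) * ip b r" using ip_cnj[OF e0 b] ip_cnj[OF r b] by simp
    then have be0: "ip b e0 = of_real n" using ibr n by (simp add: power2_eq_square)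
    have "(\<Sum>e\<in>insert e0 E. ip b e * e x) = b x" for x
    proof -
      have "b x = r x + p x" by (simp add: r_def)
      also have "r x = of_real n * e0 x" using n by (simp add: e0_def)
      finally show ?thesis using E(1) e0n be0 by (simp add: p_def)
    qed
    moreover have "(\<Sum>e\<in>insert e0 E. ip b' e * e x) = b' x" if b': "b' \<in> B" for b' x
    proof -
      have "ip b' e0 = ip (\<lambda>x. \<Sum>e\<in>E. ip b' e * e x) e0" using E(4)[OF b'] by simp
      also have "\<dots> = 0" using ip_sum[of E "\<lambda>e. e" e0 "\<lambda>e. ip b' e"] E ee0 e0 by (simp add: subset_iff)
      finally show ?thesis using E(1) E(4)[OF b'] e0n by simp
    qed
    ultimately show ?thesis using E(1-3) e0 ee0 e00 e0n
      by (intro exI[of _ "insert e0 E"]) auto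
  qed
qed

definition "ONB = (SOME E. finite E \<and> E \<subseteq> V \<and> (\<forall>e\<in>E. \<forall>e'\<in>E. ip e e' = (if e = e' then 1 else 0)) \<and>
             (\<forall>u\<in>V. \<forall>x. (\<Sum>e\<in>E. ip u e * e x) = u x))"

lemma ONB: "finite ONB" "ONB \<subseteq> V" "\<And>e e'. e\<in>ONB \<Longrightarrow> e'\<in>ONB \<Longrightarrow> ip e e' = (if e = e' then 1 else 0)"
  and ONB_expand: "\<And>u x. u\<in>V \<Longrightarrow> (\<Sum>e\<in>ONB. ip u e * e x) = u x"
proof -
  obtain B where B: "finite B" "B \<subseteq> V" "V = {(\<lambda>x. \<Sum>b\<in>B. c b * b x) | c. True}" using spanned by auto
  obtain E where E: "finite E" "E \<subseteq> V" "\<forall>e\<in>E. \<forall>e'\<in>E. ip e e' = (if e = e' then 1 else 0)"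
     "\<And>b x. b\<in>B \<Longrightarrow> (\<Sum>e\<in>E. ip b e * e x) = b x" using gram_schmidt[OF B(1,2)] by metis
  have "(\<Sum>e\<in>E. ip u e * e x) = u x" if "u \<in> V" for u x
  proof -
    have "u \<in> {(\<lambda>x. \<Sum>b\<in>B. c b * b x) | c. True}" using that B(3) by simp
    then obtain c where u: "u = (\<lambda>x. \<Sum>b\<in>B. c b * b x)" by blast
    have "u x = (\<Sum>b\<in>B. c b * (\<Sum>e\<in>E. ip b e * e x))" 
      unfolding u by (rule sum.cong[OF refl]) (simp add: E(4))
    also have "\<dots> = (\<Sum>e\<in>E. (\<Sum>b\<in>B. c b * ip b e) * e x)"
      by (simp add: sum_distrib_left sum_distrib_right sum.swap[of _ B E] mult_ac)
    also have "\<dots> = (\<Sum>e\<in>E. ip u e * e x)"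
      unfolding u using ip_sum[of B "\<lambda>b. b" _ c] B E by (intro sum.cong refl) (auto simp: subset_iff)
    finally show ?thesis by simp
  qed
  then have "\<exists>E. finite E \<and> E \<subseteq> V \<and> (\<forall>e\<in>E. \<forall>e'\<in>E. ip e e' = (if e = e' then 1 else 0)) \<and>
             (\<forall>u\<in>V. \<forall>x. (\<Sum>e\<in>E. ip u e * e x) = u x)" using E(1-3) by (intro exI[of _ E]) auto
  from someI_ex[OF this, folded ONB_def]
  show "finite ONB" "ONB \<subseteq> V" "\<And>e e'. e\<in>ONB \<Longrightarrow> e'\<in>ONB \<Longrightarrow> ip e e' = (if e = e' then 1 else 0)"
   "\<And>u x. u\<in>V \<Longrightarrow> (\<Sum>e\<in>ONB. ip u e * e x) = u x" by simp_all
qed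

lemma ip_parseval: assumes "u \<in> V" "w \<in> V" shows "ip u w = (\<Sum>e\<in>ONB. ip u e * cnj (ip w e))"
proof -
  have "ip u w = ip (\<lambda>x. \<Sum>e\<in>ONB. ip u e * e x) w" by (simp add: ONB_expand assms)
  also have "\<dots> = (\<Sum>e\<in>ONB. ip u e * ip e w)" using ip_sum[of ONB "\<lambda>e. e" w "ip u"] ONB assms by (auto simp: subset_iff)
  finally show ?thesis using ip_cnj[OF assms(2)] ONB by (auto intro!: sum.cong)
qed

lemma ip_ONB_comb: assumes "e \<in> ONB" shows "ip (\<lambda>x. \<Sum>e\<in>ONB. c e * e x) e = c e"
proof -
  have "ip (\<lambda>x. \<Sum>e\<in>ONB. c e * e x) e = (\<Sum>e'\<in>ONB. c e' * ip e' e)"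
    using ip_sum[of ONB "\<lambda>e. e" e c] ONB assms by (auto simp: subset_iff)
  also have "\<dots> = (\<Sum>e'\<in>ONB. if e' = e then c e else 0)" using ONB(3)[OF _ assms] by (intro sum.cong) auto
  finally show ?thesis using ONB(1) assms by simp
qed

text \<open>Coordinates make \<open>V\<close> isometric to a finite l2 space, from which the
  Cauchy-Schwarz and triangle inequalities are inherited.\<close>

lemma nrm_L2_set: "u \<in> V \<Longrightarrow> nrm u = L2_set (\<lambda>e. cmod (ip u e)) ONB"
proof -
  assume u: "u \<in> V"
  have "Re (ip u u) = (\<Sum>e\<in>ONB. (cmod (ip u e))\<^sup>2)"
    unfolding ip_parseval[OF u u] Re_sum by (intro sum.cong) (auto simp: complex_mult_cnj cmod_power2)
  then show ?thesis by (simp add: nrm_def L2_set_def)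
qed

lemma ip_cauchy_schwarz: assumes "u \<in> V" "w \<in> V" shows "cmod (ip u w) \<le> nrm u * nrm w"
proof -
  have "cmod (ip u w) \<le> (\<Sum>e\<in>ONB. \<bar>cmod (ip u e)\<bar> * \<bar>cmod (ip w e)\<bar>)"
    unfolding ip_parseval[OF assms] by (rule sum_norm_le) (simp add: norm_mult)
  also have "\<dots> \<le> nrm u * nrm w" unfolding nrm_L2_set[OF assms(1)] nrm_L2_set[OF assms(2)]
    by (rule L2_set_mult_ineq)
  finally show ?thesis .
qed

lemma nrm_triangle: assumes "u \<in> V" "w \<in> V" shows "nrm (\<lambda>x. u x + w x) \<le> nrm u + nrm w"
proof -
  have "nrm (\<lambda>x. u x + w x) = L2_set (\<lambda>e. cmod (ip (\<lambda>x. u x + w x) e)) ONB" by (rule nrm_L2_set[OF V_add[OF assms]])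
  also have "\<dots> \<le> L2_set (\<lambda>e. cmod (ip u e) + cmod (ip w e)) ONB"
    using ip_add[OF assms] ONB(2) by (intro L2_set_mono) (auto intro: norm_triangle_ineq simp: subset_iff)
  also have "\<dots> \<le> L2_set (\<lambda>e. cmod (ip u e)) ONB + L2_set (\<lambda>e. cmod (ip w e)) ONB" by (rule L2_set_triangle_ineq)
  finally show ?thesis using assms nrm_L2_set by simp
qed

lemma nrm_sum_le: "finite S \<Longrightarrow> (\<And>i. i \<in> S \<Longrightarrow> f i \<in> V) \<Longrightarrow> nrm (\<lambda>x. \<Sum>i\<in>S. f i x) \<le> (\<Sum>i\<in>S. nrm (f i))"
proof (induction S rule: finite_induct)
  case (insert i S)
  then show ?case using nrm_triangle[of "f i" "\<lambda>x. \<Sum>i\<in>S. f i x"] V_sum[of S f] by simp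
qed (simp add: nrm_def ip_zero[OF V_zero])

lemma ip_ONB_le: "u \<in> V \<Longrightarrow> e \<in> ONB \<Longrightarrow> cmod (ip u e) \<le> nrm u"
  using ip_cauchy_schwarz[of u e] ip_self_nrm[of e] ONB nrm_ge_0[of e]
  by (auto simp: nrm_def subset_iff)

text \<open>Point evaluations are continuous in finite dimension. The constant depends on
  \<open>x\<close> and \<open>V\<close>, which is harmless for what it carries: limits and remainder
  estimates for point values of the resolvent.\<close>

lemma eval_bounded: "\<exists>K\<ge>0. \<forall>u\<in>V. cmod (u x) \<le> K * nrm u"
proof (intro exI conjI ballI)
  show "(\<Sum>e\<in>ONB. cmod (e x)) \<ge> 0" by (rule sum_nonneg) auto
  fix u assume u: "u \<in> V"
  have "cmod (u x) \<le> (\<Sum>e\<in>ONB. nrm u * cmod (e x))"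
    unfolding ONB_expand[OF u, of x, symmetric] using ip_ONB_le[OF u]
    by (intro sum_norm_le) (auto simp: norm_mult intro: mult_right_mono)
  then show "cmod (u x) \<le> (\<Sum>e\<in>ONB. cmod (e x)) * nrm u" by (simp add: sum_distrib_left mult.commute)
qed

end

section \<open>Operators with numerical range in a sector\<close>

text \<open>Adding \<open>b\<close> does not decrease \<open>|Im w| + (2/3) k Re w\<close>, which at \<open>l\<close> is at least a multiple of \<open>|l|\<close>.\<close>

lemma sector_lower_bound:
  fixes l b :: complex and k N :: real
  assumes k: "k > 0" and N: "N \<ge> 0" and l: "\<bar>Im l\<bar> + k * Re l > 0"
    and b: "\<bar>Im b\<bar> \<le> 2/3 * k * Re b"
  shows "k / ((k+1) * (3 + 2*k)) * cmod l * N \<le> cmod (l * of_real N + b)"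
proof -
  define w where "w = l * of_real N + b"
  have Rw: "Re w = Re l * N + Re b" and Iw: "Im w = Im l * N + Im b" by (auto simp: w_def)
  \<comment> \<open>The critical case is Re l < 0. On the boundary ray |Im l| = - k Re l both sides
    agree, so 3(k+1) is exactly what the gap between \<open>k\<close> and \<open>2/3 * k\<close>
    yields. Multiplied by the factor 1 + 2k/3 that arises below, it becomes (k+1)(3+2k).\<close>
  have lb: "k * (\<bar>Re l\<bar> + \<bar>Im l\<bar>) \<le> 3 * (k+1) * (\<bar>Im l\<bar> + 2/3 * k * Re l)"
  proof (cases "Re l \<ge> 0")
    case True
    have "k * \<bar>Im l\<bar> \<le> 3 * (k+1) * \<bar>Im l\<bar>" using k by (intro mult_right_mono) auto
    moreover have "k * Re l \<le> (3 * (k+1) * (2/3 * k)) * Re l" using k True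
      by (intro mult_right_mono) (auto simp: field_simps)
    ultimately have "k * \<bar>Im l\<bar> + k * Re l \<le> 3 * (k+1) * \<bar>Im l\<bar> + (3 * (k+1) * (2/3 * k)) * Re l" by (rule add_mono)
    also have "\<dots> = 3 * (k+1) * (\<bar>Im l\<bar> + 2/3 * k * Re l)" by (simp only: distrib_left mult_ac)
    finally show ?thesis using True by (simp add: distrib_left add.commute)
  next
    case False
    define x where "x = - Re l" define y where "y = \<bar>Im l\<bar>"
    have xy: "x > 0" "y > k * x" using False l by (auto simp: x_def y_def)
    have "3 * (k+1) * (y - 2/3 * k * x) - k * (x + y) = (3 + 2 * k) * (y - k * x)" by (simp add: field_simps)
    also have "\<dots> \<ge> 0" using xy k by simp
    finally have "k * (x + y) \<le> 3 * (k+1) * (y - 2/3 * k * x)" by simp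
    then show ?thesis using False by (simp add: x_def y_def)
  qed
  have "cmod l * N * k \<le> k * (\<bar>Re l\<bar> + \<bar>Im l\<bar>) * N"
    using cmod_le[of l] k N by (simp add: mult_left_mono mult_right_mono mult_ac)
  also have "\<dots> \<le> 3 * (k+1) * (\<bar>Im l\<bar> + 2/3 * k * Re l) * N" using lb N by (intro mult_right_mono) auto
  finally have 1: "cmod l * N * k \<le> 3 * (k+1) * ((\<bar>Im l\<bar> + 2/3 * k * Re l) * N)" by (simp add: mult_ac)
  have "(\<bar>Im l\<bar> + 2/3 * k * Re l) * N \<le> \<bar>Im w\<bar> + 2/3 * k * Re w"
  proof -
    have "\<bar>Im l\<bar> * N = \<bar>Im l * N\<bar>" using N by (simp add: abs_mult)
    also have "\<dots> \<le> \<bar>Im w\<bar> + \<bar>Im b\<bar>" using Iw by simp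
    finally show ?thesis using b by (simp add: Rw algebra_simps add_divide_distrib)
  qed
  also have "\<dots> \<le> cmod w + 2/3 * k * cmod w"
    using abs_Im_le_cmod[of w] complex_Re_le_cmod[of w] k by (intro add_mono mult_left_mono) auto
  finally have "cmod l * N * k \<le> 3 * (k+1) * (cmod w + 2/3 * k * cmod w)"
    using 1 k by (smt (verit, best) mult_left_mono)
  also have "\<dots> = cmod w * ((k+1) * (3 + 2*k))" by (simp add: algebra_simps)
  finally have "cmod l * N * k / ((k+1) * (3 + 2*k)) \<le> cmod w"
    using k by (simp add: pos_divide_le_eq)
  then show ?thesis by (simp add: w_def mult_ac)
qed

text \<open>The angle between the point, seen from the vertex, and the negative real axis has
  tangent at most \<open>k\<close>. The contrapositive gets used: a point outside the sector is the
  vertex or satisfies a strict inequality, the form in which all estimates are stated.\<close>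

lemma mem_sector:
  assumes k: "k > 0" and ne: "\<mu> \<noteq> of_real a" and le: "\<bar>Im \<mu>\<bar> + k * (Re \<mu> - a) \<le> 0"
  shows "\<mu> \<in> sector a (pi - arctan k)"
proof -
  define l where "l = \<mu> - of_real a"
  define r where "r = cmod l"
  have l: "l \<noteq> 0" "\<bar>Im l\<bar> + k * Re l \<le> 0" using ne le by (auto simp: l_def)
  have r: "r > 0" using l by (simp add: r_def)
  have neg: "Re l < 0"
  proof (rule ccontr)
    assume "\<not> Re l < 0"
    then have "k * Re l \<ge> 0" using k by simp
    then have "k * Re l = 0" "Im l = 0" using l(2) by linarith+
    then have "l = 0" using k by (simp add: complex_eq_iff)
    then show False using l by simp
  qed
  define \<theta> where "\<theta> = Arg l"
  have lc: "l = of_real r * cis \<theta>" using Arg_eq[OF l(1)] by (simp add: r_def \<theta>_def cis_conv_exp)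
  have th: "-pi < \<theta>" "\<theta> \<le> pi" using Arg_bounded by (auto simp: \<theta>_def)
  define \<phi> where "\<phi> = pi - \<bar>\<theta>\<bar>"
  have ph: "0 \<le> \<phi>" "\<phi> \<le> pi" using th by (auto simp: \<phi>_def)
  have "cos \<phi> = - cos \<theta>" by (simp add: \<phi>_def abs_if)
  moreover have "sin \<phi> = \<bar>sin \<theta>\<bar>"
    using th sin_ge_zero[of \<theta>] sin_ge_zero[of "-\<theta>"] by (auto simp: \<phi>_def abs_if)
  moreover have "Re l = r * cos \<theta>" "Im l = r * sin \<theta>" by (auto simp: lc)
  ultimately have c: "r * cos \<phi> = - Re l" "r * sin \<phi> = \<bar>Im l\<bar>" using r by (auto simp: abs_mult)
  have cpos: "cos \<phi> > 0" using c neg r by (metis neg_0_less_iff_less zero_less_mult_pos)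
  have ph2: "\<phi> < pi/2"
  proof (rule ccontr)
    assume "\<not> ?thesis"
    then have "cos \<phi> \<le> cos (pi/2)" using ph by (intro cos_monotone_0_pi_le) auto
    then show False using cpos by simp
  qed
  have "r * sin \<phi> \<le> r * (k * cos \<phi>)" using c l(2) by (simp add: algebra_simps)
  then have "tan \<phi> \<le> k" using r cpos by (simp add: tan_def field_simps)
  then have "arctan (tan \<phi>) \<le> arctan k" by (rule arctan_monotone')
  then have "\<phi> \<le> arctan k" using arctan_tan[of \<phi>] ph ph2 by simp
  then have "\<bar>\<theta>\<bar> \<ge> pi - arctan k" by (simp add: \<phi>_def)
  moreover have "\<mu> = of_real a + of_real r * cis \<theta>" using lc by (simp add: l_def algebra_simps)
  ultimately show ?thesis unfolding sector_def using r th by blast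
qed

section \<open>Resolvent of an operator with sectorial numerical range\<close>

locale sectorial_op = fin_dim_ip V ip for V :: "('x \<Rightarrow> complex) set" and ip +
  fixes A :: "('x \<Rightarrow> complex) \<Rightarrow> 'x \<Rightarrow> complex" and nu c0 k :: real
  assumes A_in: "u \<in> V \<Longrightarrow> A u \<in> V"
    and A_add: "u \<in> V \<Longrightarrow> w \<in> V \<Longrightarrow> A (\<lambda>x. u x + w x) = (\<lambda>x. A u x + A w x)"
    and A_scale: "u \<in> V \<Longrightarrow> A (\<lambda>x. c * u x) = (\<lambda>x. c * A u x)"
    and nu: "nu > 0" and c0: "c0 > 0" and k: "k > 0"
    and num_Re: "u \<in> V \<Longrightarrow> c0 * Re (ip u u) \<le> - Re (ip (A u) u) - nu * Re (ip u u)"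
    and num_Im: "u \<in> V \<Longrightarrow> \<bar>Im (ip (A u) u)\<bar> \<le> 2/3 * k * (- Re (ip (A u) u) - nu * Re (ip u u))"
begin

definition S :: "complex \<Rightarrow> ('x \<Rightarrow> complex) \<Rightarrow> 'x \<Rightarrow> complex" where "S \<mu> = (\<lambda>u x. \<mu> * u x - A u x)"
definition R :: "complex \<Rightarrow> ('x \<Rightarrow> complex) \<Rightarrow> 'x \<Rightarrow> complex" where "R \<mu> = inv_into V (S \<mu>)"
text \<open>An open set containing the complement of the sector, vertex included. With p = Re of
  -<Au,u> - nu<u,u> at an eigenvector u, the imaginary part takes up two thirds of k p, and c0<u,u>
  is at most p; the remaining third of k p pays for a shift by exactly \<open>c0/3\<close>.\<close>

definition D :: "complex set" where "D = {\<mu>. \<bar>Im \<mu>\<bar> + k * (Re \<mu> + (nu + c0/3)) > 0}"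

lemma S_in: "u \<in> V \<Longrightarrow> S \<mu> u \<in> V"
  unfolding S_def by (intro V_diff V_scale A_in)

lemma S_add: "u \<in> V \<Longrightarrow> w \<in> V \<Longrightarrow> S \<mu> (\<lambda>x. u x + w x) = (\<lambda>x. S \<mu> u x + S \<mu> w x)"
  by (auto simp: S_def A_add algebra_simps)

lemma S_scale: "u \<in> V \<Longrightarrow> S \<mu> (\<lambda>x. c * u x) = (\<lambda>x. c * S \<mu> u x)"
  by (auto simp: S_def A_scale algebra_simps)

lemma ip_S: "u \<in> V \<Longrightarrow> ip (S \<mu> u) u = \<mu> * of_real ((nrm u)\<^sup>2) - ip (A u) u"
  unfolding S_def using ip_diff[OF V_scale[of u] A_in] ip_scale ip_self_nrm by simp

lemma bij_S:
  assumes "\<And>u. u \<in> V \<Longrightarrow> S \<mu> u = (\<lambda>_. 0) \<Longrightarrow> u = (\<lambda>_. 0)"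
  shows "bij_betw (S \<mu>) V V"
proof -
  obtain B where B: "finite B" "V = {(\<lambda>x. \<Sum>b\<in>B. c b * b x) | c. True}" using spanned by auto
  have 1: "S \<mu> ` V = V"
    by (rule inj_imp_surj_on_spanned[OF B S_in S_add S_scale assms])
  have "inj_on (S \<mu>) V"
  proof (rule inj_onI)
    fix u w assume uw: "u \<in> V" "w \<in> V" "S \<mu> u = S \<mu> w"
    have "S \<mu> (\<lambda>x. u x + (-1) * w x) = (\<lambda>x. S \<mu> u x + (-1) * S \<mu> w x)"
      using S_add[OF uw(1) V_scale[OF uw(2)], of \<mu> "-1"] S_scale[OF uw(2), of \<mu> "-1"] by simp
    then have "S \<mu> (\<lambda>x. u x - w x) = (\<lambda>_. 0)" using uw by simp
    then have "(\<lambda>x. u x - w x) = (\<lambda>_. 0)" using assms V_diff uw by blast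
    then show "u = w" by (auto simp: fun_eq_iff)
  qed
  then show ?thesis using 1 by (simp add: bij_betw_def)
qed

lemma S_lower:
  assumes u: "u \<in> V" and mu: "\<bar>Im \<mu>\<bar> + k * (Re \<mu> + nu) > 0"
  shows "k / ((k+1) * (3 + 2*k)) * cmod (\<mu> + of_real nu) * nrm u \<le> nrm (S \<mu> u)"
proof (cases "nrm u = 0")
  case True
  then show ?thesis using nrm_ge_0[OF S_in[OF u]] by simp
next
  case False
  then have pos: "nrm u > 0" using nrm_ge_0[OF u] by simp
  define b where "b = - ip (A u) u - of_real (nu * (nrm u)\<^sup>2)"
  have b: "\<bar>Im b\<bar> \<le> 2/3 * k * Re b" using num_Im[OF u] by (simp add: b_def nrm_sq[OF u])
  have "k / ((k+1) * (3 + 2*k)) * cmod (\<mu> + of_real nu) * (nrm u)\<^sup>2 \<le> cmod ((\<mu> + of_real nu) * of_real ((nrm u)\<^sup>2) + b)"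
    by (rule sector_lower_bound[OF k _ _ b]) (use mu in auto)
  also have "(\<mu> + of_real nu) * of_real ((nrm u)\<^sup>2) + b = ip (S \<mu> u) u"
    using ip_S[OF u] by (simp add: b_def algebra_simps)
  also have "cmod (ip (S \<mu> u) u) \<le> nrm (S \<mu> u) * nrm u" by (rule ip_cauchy_schwarz[OF S_in[OF u] u])
  finally have "(k / ((k+1) * (3 + 2*k)) * cmod (\<mu> + of_real nu) * nrm u) * nrm u \<le> nrm (S \<mu> u) * nrm u"
    by (simp add: power2_eq_square mult_ac)
  then show ?thesis using pos by (rule mult_right_le_imp_le)
qed

lemma bij_D: assumes "\<mu> \<in> D" shows "bij_betw (S \<mu>) V V"
proof (rule bij_S, rule ccontr)
  fix u assume u: "u \<in> V" "S \<mu> u = (\<lambda>_. 0)" "u \<noteq> (\<lambda>_. 0)"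
  define N where "N = Re (ip u u)"
  have N: "N > 0" using ip_pos u by (simp add: N_def)
  have "ip (S \<mu> u) u = 0" using u ip_zero by simp
  then have e: "ip (A u) u = \<mu> * of_real N" using ip_S[OF u(1)] by (simp add: nrm_sq[OF u(1)] N_def)
  define p where "p = - Re \<mu> * N - nu * N"
  have "\<bar>Im \<mu>\<bar> * N \<le> 2/3 * k * p" using num_Im[OF u(1)] N by (simp add: e N_def[symmetric] abs_mult p_def)
  moreover have "c0 * N \<le> p" using num_Re[OF u(1)] N by (simp add: e N_def[symmetric] p_def)
  then have "k * (c0 * N) \<le> k * p" using k by (intro mult_left_mono) auto
  moreover have "(\<bar>Im \<mu>\<bar> + k * (Re \<mu> + (nu + c0/3))) * N = \<bar>Im \<mu>\<bar> * N - k * p + k * (c0 * N) / 3"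
    by (simp add: p_def algebra_simps)
  ultimately have "(\<bar>Im \<mu>\<bar> + k * (Re \<mu> + (nu + c0/3))) * N \<le> 0" by simp
  then show False using N assms by (auto simp: D_def mult_le_0_iff)
qed

lemma not_sector_D: "\<mu> \<notin> sector (-nu) (pi - arctan k) \<Longrightarrow> \<mu> \<in> D"
proof -
  assume a: "\<mu> \<notin> sector (-nu) (pi - arctan k)"
  have "\<mu> = of_real (-nu) \<or> \<not> \<bar>Im \<mu>\<bar> + k * (Re \<mu> + nu) \<le> 0"
    using mem_sector[OF k, of \<mu> "-nu"] a by auto
  then have "\<bar>Im \<mu>\<bar> + k * (Re \<mu> + nu) \<ge> 0" by auto
  moreover have "k * c0 > 0" using k c0 by simp
  ultimately show ?thesis by (simp add: D_def algebra_simps)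
qed

lemma R_in: "bij_betw (S \<mu>) V V \<Longrightarrow> w \<in> V \<Longrightarrow> R \<mu> w \<in> V"
  unfolding R_def by (metis bij_betw_imp_surj_on inv_into_into)

lemma S_R: "bij_betw (S \<mu>) V V \<Longrightarrow> w \<in> V \<Longrightarrow> S \<mu> (R \<mu> w) = w"
  unfolding R_def by (simp add: bij_betw_inv_into_right[of "S \<mu>"])

lemma R_eqI: "bij_betw (S \<mu>) V V \<Longrightarrow> u \<in> V \<Longrightarrow> S \<mu> u = w \<Longrightarrow> R \<mu> w = u"
  unfolding R_def by (metis bij_betw_inv_into_left)

text \<open>The constant involves \<open>k\<close> alone and neither \<open>V\<close> nor a bound
  for \<open>A\<close>; this is the source of the uniformity in the mesh size.\<close>

lemma R_bound:
  assumes "\<mu> \<notin> sector (-nu) (pi - arctan k)" "\<mu> \<noteq> of_real (-nu)" "w \<in> V"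
  shows "nrm (R \<mu> w) \<le> ((k+1) * (3 + 2*k)) / k / cmod (\<mu> + of_real nu) * nrm w"
proof -
  have mu: "\<bar>Im \<mu>\<bar> + k * (Re \<mu> + nu) > 0" using mem_sector[OF k, of \<mu> "-nu"] assms by (auto simp: not_le[symmetric])
  have b: "bij_betw (S \<mu>) V V" using bij_D[OF not_sector_D] assms by simp
  have p: "k / ((k+1) * (3 + 2*k)) * cmod (\<mu> + of_real nu) > 0"
    using k assms(2) by (auto simp: add_eq_0_iff2)
  have "k / ((k+1) * (3 + 2*k)) * cmod (\<mu> + of_real nu) * nrm (R \<mu> w) \<le> nrm w"
    using S_lower[OF R_in[OF b assms(3)] mu] S_R[OF b assms(3)] by simp
  then have "nrm (R \<mu> w) \<le> nrm w / (k / ((k+1) * (3 + 2*k)) * cmod (\<mu> + of_real nu))"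
    unfolding pos_le_divide_eq[OF p] by (simp only: mult.commute mult.left_commute)
  then show ?thesis by (simp add: mult.commute)
qed

lemma linear_ONB_expand:
  assumes L_add: "\<And>u w. u \<in> V \<Longrightarrow> w \<in> V \<Longrightarrow> L (\<lambda>x. u x + w x) = (\<lambda>x. L u x + L w x)"
    and L_scale: "\<And>c u. u \<in> V \<Longrightarrow> L (\<lambda>x. c * u x) = (\<lambda>x. c * L u x)"
    and u: "u \<in> V"
  shows "L u = (\<lambda>x. \<Sum>e\<in>ONB. ip u e * L e x)"
proof -
  have "L (\<lambda>x. \<Sum>e\<in>E. c e * e x) = (\<lambda>x. \<Sum>e\<in>E. c e * L e x)" if "finite E" "E \<subseteq> V" for E c
    using that
  proof (induction E rule: finite_induct)
    case empty
    show ?case using L_scale[OF V_zero, of 0] by simp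
  next
    case (insert e E)
    have "(\<lambda>x. \<Sum>e\<in>E. c e * e x) \<in> V" using insert by (auto intro!: V_sum V_scale)
    then show ?case using insert L_add[OF V_scale[of e "c e"], of "\<lambda>x. \<Sum>e\<in>E. c e * e x"] L_scale[of e "c e"] by simp
  qed
  from this[OF ONB(1,2), of "ip u"] show ?thesis by (simp add: ONB_expand[OF u])
qed

text \<open>The bound depends on the space. It serves qualitative purposes: convergence of the
  exponential series, local bounds for the resolvent, the radius of the large circle.\<close>

lemma linear_bounded:
  assumes L_in: "\<And>u. u \<in> V \<Longrightarrow> L u \<in> V"
    and L_add: "\<And>u w. u \<in> V \<Longrightarrow> w \<in> V \<Longrightarrow> L (\<lambda>x. u x + w x) = (\<lambda>x. L u x + L w x)"
    and L_scale: "\<And>c u. u \<in> V \<Longrightarrow> L (\<lambda>x. c * u x) = (\<lambda>x. c * L u x)"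
  shows "\<exists>M>0. \<forall>u\<in>V. nrm (L u) \<le> M * nrm u"
proof -
  define M where "M = 1 + (\<Sum>e\<in>ONB. nrm (L e))"
  have Lpos: "nrm (L e) \<ge> 0" if "e \<in> ONB" for e using that ONB L_in nrm_ge_0 by auto
  have "nrm (L u) \<le> M * nrm u" if u: "u \<in> V" for u
  proof -
    have "L u = (\<lambda>x. \<Sum>e\<in>ONB. ip u e * L e x)" by (rule linear_ONB_expand[OF L_add L_scale u])
    then have "nrm (L u) \<le> (\<Sum>e\<in>ONB. nrm (\<lambda>x. ip u e * L e x))"
      using nrm_sum_le[OF ONB(1), of "\<lambda>e x. ip u e * L e x"] ONB(2) L_in V_scale by (simp add: subset_iff)
    also have "\<dots> = (\<Sum>e\<in>ONB. cmod (ip u e) * nrm (L e))"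
      using ONB(2) L_in by (intro sum.cong refl nrm_scale) auto
    also have "\<dots> \<le> (\<Sum>e\<in>ONB. nrm u * nrm (L e))"
      using ip_ONB_le[OF u] Lpos by (intro sum_mono mult_right_mono) auto
    also have "\<dots> \<le> M * nrm u" using nrm_ge_0[OF u] by (simp add: M_def algebra_simps sum_distrib_left)
    finally show ?thesis .
  qed
  moreover have "M > 0" unfolding M_def using sum_nonneg[of ONB "\<lambda>e. nrm (L e)"] Lpos by force
  ultimately show ?thesis by blast
qed

lemma A_bounded: "\<exists>M>0. \<forall>u\<in>V. nrm (A u) \<le> M * nrm u"
  by (rule linear_bounded[OF A_in A_add A_scale])

lemma R_add: assumes "bij_betw (S \<mu>) V V" "u \<in> V" "w \<in> V"
  shows "R \<mu> (\<lambda>x. u x + w x) = (\<lambda>x. R \<mu> u x + R \<mu> w x)"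
  using assms by (intro R_eqI) (auto simp: V_add R_in S_add S_R)

lemma R_scale: assumes "bij_betw (S \<mu>) V V" "u \<in> V"
  shows "R \<mu> (\<lambda>x. c * u x) = (\<lambda>x. c * R \<mu> u x)"
  using assms by (intro R_eqI) (auto simp: V_scale R_in S_scale S_R)

lemma R_identity:
  assumes "bij_betw (S \<mu>) V V" "bij_betw (S \<mu>') V V" "w \<in> V"
  shows "R \<mu> w = (\<lambda>x. (\<mu>' - \<mu>) * R \<mu> (R \<mu>' w) x + R \<mu>' w x)"
proof (rule R_eqI[OF assms(1)])
  have i: "R \<mu>' w \<in> V" "R \<mu> (R \<mu>' w) \<in> V" using assms R_in by auto
  show "(\<lambda>x. (\<mu>' - \<mu>) * R \<mu> (R \<mu>' w) x + R \<mu>' w x) \<in> V" using i by (intro V_add V_scale)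
  have "S \<mu> (\<lambda>x. (\<mu>' - \<mu>) * R \<mu> (R \<mu>' w) x + R \<mu>' w x) = (\<lambda>x. (\<mu>' - \<mu>) * R \<mu>' w x + S \<mu> (R \<mu>' w) x)"
    using S_add[OF V_scale[OF i(2)] i(1)] S_scale[OF i(2)] S_R[OF assms(1) i(1)] by simp
  also have "\<dots> = S \<mu>' (R \<mu>' w)" by (auto simp: S_def algebra_simps)
  finally show "S \<mu> (\<lambda>x. (\<mu>' - \<mu>) * R \<mu> (R \<mu>' w) x + R \<mu>' w x) = w" using S_R[OF assms(2,3)] by simp
qed

text \<open>By the resolvent identity the norm of \<open>R \<mu> w\<close> is at most |mu' - mu| M
  times itself plus M times the norm of \<open>w\<close>; within distance 1/(2M) the first term is
  absorbed.\<close>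

lemma R_locally_bounded:
  assumes b: "bij_betw (S \<mu>') V V"
  shows "\<exists>M>0. \<exists>d>0. \<forall>\<mu> w. dist \<mu> \<mu>' < d \<and> bij_betw (S \<mu>) V V \<and> w \<in> V \<longrightarrow> nrm (R \<mu> w) \<le> M * nrm w"
proof -
  obtain M where M: "M > 0" "\<And>u. u\<in>V \<Longrightarrow> nrm (R \<mu>' u) \<le> M * nrm u"
    using linear_bounded[of "R \<mu>'", OF R_in[OF b] R_add[OF b] R_scale[OF b]] by blast
  have "nrm (R \<mu> w) \<le> 2 * M * nrm w"
    if d: "dist \<mu> \<mu>' < 1 / (2*M)" and b': "bij_betw (S \<mu>) V V" and w: "w \<in> V" for \<mu> w
  proof -
    have i: "R \<mu> w \<in> V" "R \<mu>' (R \<mu> w) \<in> V" "R \<mu>' w \<in> V" using R_in b b' w by auto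
    have "R \<mu> w = (\<lambda>x. (\<mu>' - \<mu>) * R \<mu>' (R \<mu> w) x + R \<mu>' w x)"
      using R_identity[OF b b' w] by (auto simp: fun_eq_iff algebra_simps)
    then have "nrm (R \<mu> w) \<le> cmod (\<mu>' - \<mu>) * nrm (R \<mu>' (R \<mu> w)) + nrm (R \<mu>' w)"
      using nrm_triangle[OF V_scale[OF i(2)] i(3)] nrm_scale[OF i(2)] by metis
    also have "\<dots> \<le> 1 / (2*M) * (M * nrm (R \<mu> w)) + M * nrm w"
      using d M(2)[OF i(1)] M(2)[OF w] nrm_ge_0[OF i(2)] M(1)
      by (intro add_mono mult_mono) (auto simp: dist_norm norm_minus_commute)
    finally show ?thesis using M(1) by simp
  qed
  then show ?thesis using M(1) by (intro exI[of _ "2*M"] conjI exI[of _ "1/(2*M)"]) auto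
qed

lemma open_D: "open D"
  unfolding D_def by (intro open_Collect_less continuous_intros)

lemma R_continuous:
  assumes mu: "\<mu>' \<in> D" and w: "w \<in> V"
  shows "((\<lambda>\<mu>. R \<mu> w x) \<longlongrightarrow> R \<mu>' w x) (at \<mu>')"
proof -
  note b = bij_D[OF mu]
  obtain M d where M: "M > 0" "d > 0" "\<And>\<mu> w. dist \<mu> \<mu>' < d \<Longrightarrow> bij_betw (S \<mu>) V V \<Longrightarrow> w \<in> V \<Longrightarrow> nrm (R \<mu> w) \<le> M * nrm w"
    using R_locally_bounded[OF b] by blast
  obtain K where K: "K \<ge> 0" "\<And>u. u\<in>V \<Longrightarrow> cmod (u x) \<le> K * nrm u" using eval_bounded by blast
  have "eventually (\<lambda>\<mu>. \<mu> \<in> D \<and> dist \<mu> \<mu>' < d) (at \<mu>')"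
    using eventually_at_in_open'[OF open_D mu] M(2) eventually_at_ball'[of d \<mu>' UNIV]
    by (auto simp: dist_commute elim: eventually_elim2)
  then have "eventually (\<lambda>\<mu>. norm (R \<mu> w x - R \<mu>' w x) \<le> cmod (\<mu>' - \<mu>) * (K * (M * nrm (R \<mu>' w)))) (at \<mu>')"
  proof (rule eventually_mono)
    fix \<mu> assume m: "\<mu> \<in> D \<and> dist \<mu> \<mu>' < d"
    then have b': "bij_betw (S \<mu>) V V" using bij_D by auto
    have i: "R \<mu>' w \<in> V" "R \<mu> (R \<mu>' w) \<in> V" using R_in b b' w by auto
    have "R \<mu> w x - R \<mu>' w x = (\<mu>' - \<mu>) * R \<mu> (R \<mu>' w) x"
      by (subst R_identity[OF b' b w]) simp
    moreover have "cmod (R \<mu> (R \<mu>' w) x) \<le> K * (M * nrm (R \<mu>' w))"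
      using K(2)[OF i(2)] mult_left_mono[OF M(3)[of \<mu> "R \<mu>' w"] K(1)] m b' i by fastforce
    ultimately show "norm (R \<mu> w x - R \<mu>' w x) \<le> cmod (\<mu>' - \<mu>) * (K * (M * nrm (R \<mu>' w)))"
      by (simp add: norm_mult mult_left_mono)
  qed
  then have "((\<lambda>\<mu>. R \<mu> w x - R \<mu>' w x) \<longlongrightarrow> 0) (at \<mu>')"
    by (rule Lim_null_comparison) (auto intro!: tendsto_eq_intros)
  then show ?thesis by (simp add: LIM_zero_iff)
qed

text \<open>The resolvent identity writes the difference quotient as - R(mu) applied to the fixed
  vector \<open>R \<mu>' w\<close>, so continuity of the resolvent suffices and the derivative is -
  R(mu')^2 w.\<close>

lemma R_holomorphic:
  assumes w: "w \<in> V"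
  shows "(\<lambda>\<mu>. R \<mu> w x) holomorphic_on D"
proof (rule holomorphic_onI)
  fix \<mu>' assume mu: "\<mu>' \<in> D"
  note b = bij_D[OF mu]
  have i: "R \<mu>' w \<in> V" using R_in b w by auto
  have "((\<lambda>\<mu>. - R \<mu> (R \<mu>' w) x) \<longlongrightarrow> - R \<mu>' (R \<mu>' w) x) (at \<mu>')"
    by (intro tendsto_minus R_continuous mu i)
  moreover have "eventually (\<lambda>\<mu>. - R \<mu> (R \<mu>' w) x = (R \<mu> w x - R \<mu>' w x) / (\<mu> - \<mu>')) (at \<mu>')"
    using eventually_at_in_open[OF open_D mu]
  proof (rule eventually_mono)
    fix \<mu> assume m: "\<mu> \<in> D - {\<mu>'}"
    then have b': "bij_betw (S \<mu>) V V" using bij_D by auto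
    have "R \<mu> w x - R \<mu>' w x = - ((\<mu> - \<mu>') * R \<mu> (R \<mu>' w) x)"
      by (subst R_identity[OF b' b w]) (simp add: algebra_simps)
    then show "- R \<mu> (R \<mu>' w) x = (R \<mu> w x - R \<mu>' w x) / (\<mu> - \<mu>')" using m by auto
  qed
  ultimately have "((\<lambda>\<mu>. (R \<mu> w x - R \<mu>' w x) / (\<mu> - \<mu>')) \<longlongrightarrow> - R \<mu>' (R \<mu>' w) x) (at \<mu>')"
    by (rule Lim_transform_eventually)
  then have "((\<lambda>\<mu>. R \<mu> w x) has_field_derivative - R \<mu>' (R \<mu>' w) x) (at \<mu>')"
    by (simp add: has_field_derivative_iff)
  then show "(\<lambda>\<mu>. R \<mu> w x) field_differentiable at \<mu>' within D"
    by (meson field_differentiable_def field_differentiable_at_within)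
qed

lemma Apow_in: "z \<in> V \<Longrightarrow> (A ^^ n) z \<in> V"
  by (induction n) (auto simp: A_in)

lemma Apow_bound:
  assumes M: "M > 0" "\<And>u. u\<in>V \<Longrightarrow> nrm (A u) \<le> M * nrm u" and z: "z \<in> V"
  shows "nrm ((A ^^ n) z) \<le> M ^ n * nrm z"
proof (induction n)
  case (Suc n)
  have "nrm ((A ^^ Suc n) z) \<le> M * nrm ((A ^^ n) z)" using M(2)[OF Apow_in[OF z]] by simp
  also have "\<dots> \<le> M * (M ^ n * nrm z)" using Suc M by (intro mult_left_mono) auto
  finally show ?case by simp
qed simp

text \<open>The radius is twice the bound of \<open>A\<close>: this gives the resolvent bound 1/M
  and also the ratio 1/2 in the Neumann remainder.\<close>

lemma R_large:
  assumes M: "M > 0" "\<And>u. u\<in>V \<Longrightarrow> nrm (A u) \<le> M * nrm u" and mu: "cmod \<mu> \<ge> 2 * M"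
  shows "bij_betw (S \<mu>) V V" "w \<in> V \<Longrightarrow> nrm (R \<mu> w) \<le> nrm w / M"
proof -
  have low: "M * nrm u \<le> nrm (S \<mu> u)" if u: "u \<in> V" for u
  proof -
    have "cmod \<mu> * nrm u = nrm (\<lambda>x. S \<mu> u x + A u x)" using nrm_scale[OF u] by (simp add: S_def)
    also have "\<dots> \<le> nrm (S \<mu> u) + nrm (A u)" by (rule nrm_triangle[OF S_in[OF u] A_in[OF u]])
    also have "\<dots> \<le> nrm (S \<mu> u) + M * nrm u" using M(2)[OF u] by simp
    moreover have "2 * M * nrm u \<le> cmod \<mu> * nrm u" using mu nrm_ge_0[OF u] by (intro mult_right_mono)
    ultimately show ?thesis by linarith
  qed
  show b: "bij_betw (S \<mu>) V V"
  proof (rule bij_S)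
    fix u assume u: "u \<in> V" "S \<mu> u = (\<lambda>_. 0)"
    then have "M * nrm u \<le> 0" using low[OF u(1)] ip_zero[OF V_zero] by (simp add: nrm_def)
    then have "nrm u = 0" using M nrm_ge_0[OF u(1)] by (simp add: mult_le_0_iff)
    then show "u = (\<lambda>_. 0)" using nrm_eq_0 u by blast
  qed
  assume w: "w \<in> V"
  show "nrm (R \<mu> w) \<le> nrm w / M"
    using low[OF R_in[OF b w]] S_R[OF b w] M by (simp add: pos_le_divide_eq mult.commute)
qed

text \<open>A finite Neumann sum with exact remainder, obtained by iterating R(mu) y = (y + R(mu) A
  y) / mu. No convergence is involved at this stage.\<close>

lemma R_neumann:
  assumes b: "bij_betw (S \<mu>) V V" and ne: "\<mu> \<noteq> 0" and w: "w \<in> V"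
  shows "R \<mu> w x = (\<Sum>n<N. (A ^^ n) w x / \<mu> ^ Suc n) + R \<mu> ((A ^^ N) w) x / \<mu> ^ N"
proof (induction N)
  case (Suc N)
  define y where "y = (A ^^ N) w"
  have y: "y \<in> V" using Apow_in w by (simp add: y_def)
  have Ry: "R \<mu> y \<in> V" using R_in[OF b y] .
  have "R \<mu> (A y) = (\<lambda>x. \<mu> * R \<mu> y x - y x)"
  proof (rule R_eqI[OF b])
    show "(\<lambda>x. \<mu> * R \<mu> y x - y x) \<in> V" by (intro V_diff V_scale Ry y)
    have "S \<mu> (\<lambda>x. \<mu> * R \<mu> y x + (-1) * y x) = (\<lambda>x. \<mu> * y x + (-1) * S \<mu> y x)"
      using S_add[OF V_scale[OF Ry, of \<mu>] V_scale[OF y, of "-1"], of \<mu>] S_scale[OF Ry, of \<mu> \<mu>]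
        S_scale[OF y, of \<mu> "-1"] by (simp add: S_R[OF b y])
    then show "S \<mu> (\<lambda>x. \<mu> * R \<mu> y x - y x) = A y" by (simp add: S_def)
  qed
  then have "R \<mu> y x = (R \<mu> (A y) x + y x) / \<mu>" using ne by simp
  then have "R \<mu> y x / \<mu> ^ N = y x / \<mu> ^ Suc N + R \<mu> (A y) x / \<mu> ^ Suc N"
    by (simp add: add_divide_distrib)
  then show ?case using Suc by (simp add: y_def)
qed simp

end

section \<open>The exponential of the operator and its energy estimate\<close>

context sectorial_op
begin

text \<open>The coordinate of exp(zeta A) z along \<open>e\<close>, as a scalar power series in
  zeta. Working coordinatewise lets termwise differentiation of scalar series replace calculus in an
  operator norm.\<close>

definition cexp :: "('x \<Rightarrow> complex) \<Rightarrow> ('x \<Rightarrow> complex) \<Rightarrow> complex \<Rightarrow> complex" where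
  "cexp z e \<zeta> = (\<Sum>n. ip ((A ^^ n) z) e / fact n * \<zeta> ^ n)"

definition E :: "complex \<Rightarrow> ('x \<Rightarrow> complex) \<Rightarrow> 'x \<Rightarrow> complex" where
  "E \<zeta> z = (\<lambda>x. \<Sum>e\<in>ONB. cexp z e \<zeta> * e x)"

lemma summable_cexp:
  assumes "z \<in> V" "e \<in> ONB"
  shows "summable (\<lambda>n. ip ((A ^^ n) z) e / fact n * \<zeta> ^ n)"
proof -
  obtain M where M: "M > 0" "\<And>u. u\<in>V \<Longrightarrow> nrm (A u) \<le> M * nrm u" using A_bounded by blast
  have s: "summable (\<lambda>n. inverse (fact n) * (M * cmod \<zeta>) ^ n * nrm z)"
    using summable_exp[of "M * cmod \<zeta>"] by (rule summable_mult2)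
  show ?thesis
  proof (rule summable_comparison_test'[OF s, of 0])
    fix n :: nat
    have "cmod (ip ((A ^^ n) z) e) \<le> M ^ n * nrm z"
      using ip_ONB_le[OF Apow_in[OF assms(1)] assms(2)] Apow_bound[OF M assms(1)] by (rule order_trans)
    then have "cmod \<zeta> ^ n * cmod (ip ((A ^^ n) z) e) \<le> cmod \<zeta> ^ n * (M ^ n * nrm z)" by (rule mult_left_mono) simp
    then show "norm (ip ((A ^^ n) z) e / fact n * \<zeta> ^ n) \<le> inverse (fact n) * (M * cmod \<zeta>) ^ n * nrm z"
      by (simp add: norm_mult norm_divide norm_power power_mult_distrib field_simps)
  qed
qed

lemma E_in: "E \<zeta> z \<in> V"
  unfolding E_def using ONB by (intro V_sum V_scale) auto

lemma ip_E: "e \<in> ONB \<Longrightarrow> ip (E \<zeta> z) e = cexp z e \<zeta>"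
  unfolding E_def by (rule ip_ONB_comb)

lemma E_series:
  assumes z: "z \<in> V"
  shows "(\<lambda>n. \<zeta> ^ n / of_nat (fact n) * (A ^^ n) z x) sums E \<zeta> z x"
proof -
  have "(\<lambda>n. \<Sum>e\<in>ONB. ip ((A ^^ n) z) e / fact n * \<zeta> ^ n * e x) sums (\<Sum>e\<in>ONB. cexp z e \<zeta> * e x)"
    unfolding cexp_def using summable_cexp[OF z] by (intro sums_sum sums_mult2 summable_sums) auto
  moreover have "(\<Sum>e\<in>ONB. ip ((A ^^ n) z) e / fact n * \<zeta> ^ n * e x) = \<zeta> ^ n / of_nat (fact n) * (A ^^ n) z x" for n
    by (subst ONB_expand[OF Apow_in[OF z], symmetric]) (simp add: sum_distrib_left mult_ac)
  ultimately show ?thesis by (simp add: E_def)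
qed

lemma ip_A_expand:
  assumes u: "u \<in> V" and e: "e \<in> ONB"
  shows "ip (A u) e = (\<Sum>e'\<in>ONB. ip u e' * ip (A e') e)"
proof -
  have "A u = (\<lambda>x. \<Sum>e\<in>ONB. ip u e * A e x)" by (rule linear_ONB_expand[OF A_add A_scale u])
  moreover have "ip (\<lambda>x. \<Sum>e\<in>ONB. ip u e * A e x) e = (\<Sum>e'\<in>ONB. ip u e' * ip (A e') e)"
    using ONB(1,2) A_in e by (intro ip_sum) auto
  ultimately show ?thesis by simp
qed

text \<open>The differential equation u' = A u in coordinates: \<open>diffs\<close> shifts the
  coefficient index by one, which inserts one more factor \<open>A\<close>.\<close>

lemma cexp_deriv:
  assumes z: "z \<in> V" and e: "e \<in> ONB"
  shows "(cexp z e has_field_derivative ip (A (E \<zeta> z)) e) (at \<zeta>)"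
proof -
  have 1: "((\<lambda>x. \<Sum>n. ip ((A ^^ n) z) e / fact n * x ^ n) has_field_derivative
        (\<Sum>n. diffs (\<lambda>n. ip ((A ^^ n) z) e / fact n) n * \<zeta> ^ n)) (at \<zeta>)"
    by (rule termdiffs_strong_converges_everywhere) (rule summable_cexp[OF z e])
  have d: "diffs (\<lambda>n. ip ((A ^^ n) z) e / fact n) n * \<zeta> ^ n = (\<Sum>e'\<in>ONB. ip ((A ^^ n) z) e' / fact n * \<zeta> ^ n * ip (A e') e)" for n
  proof -
    have "diffs (\<lambda>n. ip ((A ^^ n) z) e / fact n) n = ip (A ((A ^^ n) z)) e / fact n"
      by (simp add: diffs_def field_simps del: of_nat_Suc)
    then show ?thesis by (simp add: ip_A_expand[OF Apow_in[OF z] e] sum_distrib_left sum_divide_distrib mult_ac)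
  qed
  have "(\<lambda>n. \<Sum>e'\<in>ONB. ip ((A ^^ n) z) e' / fact n * \<zeta> ^ n * ip (A e') e) sums (\<Sum>e'\<in>ONB. cexp z e' \<zeta> * ip (A e') e)"
    unfolding cexp_def using summable_cexp[OF z] by (intro sums_sum sums_mult2 summable_sums) auto
  then have "(\<Sum>n. diffs (\<lambda>n. ip ((A ^^ n) z) e / fact n) n * \<zeta> ^ n) = ip (A (E \<zeta> z)) e"
    unfolding d by (simp add: sums_iff ip_A_expand[OF E_in e] ip_E)
  then show ?thesis using 1 by (simp add: cexp_def[abs_def])
qed

text \<open>Along the ray s -> s zeta the energy has derivative 2 Re (zeta <Au,u>), and a Gronwall
  factor finishes. Leaving the direction zeta free covers decay in real time (zeta = 1, rate
  \<open>nu\<close>) and contractivity in a complex sector (rate 0, s = 1).\<close>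

lemma E_bound:
  assumes z: "z \<in> V" and s: "s \<ge> 0"
    and num: "\<And>u. u \<in> V \<Longrightarrow> Re (\<zeta> * ip (A u) u) \<le> - \<kappa> * Re (ip u u)"
  shows "nrm (E (of_real s * \<zeta>) z) \<le> exp (- \<kappa> * s) * nrm z"
proof -
  define c where "c = (\<lambda>e t. cexp z e (of_real t * \<zeta>))"
  define u where "u = (\<lambda>t. E (of_real t * \<zeta>) z)"
  have u: "u t \<in> V" for t by (simp add: u_def E_in)
  have ipu: "ip (u t) e = c e t" if "e \<in> ONB" for e t using ip_E[OF that] by (simp add: u_def c_def)
  \<comment> \<open>The energy as a function of the real variable t; real and imaginary parts are
    squared separately because the modulus squared is not complex differentiable.\<close>
  define h where "h = (\<lambda>t. \<Sum>e\<in>ONB. (Re (c e t))\<^sup>2 + (Im (c e t))\<^sup>2)"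
  have hn: "h t = Re (ip (u t) (u t))" for t
    unfolding h_def ip_parseval[OF u u] Re_sum using ipu
    by (intro sum.cong) (auto simp: complex_mult_cnj)
  have dc: "(c e has_vector_derivative (\<zeta> * ip (A (u t)) e)) (at t)" if e: "e \<in> ONB" for e t
  proof -
    have "((\<lambda>t. of_real t * \<zeta>) has_vector_derivative \<zeta>) (at t)"
      by (auto intro!: derivative_eq_intros)
    from field_vector_diff_chain_at[OF this cexp_deriv[OF z e]]
    show ?thesis by (simp add: c_def u_def o_def)
  qed
  have dh: "(h has_real_derivative 2 * Re (\<zeta> * ip (A (u t)) (u t))) (at t)" for t
  proof -
    have "(h has_real_derivative (\<Sum>e\<in>ONB. 2 * Re (c e t) * Re (\<zeta> * ip (A (u t)) e) + 2 * Im (c e t) * Im (\<zeta> * ip (A (u t)) e))) (at t)"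
      unfolding h_def by (intro DERIV_sum) (auto intro!: derivative_eq_intros dc simp: mult_ac simp del: times_complex.sel)
    also have "(\<Sum>e\<in>ONB. 2 * Re (c e t) * Re (\<zeta> * ip (A (u t)) e) + 2 * Im (c e t) * Im (\<zeta> * ip (A (u t)) e))
      = 2 * Re (\<zeta> * ip (A (u t)) (u t))"
      unfolding ip_parseval[OF A_in[OF u] u] sum_distrib_left Re_sum
      by (intro sum.cong refl) (simp add: ipu algebra_simps)
    finally show ?thesis .
  qed
  have "exp (2 * \<kappa> * s) * h s \<le> exp (2 * \<kappa> * 0) * h 0"
  proof (rule DERIV_nonpos_imp_nonincreasing[OF s])
    fix t :: real
    have "((\<lambda>t. exp (2 * \<kappa> * t) * h t) has_real_derivative exp (2*\<kappa>*t) * (2 * \<kappa>) * h t + exp (2*\<kappa>*t) * (2 * Re (\<zeta> * ip (A (u t)) (u t)))) (at t)"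
      by (rule derivative_eq_intros dh refl | simp)+
    moreover have "exp (2*\<kappa>*t) * (2 * \<kappa>) * h t + exp (2*\<kappa>*t) * (2 * Re (\<zeta> * ip (A (u t)) (u t))) \<le> 0"
    proof -
      have "\<kappa> * h t + Re (\<zeta> * ip (A (u t)) (u t)) \<le> 0" using num[OF u, of t] hn[of t] by simp
      then have "exp (2*\<kappa>*t) * 2 * (\<kappa> * h t + Re (\<zeta> * ip (A (u t)) (u t))) \<le> 0" by (simp add: mult_le_0_iff)
      then show ?thesis by (simp only: algebra_simps)
    qed
    ultimately show "\<exists>y. ((\<lambda>t. exp (2 * \<kappa> * t) * h t) has_real_derivative y) (at t) \<and> y \<le> 0" by blast
  qed
  then have "exp (2 * \<kappa> * s) * (nrm (u s))\<^sup>2 \<le> (nrm (u 0))\<^sup>2" by (simp add: hn nrm_sq u)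
  moreover have "u 0 = z"
  proof
    fix x
    have "u 0 x = E 0 z x" by (simp add: u_def)
    also have "\<dots> = (\<Sum>n. 0 ^ n / of_nat (fact n) * (A ^^ n) z x)" using E_series[OF z, of 0 x] by (simp add: sums_iff)
    also have "\<dots> = (\<Sum>n. (A ^^ n) z x / of_nat (fact n) * 0 ^ n)" by (simp add: mult_ac)
    also have "\<dots> = z x" by (subst powser_zero) simp
    finally show "u 0 x = z x" .
  qed
  ultimately have "(exp (\<kappa> * s) * nrm (u s))\<^sup>2 \<le> (nrm z)\<^sup>2"
    by (simp add: power_mult_distrib exp_double[symmetric] mult_ac)
  then have "exp (\<kappa> * s) * nrm (u s) \<le> nrm z" using nrm_ge_0[OF z] by (rule power2_le_imp_le)
  then show ?thesis by (simp add: exp_minus u_def field_simps)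
qed

lemma E_decay: "z \<in> V \<Longrightarrow> t > 0 \<Longrightarrow> nrm (E (of_real t) z) \<le> exp (- nu * t) * nrm z"
proof -
  assume z: "z \<in> V" "t > 0"
  have "Re (1 * ip (A u) u) \<le> - nu * Re (ip u u)" if "u \<in> V" for u
    using num_Re[OF that] mult_nonneg_nonneg[OF less_imp_le[OF c0] ip_self_ge_0[OF that]] by simp
  from E_bound[OF z(1) _ this, of t] z show ?thesis by simp
qed

text \<open>The values - <Au,u> lie in the cone |Im| <= (2/3) k Re. Rotating that cone keeps it in
  the right half-plane as long as the tangent of the angle is at most 3/(2k), whence the opening of
  the sector.\<close>

lemma E_sector_bound:
  assumes z: "z \<in> V" and zeta: "\<zeta> \<noteq> 0" "\<bar>Arg \<zeta>\<bar> \<le> arctan (3 / (2*k))"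
  shows "nrm (E \<zeta> z) \<le> nrm z"
proof -
  define \<theta> where "\<theta> = \<bar>Arg \<zeta>\<bar>"
  define r where "r = cmod \<zeta>"
  have r: "r > 0" using zeta by (simp add: r_def)
  have zc: "\<zeta> = of_real r * cis (Arg \<zeta>)" using Arg_eq[OF zeta(1)] by (simp add: r_def cis_conv_exp)
  have th: "0 \<le> \<theta>" "\<theta> < pi/2" using zeta arctan_ubound[of "3/(2*k)"] by (auto simp: \<theta>_def)
  have cpos: "cos \<theta> > 0" using th by (intro cos_gt_zero_pi) auto
  have spos: "sin \<theta> \<ge> 0" using th by (intro sin_ge_zero) auto
  have "tan \<theta> \<le> tan (arctan (3 / (2*k)))"
    using zeta(2) th arctan_ubound[of "3/(2*k)"] by (cases "\<theta> = arctan (3/(2*k))") (auto simp: \<theta>_def intro!: less_imp_le[OF tan_monotone])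
  then have "tan \<theta> \<le> 3 / (2*k)" by (simp add: tan_arctan)
  then have tt: "2/3 * k * sin \<theta> \<le> cos \<theta>" using cpos k by (simp add: tan_def field_simps)
  have Rez: "Re \<zeta> = r * cos \<theta>" by (subst zc) (simp add: \<theta>_def abs_if)
  have Imz: "\<bar>Im \<zeta>\<bar> = r * sin \<theta>" 
  proof -
    have "\<bar>Im \<zeta>\<bar> = r * \<bar>sin (Arg \<zeta>)\<bar>" by (subst zc) (use r in \<open>simp add: abs_mult\<close>)
    also have "\<bar>sin (Arg \<zeta>)\<bar> = sin \<theta>" using spos by (auto simp: \<theta>_def abs_if)
    finally show ?thesis .
  qed
  have "Re (\<zeta> * ip (A u) u) \<le> - 0 * Re (ip u u)" if u: "u \<in> V" for u
  proof -
    define p where "p = - Re (ip (A u) u)"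
    define q where "q = Im (ip (A u) u)"
    have N: "nu * Re (ip u u) \<ge> 0" "c0 * Re (ip u u) \<ge> 0" using ip_self_ge_0[OF u] nu c0 by auto
    have p: "p \<ge> 0" using num_Re[OF u] N by (simp add: p_def)
    have q1: "\<bar>q\<bar> \<le> 2/3 * k * (p - nu * Re (ip u u))" using num_Im[OF u] by (simp add: p_def q_def)
    also have "\<dots> \<le> 2/3 * k * p" using N k by (intro mult_left_mono) auto
    finally have q: "\<bar>q\<bar> \<le> 2/3 * k * p" .
    have "Re (\<zeta> * ip (A u) u) = - (Re \<zeta> * p) - Im \<zeta> * q" by (simp add: p_def q_def)
    also have "\<dots> \<le> - (Re \<zeta> * p) + \<bar>Im \<zeta>\<bar> * \<bar>q\<bar>" by (simp add: abs_mult[symmetric])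
    also have "\<dots> \<le> - (r * cos \<theta> * p) + r * sin \<theta> * (2/3 * k * p)"
      using q r spos by (simp add: Rez Imz mult_left_mono)
    also have "\<dots> = - (r * p * (cos \<theta> - 2/3 * k * sin \<theta>))" by (simp add: algebra_simps)
    also have "\<dots> \<le> 0" using r p tt by simp
    finally show ?thesis by simp
  qed
  from E_bound[OF z _ this, of 1] show ?thesis by simp
qed

end

section \<open>The Dunford integral\<close>

text \<open>A scalar model: \<open>f\<close> will be a point value of the resolvent,
  \<open>a n\<close> the point value of A^n z, and \<open>m\<close> the position of the shifted
  vertex. Holomorphy is assumed outside the sector only, whereas the bound and the expansion at
  infinity hold on all large circles, also where these cross the sector.\<close>

locale dunford =
  fixes f :: "complex \<Rightarrow> complex" and a :: "nat \<Rightarrow> complex" and k m t \<rho> K q :: real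
  assumes k: "k > 0" and m: "m > 0" and t: "t > 0" and rho: "\<rho> > 0" and q: "0 \<le> q" "q < 1"
    and hol: "f holomorphic_on {\<mu>. \<bar>Im \<mu>\<bar> + k * (Re \<mu> + m) > 0}"
    and bnd: "cmod \<mu> \<ge> \<rho> \<Longrightarrow> cmod (f \<mu>) \<le> K"
    and ser: "cmod \<mu> \<ge> \<rho> \<Longrightarrow> cmod (f \<mu> - (\<Sum>n<N. a n / \<mu> ^ Suc n)) \<le> K * q ^ N"
begin

definition F :: "complex \<Rightarrow> complex" where "F \<mu> = exp (\<mu> * of_real t) * f \<mu>"
definition D :: "complex set" where "D = {\<mu>. \<bar>Im \<mu>\<bar> + k * (Re \<mu> + m) > 0}"
text \<open>For s = 1 and s = -1 these are two half-planes with union \<open>D\<close>. Unlike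
  \<open>D\<close> they are convex, and each contains one end of an admissible curve.\<close>

definition U :: "real \<Rightarrow> complex set" where "U s = {\<mu>. s * Im \<mu> + k * (Re \<mu> + m) > 0}"
definition I :: complex where "I = 2 * of_real pi * \<i> * (\<Sum>n. of_real t ^ n / of_nat (fact n) * a n)"

lemma K_nonneg: "K \<ge> 0"
  using bnd[of "of_real \<rho>"] rho norm_ge_zero[of "f (of_real \<rho>)"] by (simp del: norm_ge_zero)

text \<open>\<open>D\<close> is not convex but is star-shaped about 0: the defining expression at u
  mu is the convex combination of its value at mu and its value k m > 0 at 0.\<close>

lemma primitive: "\<exists>G. \<forall>\<mu>\<in>D. (G has_field_derivative F \<mu>) (at \<mu>)"
proof -
  have o: "open D" unfolding D_def by (intro open_Collect_less continuous_intros)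
  have h: "F holomorphic_on D" unfolding F_def[abs_def] using hol by (intro holomorphic_intros) (auto simp: D_def)
  have "starlike D"
    unfolding starlike_def
  proof (intro bexI ballI subsetI)
    show "0 \<in> D" using k m by (simp add: D_def)
    fix \<mu> x assume mu: "\<mu> \<in> D" and "x \<in> closed_segment 0 \<mu>"
    then obtain u where u: "0 \<le> u" "u \<le> 1" "x = u *\<^sub>R \<mu>" by (auto simp: closed_segment_def)
    have eq: "\<bar>Im x\<bar> + k * (Re x + m) = u * (\<bar>Im \<mu>\<bar> + k * (Re \<mu> + m)) + (1 - u) * (k * m)"
      using u by (simp add: abs_mult algebra_simps)
    have "u * (\<bar>Im \<mu>\<bar> + k * (Re \<mu> + m)) \<ge> 0" "(1-u) * (k * m) \<ge> 0" using u mu k m by (auto simp: D_def)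
    moreover have "u * (\<bar>Im \<mu>\<bar> + k * (Re \<mu> + m)) > 0 \<or> (1-u) * (k * m) > 0"
      using u mu k m by (cases "u = 0") (auto simp: D_def)
    ultimately show "x \<in> D" unfolding D_def mem_Collect_eq eq by linarith
  qed
  then show ?thesis
    using holomorphic_starlike_primitive[of D F "{}"] o h holomorphic_on_imp_continuous_on holomorphic_on_imp_differentiable_at
    by auto
qed

definition G where "G = (SOME G. \<forall>\<mu>\<in>D. (G has_field_derivative F \<mu>) (at \<mu>))"

lemma G: "\<mu> \<in> D \<Longrightarrow> (G has_field_derivative F \<mu>) (at \<mu>)"
  using someI_ex[OF primitive] unfolding G_def by blast

lemma U_D: "s = 1 \<or> s = -1 \<Longrightarrow> U s \<subseteq> D"
  by (auto simp: U_def D_def)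

lemma F_bound: "cmod \<mu> \<ge> \<rho> \<Longrightarrow> cmod (F \<mu>) \<le> K * exp (t * Re \<mu>)"
  using bnd[of \<mu>] by (simp add: F_def norm_mult mult_ac mult_right_mono)

lemma F_bound_left: "Re \<mu> \<le> - \<rho> \<Longrightarrow> cmod (F \<mu>) \<le> K * exp (t * Re \<mu>)"
  using F_bound[of \<mu>] abs_Re_le_cmod[of \<mu>] rho by linarith

text \<open>The direction (-1, s k) is parallel to the edge of \<open>U s\<close>, so the ray never
  leaves it, while the real part falls at unit speed. The exponential bound on \<open>F\<close> then
  integrates to the factor 1/t, and 1 + k bounds the length of the direction.\<close>

lemma G_ray:
  assumes s: "s = 1 \<or> s = -1" and mu: "\<mu> \<in> U s" "Re \<mu> \<le> - \<rho>" and T: "T > 0"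
  shows "cmod (G (\<mu> + of_real T * Complex (-1) (s*k)) - G \<mu>) \<le> K * (1 + k) / t * exp (t * Re \<mu>)"
proof -
  define d where "d = Complex (-1) (s*k)"
  have cd: "cmod d \<le> 1 + k" using cmod_le[of d] s k by (auto simp: d_def)
  have inU: "\<mu> + of_real x * d \<in> U s" for x
    using mu s by (auto simp: U_def d_def algebra_simps)
  have gd: "((\<lambda>x. G (\<mu> + of_real x * d)) has_vector_derivative (d * F (\<mu> + of_real x * d))) (at x)" for x
  proof -
    have "((\<lambda>x. \<mu> + of_real x * d) has_vector_derivative d) (at x)"
      by (auto intro!: derivative_eq_intros)
    from field_vector_diff_chain_at[OF this G] inU U_D[OF s] show ?thesis by (auto simp: o_def)
  qed
  \<comment> \<open>The comparison function on the right is an antiderivative in x of the bound for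
    the derivative of G along the ray.\<close>
  have "norm (G (\<mu> + of_real T * d) - G (\<mu> + of_real 0 * d)) \<le> 
     (- (K * (1 + k) / t) * exp (t * (Re \<mu> - T))) - (- (K * (1 + k) / t) * exp (t * (Re \<mu> - 0)))"
  proof (rule differentiable_bound_general[OF T])
    show "continuous_on {0..T} (\<lambda>x. G (\<mu> + of_real x * d))"
      using gd has_vector_derivative_continuous by (blast intro: continuous_at_imp_continuous_on)
    show "continuous_on {0..T} (\<lambda>x. - (K * (1 + k) / t) * exp (t * (Re \<mu> - x)))"
      by (intro continuous_intros)
    fix x assume x: "0 < x" "x < T"
    show "((\<lambda>x. G (\<mu> + of_real x * d)) has_vector_derivative (d * F (\<mu> + of_real x * d))) (at x)" by (rule gd)
    show "((\<lambda>x. - (K * (1 + k) / t) * exp (t * (Re \<mu> - x))) has_vector_derivative (K * (1 + k) * exp (t * (Re \<mu> - x)))) (at x)"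
      unfolding has_real_derivative_iff_has_vector_derivative[symmetric]
      using t by (auto intro!: derivative_eq_intros)
    have "cmod (F (\<mu> + of_real x * d)) \<le> K * exp (t * Re (\<mu> + of_real x * d))"
      using mu x by (intro F_bound_left) (auto simp: d_def)
    then have "cmod d * cmod (F (\<mu> + of_real x * d)) \<le> (1 + k) * (K * exp (t * Re (\<mu> + of_real x * d)))"
      using cd k by (intro mult_mono) auto
    then show "norm (d * F (\<mu> + of_real x * d)) \<le> K * (1 + k) * exp (t * (Re \<mu> - x))"
      by (simp add: norm_mult d_def mult_ac)
  qed
  also have "\<dots> \<le> K * (1 + k) / t * exp (t * Re \<mu>)" using K_nonneg k t by simp
  finally show ?thesis by (simp add: d_def)
qed

text \<open>Both points are pushed down parallel rays. Their distance stays fixed and the connecting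
  segment lies in the convex half-plane far to the left, where \<open>F\<close> tends to 0; only the
  costs of the two rays survive. The bound does not contain the distance of the points, as arbitrary
  curves require.\<close>

lemma G_close:
  assumes s: "s = 1 \<or> s = -1" and mu: "\<mu> \<in> U s" "Re \<mu> \<le> - \<rho>" and mu': "\<mu>' \<in> U s" "Re \<mu>' \<le> - \<rho>"
  shows "cmod (G \<mu> - G \<mu>') \<le> K * (1 + k) / t * (exp (t * Re \<mu>) + exp (t * Re \<mu>'))"
proof -
  define d where "d = Complex (-1) (s*k)"
  define C where "C = K * (1 + k) / t * (exp (t * Re \<mu>) + exp (t * Re \<mu>'))"
  have inU: "z + of_real x * d \<in> U s" if "z \<in> U s" for x z
    using that s by (auto simp: U_def d_def algebra_simps)
  have "cmod (G \<mu> - G \<mu>') \<le> C + K * exp (t * (- \<rho> - T)) * cmod (\<mu> - \<mu>')" if T: "T > 0" for T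
  proof -
    define W where "W = U s \<inter> {z. Re z \<le> - \<rho> - T}"
    have cU: "convex (U s)"
    proof -
      have "U s = {z. inner (Complex k s) z > - k * m}" by (auto simp: U_def inner_complex_def algebra_simps)
      then show ?thesis by (simp add: convex_halfspace_gt)
    qed
    have cW: "convex W" unfolding W_def using cU convex_halfspace_Re_le by (intro convex_Int) auto
    have "cmod (G (\<mu> + of_real T * d) - G (\<mu>' + of_real T * d)) \<le> K * exp (t * (- \<rho> - T)) * cmod ((\<mu> + of_real T * d) - (\<mu>' + of_real T * d))"
    proof (rule field_differentiable_bound[OF cW])
      fix z assume z: "z \<in> W"
      show "(G has_field_derivative F z) (at z within W)"
        using G z U_D[OF s] by (auto simp: W_def intro: has_field_derivative_at_within)
      have "cmod (F z) \<le> K * exp (t * Re z)" using z T by (intro F_bound_left) (auto simp: W_def)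
      also have "\<dots> \<le> K * exp (t * (- \<rho> - T))" using z t K_nonneg by (auto simp: W_def intro!: mult_left_mono)
      finally show "cmod (F z) \<le> K * exp (t * (- \<rho> - T))" .
    qed (use inU mu mu' in \<open>auto simp: W_def d_def\<close>)
    then have 1: "cmod (G (\<mu> + of_real T * d) - G (\<mu>' + of_real T * d)) \<le> K * exp (t * (- \<rho> - T)) * cmod (\<mu> - \<mu>')" by simp
    have 2: "cmod (G (\<mu> + of_real T * d) - G \<mu>) \<le> K * (1 + k) / t * exp (t * Re \<mu>)"
      unfolding d_def by (rule G_ray[OF s mu T])
    have 3: "cmod (G (\<mu>' + of_real T * d) - G \<mu>') \<le> K * (1 + k) / t * exp (t * Re \<mu>')"
      unfolding d_def by (rule G_ray[OF s mu' T])
    have "cmod ((G (\<mu> + of_real T * d) - G (\<mu>' + of_real T * d)) - (G (\<mu> + of_real T * d) - G \<mu>) + (G (\<mu>' + of_real T * d) - G \<mu>'))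
      \<le> cmod (G (\<mu> + of_real T * d) - G (\<mu>' + of_real T * d)) + cmod (G (\<mu> + of_real T * d) - G \<mu>) + cmod (G (\<mu>' + of_real T * d) - G \<mu>')"
      by (rule order_trans[OF norm_triangle_ineq add_right_mono[OF norm_triangle_ineq4]])
    then have "cmod (G \<mu> - G \<mu>') \<le> cmod (G (\<mu> + of_real T * d) - G (\<mu>' + of_real T * d)) + cmod (G (\<mu> + of_real T * d) - G \<mu>) + cmod (G (\<mu>' + of_real T * d) - G \<mu>')"
      by simp
    then show ?thesis using 1 2 3 by (simp add: C_def distrib_left)
  qed
  then have ev: "eventually (\<lambda>T. cmod (G \<mu> - G \<mu>') \<le> C + K * exp (t * (- \<rho> - T)) * cmod (\<mu> - \<mu>')) at_top"
    by (rule eventually_mono[OF eventually_gt_at_top[of 0]])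
  have "((\<lambda>T. exp (t * (- \<rho> - T))) \<longlongrightarrow> 0) at_top"
  proof (rule filterlim_compose[OF exp_at_bot])
    have "filterlim (\<lambda>T. - (t * \<rho> + t * T)) at_bot at_top"
      unfolding filterlim_uminus_at_top[symmetric]
      using t by (intro filterlim_tendsto_add_at_top[OF tendsto_const] filterlim_tendsto_pos_mult_at_top[OF tendsto_const _ filterlim_ident])
    moreover have "(\<lambda>T. - (t * \<rho> + t * T)) = (\<lambda>T. t * (- \<rho> - T))" by (auto simp: algebra_simps)
    ultimately show "filterlim (\<lambda>T. t * (- \<rho> - T)) at_bot at_top" by simp
  qed
  then have "((\<lambda>T. C + K * exp (t * (- \<rho> - T)) * cmod (\<mu> - \<mu>')) \<longlongrightarrow> C + K * 0 * cmod (\<mu> - \<mu>')) at_top"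
    by (intro tendsto_intros)
  then have "cmod (G \<mu> - G \<mu>') \<le> C + K * 0 * cmod (\<mu> - \<mu>')"
    by (rule tendsto_lowerbound[OF _ ev]) simp
  then show ?thesis by (simp add: C_def)
qed

lemma higher_deriv_exp: "(deriv ^^ n) (\<lambda>w. exp (w * c)) = (\<lambda>w::complex. c ^ n * exp (w * c))"
proof (induction n)
  case (Suc n)
  have "deriv (\<lambda>w. c ^ n * exp (w * c)) w = c ^ Suc n * exp (w * c)" for w
    by (rule DERIV_imp_deriv) (auto intro!: derivative_eq_intros)
  then show ?case using Suc by auto
qed simp

text \<open>The partial sums of the expansion at infinity converge uniformly on the circle, and
  Cauchy's formula for the derivatives of exp at 0 evaluates each term. Nothing is assumed about
  \<open>f\<close> inside the circle.\<close>

lemma circle_integral: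
  assumes r: "r \<ge> \<rho>"
  shows "(F has_contour_integral I) (circlepath 0 r)"
proof -
  have r0: "r > 0" using r rho by simp
  \<comment> \<open>The inert \<open>\<mu> - 0\<close> matches the shape of Cauchy's formula with
    centre 0.\<close>
  define P where "P = (\<lambda>N (\<mu>::complex). \<Sum>n<N. a n * (exp (\<mu> * of_real t) / (\<mu> - 0) ^ Suc n))"
  have trm: "((\<lambda>\<mu>. exp (\<mu> * of_real t) / (\<mu> - 0) ^ Suc n) has_contour_integral (2 * pi * \<i>) / fact n * of_real t ^ n) (circlepath 0 r)" for n
  proof -
    have "continuous_on (cball (0::complex) r) (\<lambda>\<mu>. exp (\<mu> * complex_of_real t))" "(\<lambda>\<mu>. exp (\<mu> * complex_of_real t)) holomorphic_on ball 0 r"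
      by (intro continuous_intros holomorphic_intros)+
    from Cauchy_has_contour_integral_higher_derivative_circlepath[OF this, of 0 n] r0
    show ?thesis by (simp add: higher_deriv_exp)
  qed
  have P: "(P N has_contour_integral (\<Sum>n<N. a n * ((2 * pi * \<i>) / fact n * of_real t ^ n))) (circlepath 0 r)" for N
    unfolding P_def by (intro has_contour_integral_sum has_contour_integral_lmul trm) auto
  have "uniform_limit (sphere 0 r) P F sequentially"
    unfolding uniform_limit_iff
  proof (intro allI impI)
    fix e :: real assume e: "e > 0"
    have "(\<lambda>N. exp (t * r) * (K * q ^ N)) \<longlonglongrightarrow> exp (t * r) * (K * 0)"
      using q by (intro tendsto_intros LIMSEQ_realpow_zero)
    then have "eventually (\<lambda>N. exp (t * r) * (K * q ^ N) < e) sequentially"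
      by (rule order_tendstoD) (use e in simp)
    then show "eventually (\<lambda>N. \<forall>\<mu>\<in>sphere 0 r. dist (P N \<mu>) (F \<mu>) < e) sequentially"
    proof (rule eventually_mono, intro ballI)
      fix N and \<mu> :: complex assume N: "exp (t * r) * (K * q ^ N) < e" and "\<mu> \<in> sphere 0 r"
      then have mu: "cmod \<mu> = r" by simp
      have "F \<mu> - P N \<mu> = exp (\<mu> * of_real t) * (f \<mu> - (\<Sum>n<N. a n / \<mu> ^ Suc n))"
        by (simp add: F_def P_def right_diff_distrib sum_distrib_left mult_ac)
      then have "cmod (F \<mu> - P N \<mu>) = exp (t * Re \<mu>) * cmod (f \<mu> - (\<Sum>n<N. a n / \<mu> ^ Suc n))"
        by (simp add: norm_mult mult_ac)
      also have "\<dots> \<le> exp (t * r) * (K * q ^ N)"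
        using ser[of \<mu> N] mu r t complex_Re_le_cmod[of \<mu>] by (intro mult_mono) auto
      finally show "dist (P N \<mu>) (F \<mu>) < e" using N by (simp add: dist_norm norm_minus_commute)
    qed
  qed
  note lim = contour_integral_uniform_limit_circlepath[OF _ this _ r0]
  have ev: "eventually (\<lambda>N. P N contour_integrable_on circlepath 0 r) sequentially"
    by (intro always_eventually allI has_contour_integral_integrable[OF P])
  have int: "F contour_integrable_on circlepath 0 r" using lim(1) ev by simp
  have "(\<lambda>N. contour_integral (circlepath 0 r) (P N)) \<longlonglongrightarrow> contour_integral (circlepath 0 r) F"
    using lim(2) ev by simp
  then have "(\<lambda>n. a n * ((2 * pi * \<i>) / fact n * of_real t ^ n)) sums contour_integral (circlepath 0 r) F"
    unfolding sums_def using contour_integral_unique[OF P] by simp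
  then have "(\<lambda>n. a n * ((2 * pi * \<i>) / fact n * of_real t ^ n) / (2 * pi * \<i>)) sums (contour_integral (circlepath 0 r) F / (2 * pi * \<i>))"
    by (rule sums_divide)
  moreover have "a n * ((2 * pi * \<i>) / fact n * of_real t ^ n) / (2 * pi * \<i>) = of_real t ^ n / of_nat (fact n) * a n" for n
    by (simp add: field_simps)
  ultimately have "(\<lambda>n. of_real t ^ n / of_nat (fact n) * a n) sums (contour_integral (circlepath 0 r) F / (2 * pi * \<i>))"
    by (simp only:)
  then have "(\<Sum>n. of_real t ^ n / of_nat (fact n) * a n) = contour_integral (circlepath 0 r) F / (2 * pi * \<i>)"
    by (simp add: sums_iff)
  then have "I = contour_integral (circlepath 0 r) F" by (simp add: I_def)
  then show ?thesis using int has_contour_integral_integral by metis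
qed

text \<open>The circle is cut at the angles \<open>th\<close> and \<open>2*pi - th\<close>. On the
  outer two arcs \<open>G\<close> is a primitive; on the middle arc, which faces the sector, the
  real part is at most r cos th < 0 and the integrand is exponentially small.\<close>

lemma G_arc:
  assumes r: "r \<ge> \<rho>"
  defines "th \<equiv> pi - arctan k"
  shows "cmod (I - (G (of_real r * cis th) - G (of_real r * cis (2*pi - th)))) \<le> 2 * pi * r * K * exp (t * (r * cos th))"
proof -
  define om where "om = arctan k"
  have om: "0 < om" "om < pi/2" using k arctan_ubound by (auto simp: om_def)
  have th: "th = pi - om" "pi/2 < th" "th < pi" using om by (auto simp: th_def om_def)
  have com: "cos om > 0" using om by (intro cos_gt_zero_pi) auto
  have kk: "k * cos om = sin om" using com tan_arctan[of k] by (simp add: om_def tan_def field_simps)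
  have r0: "r > 0" using r rho by simp
  define g where "g = (\<lambda>x. F (0 + of_real r * cis x) * of_real r * \<i> * cis x)"
  have "(F has_contour_integral I) (part_circlepath 0 r 0 (2*pi))" using circle_integral[OF r] by (simp add: circlepath_def)
  then have gI: "(g has_integral I) {0..2*pi}"
    unfolding g_def by (subst (asm) has_contour_integral_part_circlepath_iff) auto
  have dG: "((\<lambda>x. G (of_real r * cis x)) has_vector_derivative g x) (at x)" if "of_real r * cis x \<in> D" for x
  proof -
    have "((\<lambda>x. of_real r * cis x) has_vector_derivative of_real r * (\<i> * cis x)) (at x)"
      by (auto intro!: derivative_eq_intros has_vector_derivative_mult_right simp: has_vector_derivative_def)
    from field_vector_diff_chain_at[OF this G[OF that]] show ?thesis by (simp add: o_def g_def mult_ac)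
  qed
  \<comment> \<open>With k = tan om the expression is sin (x + om) / cos om, nonnegative up to x =
    pi - om = \<open>th\<close>. Strict membership in \<open>D\<close> then comes from k m >
    0.\<close>
  have low: "0 \<le> sin x + k * cos x" if "0 \<le> x" "x \<le> th" for x
  proof -
    have "0 \<le> sin (x + om)" using that om th by (intro sin_ge_zero) auto
    also have "\<dots> = cos om * (sin x + k * cos x)" by (simp add: sin_add kk[symmetric] algebra_simps)
    finally show ?thesis using com by (simp add: zero_le_mult_iff)
  qed
  have inD1: "of_real r * cis x \<in> D" if "0 \<le> x" "x \<le> th" for x
  proof -
    have "0 \<le> r * (sin x + k * cos x)" using low[OF that] r0 by simp
    moreover have "sin x \<ge> 0" using that th by (intro sin_ge_zero) auto
    moreover have "k * m > 0" using k m by simp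
    ultimately have "r * sin x + k * (r * cos x + m) > 0" by (simp add: algebra_simps)
    then show ?thesis using \<open>sin x \<ge> 0\<close> r0 by (simp add: D_def abs_mult)
  qed
  have inD2: "of_real r * cis x \<in> D" if "2*pi - th \<le> x" "x \<le> 2*pi" for x
  proof -
    have "of_real r * cis (2*pi - x) \<in> D" using inD1[of "2*pi - x"] that by auto
    then show ?thesis by (simp add: D_def abs_mult)
  qed
  have i1: "(g has_integral (G (of_real r * cis th) - G (of_real r * cis 0))) {0..th}"
    by (rule fundamental_theorem_of_calculus) (use th dG inD1 in \<open>auto intro: has_vector_derivative_at_within\<close>)
  have i3: "(g has_integral (G (of_real r * cis (2*pi)) - G (of_real r * cis (2*pi-th)))) {2*pi-th..2*pi}"
    by (rule fundamental_theorem_of_calculus) (use th dG inD2 in \<open>auto intro: has_vector_derivative_at_within\<close>)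
  have gi: "g integrable_on {0..2*pi}" using gI by blast
  then have "g integrable_on {th..2*pi-th}" by (rule integrable_subinterval_real) (use th in auto)
  then obtain J where J: "(g has_integral J) {th..2*pi-th}" by blast
  have "(g has_integral (G (of_real r * cis th) - G (of_real r * cis 0) + J)) {0..2*pi-th}"
    by (rule has_integral_combine[OF _ _ i1 J]) (use th in auto)
  from has_integral_combine[OF _ _ this i3] th
  have "(g has_integral (G (of_real r * cis th) - G (of_real r * cis 0) + J + (G (of_real r * cis (2*pi)) - G (of_real r * cis (2*pi-th))))) {0..2*pi}"
    by simp
  then have "I = G (of_real r * cis th) - G (of_real r * cis 0) + J + (G (of_real r * cis (2*pi)) - G (of_real r * cis (2*pi-th)))"
    using gI has_integral_unique by blast
  \<comment> \<open>The values of \<open>G\<close> at the angles 0 and 2 pi cancel, since both are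
    taken at the same point of the positive real axis.\<close>
  then have IJ: "I - (G (of_real r * cis th) - G (of_real r * cis (2*pi - th))) = J" by simp
  have "cmod J \<le> (r * K * exp (t * (r * cos th))) * measure lborel (cbox th (2*pi-th))"
  proof (rule has_integral_bound)
    show "(g has_integral J) (cbox th (2*pi-th))" using J by simp
    show "0 \<le> r * K * exp (t * (r * cos th))" using r0 K_nonneg by simp
    fix x assume "x \<in> cbox th (2*pi-th)"
    then have x: "th \<le> x" "x \<le> 2*pi - th" by auto
    have "cos x \<le> cos th"
    proof (cases "x \<le> pi")
      case True then show ?thesis using x th by (intro cos_monotone_0_pi_le) auto
    next
      case False
      have "cos (2*pi - x) \<le> cos th" using x th False by (intro cos_monotone_0_pi_le) auto
      then show ?thesis by simp
    qed
    then have le: "t * (r * cos x) \<le> t * (r * cos th)" using t r0 by simp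
    have "cmod (of_real r * cis x) = r" using r0 by (simp add: norm_mult)
    then have "cmod (F (of_real r * cis x)) \<le> K * exp (t * (r * cos x))"
      using F_bound[of "of_real r * cis x"] r by simp
    also have "\<dots> \<le> K * exp (t * (r * cos th))" using le K_nonneg by (intro mult_left_mono) auto
    finally have "cmod (F (of_real r * cis x)) * r \<le> K * exp (t * (r * cos th)) * r" using r0 by (intro mult_right_mono) auto
    then show "norm (g x) \<le> r * K * exp (t * (r * cos th))" using r0 by (simp add: g_def norm_mult mult_ac)
  qed
  also have "\<dots> \<le> (r * K * exp (t * (r * cos th))) * (2 * pi)"
    using r0 K_nonneg th by (intro mult_left_mono) auto
  finally show ?thesis unfolding IJ by (simp add: mult_ac)
qed

text \<open>The two end points are compared with the circle points at the angles \<open>th\<close>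
  and \<open>2*pi - th\<close>, each pair within one half-plane. As the radius grows, the terms from
  the circle vanish and only those of the end points remain.\<close>

lemma G_ends:
  assumes b: "\<mu> \<in> U 1" "Re \<mu> \<le> - \<rho>" and a: "\<mu>' \<in> U (-1)" "Re \<mu>' \<le> - \<rho>"
  shows "cmod (G \<mu> - G \<mu>' - I) \<le> K * (1 + k) / t * (exp (t * Re \<mu>) + exp (t * Re \<mu>'))"
proof -
  define om where "om = arctan k"
  define th where "th = pi - om"
  have om: "0 < om" "om < pi/2" using k arctan_ubound by (auto simp: om_def)
  have com: "cos om > 0" using om by (intro cos_gt_zero_pi) auto
  have kk: "k * cos om = sin om" using com tan_arctan[of k] by (simp add: om_def tan_def field_simps)
  define C where "C = K * (1 + k) / t"
  define c where "c = cos om"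
  \<comment> \<open>The lower bound on r secures both r >= rho, for the circle, and r c >= rho,
    which puts the two circle points far enough to the left.\<close>
  have bd: "cmod (G \<mu> - G \<mu>' - I) \<le> C * (exp (t * Re \<mu>) + exp (- (t * c * r))) + C * (exp (t * Re \<mu>') + exp (- (t * c * r)))
       + 2 * pi * K / (t * c) * ((t * c * r) / exp (t * c * r))" if r: "r \<ge> \<rho> + \<rho> / c" for r
  proof -
    have rc: "r * c \<ge> \<rho>" "r \<ge> \<rho>"
    proof -
      have "\<rho> / c \<le> r" using r rho by simp
      then show "r * c \<ge> \<rho>" using com by (simp add: c_def field_simps)
      show "r \<ge> \<rho>" using r rho com by (smt (verit) c_def divide_nonneg_pos)
    qed
    define p where "p = of_real r * cis th"
    define p' where "p' = of_real r * cis (2*pi - th)"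
    have Rp: "Re p = - (r * c)" "Im p = r * sin om" "Re p' = - (r * c)" "Im p' = - (r * sin om)"
      by (auto simp: p_def p'_def th_def c_def)
    have kr: "k * (r * c) = r * sin om" using kk by (simp add: c_def mult.left_commute)
    have pU: "p \<in> U 1" "p' \<in> U (-1)" using k m by (simp_all add: U_def Rp kr[symmetric] distrib_left)
    have 1: "cmod (G \<mu> - G p) \<le> C * (exp (t * Re \<mu>) + exp (- (t * c * r)))"
      using G_close[OF _ b pU(1)] rc by (simp add: Rp C_def mult_ac)
    have 2: "cmod (G p' - G \<mu>') \<le> C * (exp (t * Re \<mu>') + exp (- (t * c * r)))"
      using G_close[OF _ pU(2) _ a] rc by (simp add: Rp C_def mult_ac add.commute)
    have "cmod (I - (G p - G p')) \<le> 2 * pi * r * K * exp (t * (r * cos th))"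
      using G_arc[OF rc(2)] by (simp add: p_def p'_def th_def om_def)
    also have "\<dots> = 2 * pi * K / (t * c) * ((t * c * r) / exp (t * c * r))"
      using t com by (simp add: th_def c_def exp_minus field_simps)
    finally have 3: "cmod (I - (G p - G p')) \<le> 2 * pi * K / (t * c) * ((t * c * r) / exp (t * c * r))" .
    have "cmod ((G \<mu> - G p) + (G p' - G \<mu>') - (I - (G p - G p'))) \<le> cmod (G \<mu> - G p) + cmod (G p' - G \<mu>') + cmod (I - (G p - G p'))"
      by (rule order_trans[OF norm_triangle_ineq4 add_right_mono[OF norm_triangle_ineq]])
    moreover have "(G \<mu> - G p) + (G p' - G \<mu>') - (I - (G p - G p')) = G \<mu> - G \<mu>' - I" by simp
    ultimately have "cmod (G \<mu> - G \<mu>' - I) \<le> cmod (G \<mu> - G p) + cmod (G p' - G \<mu>') + cmod (I - (G p - G p'))"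
      by (simp only:)
    then show ?thesis using 1 2 3 by linarith
  qed
  have tc: "t * c > 0" using t com by (simp add: c_def)
  have fl: "filterlim (\<lambda>r. t * c * r) at_top at_top"
    by (rule filterlim_tendsto_pos_mult_at_top[OF tendsto_const tc filterlim_ident])
  have e1: "((\<lambda>r. exp (- (t * c * r))) \<longlongrightarrow> 0) at_top"
    by (rule filterlim_compose[OF exp_at_bot]) (use fl in \<open>simp add: filterlim_uminus_at_top[symmetric]\<close>)
  have e2: "((\<lambda>r. (t * c * r) / exp (t * c * r)) \<longlongrightarrow> 0) at_top"
    using filterlim_compose[OF tendsto_power_div_exp_0[of 1] fl] by simp
  have "((\<lambda>r. C * (exp (t * Re \<mu>) + exp (- (t * c * r))) + C * (exp (t * Re \<mu>') + exp (- (t * c * r)))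
       + 2 * pi * K / (t * c) * ((t * c * r) / exp (t * c * r))) \<longlongrightarrow>
      C * (exp (t * Re \<mu>) + 0) + C * (exp (t * Re \<mu>') + 0) + 2 * pi * K / (t * c) * 0) at_top"
    by (intro tendsto_add tendsto_mult tendsto_const e1 e2)
  then have "cmod (G \<mu> - G \<mu>' - I) \<le> C * (exp (t * Re \<mu>) + 0) + C * (exp (t * Re \<mu>') + 0) + 2 * pi * K / (t * c) * 0"
    by (rule tendsto_lowerbound[OF _ eventually_mono[OF eventually_ge_at_top[of "\<rho> + \<rho>/c"] bd]]) simp_all
  then show ?thesis by (simp add: C_def distrib_left)
qed

theorem inversion:
  assumes g: "curve_in \<gamma> S" and S: "S \<subseteq> D"
  shows "improper_cintegral \<gamma> F I"
proof -
  have gD: "\<gamma> s \<in> D" for s using g S unfolding curve_in_def by blast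
  \<comment> \<open>On a compact interval G along the curve is continuous and differentiable off a
    finite set, so the fundamental theorem applies to a piecewise C1 curve.\<close>
  have hi: "((\<lambda>s. F (\<gamma> s) * vector_derivative \<gamma> (at s)) has_integral (G (\<gamma> b) - G (\<gamma> a))) {a..b}" if ab: "a \<le> b" for a b
  proof -
    have pc: "\<gamma> piecewise_C1_differentiable_on {a..b}" using g by (auto simp: curve_in_def)
    then obtain X where X: "finite X" "\<gamma> C1_differentiable_on ({a..b} - X)" and cont: "continuous_on {a..b} \<gamma>"
      by (auto simp: piecewise_C1_differentiable_on_def)
    show ?thesis
    proof (rule fundamental_theorem_of_calculus_strong[OF X(1) ab])
      fix x assume x: "x \<in> {a..b} - X"
      have "\<gamma> differentiable (at x)" using X(2) x by (auto simp: C1_differentiable_on_eq)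
      then have "(\<gamma> has_vector_derivative vector_derivative \<gamma> (at x)) (at x)" by (simp add: vector_derivative_works)
      from field_vector_diff_chain_at[OF this G[OF gD]]
      show "((\<lambda>s. G (\<gamma> s)) has_vector_derivative F (\<gamma> x) * vector_derivative \<gamma> (at x)) (at x)" by (simp add: o_def mult.commute)
    next
      have "continuous_on D G" using G by (meson DERIV_isCont continuous_at_imp_continuous_on)
      then show "continuous_on {a..b} (\<lambda>s. G (\<gamma> s))"
        by (rule continuous_on_compose2[OF _ cont]) (use gD in auto)
    qed
  qed
  have int: "(\<lambda>s. F (\<gamma> s) * vector_derivative \<gamma> (at s)) integrable_on {a..b}" for a b
    using hi[of a b] by (cases "a \<le> b") (auto simp: integrable_on_def)
  define E where "E = (\<lambda>s. exp (t * Re (\<gamma> s)))"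
  have Etop: "(E \<longlongrightarrow> 0) at_top" and Ebot: "(E \<longlongrightarrow> 0) at_bot"
    unfolding E_def using g t
    by (auto simp: curve_in_def intro!: filterlim_compose[OF exp_at_bot] filterlim_tendsto_pos_mult_at_bot[OF tendsto_const])
  \<comment> \<open>Once Im >= 0, membership in \<open>D\<close> means membership in
    \<open>U 1\<close>; dually at the other end. The signs of the parameters are recorded so that
    the lower limit of integration lies below the upper one.\<close>
  have evb: "eventually (\<lambda>b. \<gamma> b \<in> U 1 \<and> Re (\<gamma> b) \<le> - \<rho> \<and> b \<ge> 0) at_top"
  proof -
    have "eventually (\<lambda>b. Im (\<gamma> b) \<ge> 0) at_top" "eventually (\<lambda>b. Re (\<gamma> b) \<le> - \<rho>) at_top"
      using g by (auto simp: curve_in_def filterlim_at_top filterlim_at_bot)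
    then show ?thesis using eventually_ge_at_top[of 0]
    proof eventually_elim
      case (elim b)
      then show ?case using gD[of b] by (simp add: U_def D_def)
    qed
  qed
  have eva: "eventually (\<lambda>b. \<gamma> b \<in> U (-1) \<and> Re (\<gamma> b) \<le> - \<rho> \<and> b \<le> 0) at_bot"
  proof -
    have "eventually (\<lambda>b. Im (\<gamma> b) \<le> 0) at_bot" "eventually (\<lambda>b. Re (\<gamma> b) \<le> - \<rho>) at_bot"
      using g by (auto simp: curve_in_def filterlim_at_top filterlim_at_bot)
    then show ?thesis using eventually_le_at_bot[of 0]
    proof eventually_elim
      case (elim b)
      then show ?case using gD[of b] by (simp add: U_def D_def)
    qed
  qed
  have "((\<lambda>p. case p of (a, b) \<Rightarrow> integral {a..b} (\<lambda>s. F (\<gamma> s) * vector_derivative \<gamma> (at s))) \<longlongrightarrow> I) (at_bot \<times>\<^sub>F at_top)"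
  proof (rule LIM_zero_cancel, rule Lim_null_comparison)
    show "eventually (\<lambda>p. norm ((case p of (a, b) \<Rightarrow> integral {a..b} (\<lambda>s. F (\<gamma> s) * vector_derivative \<gamma> (at s))) - I)
       \<le> K * (1 + k) / t * (E (snd p) + E (fst p))) (at_bot \<times>\<^sub>F at_top)"
      using eventually_prodI[OF eva evb]
    proof (rule eventually_mono)
      fix p assume p: "(\<gamma> (fst p) \<in> U (-1) \<and> Re (\<gamma> (fst p)) \<le> - \<rho> \<and> fst p \<le> 0) \<and> (\<gamma> (snd p) \<in> U 1 \<and> Re (\<gamma> (snd p)) \<le> - \<rho> \<and> snd p \<ge> 0)"
      then have le: "fst p \<le> snd p" by simp
      show "norm ((case p of (a, b) \<Rightarrow> integral {a..b} (\<lambda>s. F (\<gamma> s) * vector_derivative \<gamma> (at s))) - I)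
       \<le> K * (1 + k) / t * (E (snd p) + E (fst p))"
        using G_ends[of "\<gamma> (snd p)" "\<gamma> (fst p)"] p integral_unique[OF hi[OF le]] by (simp add: case_prod_beta E_def)
    qed
    have "((\<lambda>p. K * (1 + k) / t * (E (snd p) + E (fst p))) \<longlongrightarrow> K * (1 + k) / t * (0 + 0)) (at_bot \<times>\<^sub>F at_top)"
      by (intro tendsto_mult tendsto_const tendsto_add filterlim_compose[OF Etop filterlim_snd] filterlim_compose[OF Ebot filterlim_fst])
    then show "((\<lambda>p. K * (1 + k) / t * (E (snd p) + E (fst p))) \<longlongrightarrow> 0) (at_bot \<times>\<^sub>F at_top)" by simp
  qed
  then show ?thesis using int by (auto simp: improper_cintegral_def)
qed

end

text \<open>With the radius 2M the Neumann remainder R(mu) A^N z / mu^N is at most a constant times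
  M^N / (2M)^N, which accounts for the ratio 1/2. The constant Kx passes from the norm to the value
  at x.\<close>

lemma (in sectorial_op) dunford_formula:
  assumes z: "z \<in> V" and t: "t > 0" and g: "curve_in \<gamma> (- sector (-nu) (pi - arctan k))"
  shows "improper_cintegral \<gamma> (\<lambda>\<mu>. exp (\<mu> * complex_of_real t) * R \<mu> z x) (2 * complex_of_real pi * \<i> * E (of_real t) z x)"
proof -
  obtain M where M: "M > 0" "\<And>u. u\<in>V \<Longrightarrow> nrm (A u) \<le> M * nrm u" using A_bounded by blast
  obtain Kx where Kx: "Kx \<ge> 0" "\<And>u. u\<in>V \<Longrightarrow> cmod (u x) \<le> Kx * nrm u" using eval_bounded by blast
  have Rb: "cmod (R \<mu> w x) \<le> Kx * (nrm w / M)" if "cmod \<mu> \<ge> 2 * M" "w \<in> V" for \<mu> w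
    using Kx(2)[OF R_in[OF R_large(1)[OF M that(1)] that(2)]] mult_left_mono[OF R_large(2)[OF M that] Kx(1)] by linarith
  interpret du: dunford "\<lambda>\<mu>. R \<mu> z x" "\<lambda>n. (A ^^ n) z x" k "nu + c0/3" t "2 * M" "Kx * (nrm z / M)" "1/2"
  proof
    show "(\<lambda>\<mu>. R \<mu> z x) holomorphic_on {\<mu>. 0 < \<bar>Im \<mu>\<bar> + k * (Re \<mu> + (nu + c0/3))}"
      using R_holomorphic[OF z] by (simp add: D_def)
    fix \<mu> assume mu: "2 * M \<le> cmod \<mu>"
    show "cmod (R \<mu> z x) \<le> Kx * (nrm z / M)" using Rb[OF mu z] .
    fix N
    have ne: "\<mu> \<noteq> 0" using mu M(1) by auto
    have "R \<mu> z x - (\<Sum>n<N. (A ^^ n) z x / \<mu> ^ Suc n) = R \<mu> ((A ^^ N) z) x / \<mu> ^ N"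
      using R_neumann[OF R_large(1)[OF M mu] ne z, of x N] by simp
    then have "cmod (R \<mu> z x - (\<Sum>n<N. (A ^^ n) z x / \<mu> ^ Suc n)) = cmod (R \<mu> ((A ^^ N) z) x) / cmod \<mu> ^ N"
      by (simp add: norm_divide norm_power)
    also have "\<dots> \<le> (Kx * (M ^ N * nrm z / M)) / (2 * M) ^ N"
    proof (rule frac_le)
      have "cmod (R \<mu> ((A ^^ N) z) x) \<le> Kx * (nrm ((A ^^ N) z) / M)" using Rb[OF mu Apow_in[OF z]] .
      also have "\<dots> \<le> Kx * (M ^ N * nrm z / M)"
        using Apow_bound[OF M z, of N] Kx(1) M(1) by (intro mult_left_mono divide_right_mono) auto
      finally show "cmod (R \<mu> ((A ^^ N) z) x) \<le> Kx * (M ^ N * nrm z / M)" .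
      show "(2 * M) ^ N \<le> cmod \<mu> ^ N" using mu M(1) by (intro power_mono) auto
    qed (use Kx(1) M(1) nrm_ge_0[OF z] in auto)
    also have "\<dots> = Kx * (nrm z / M) * (1/2) ^ N" using M(1) by (simp add: power_mult_distrib power_divide)
    finally show "cmod (R \<mu> z x - (\<Sum>n<N. (A ^^ n) z x / \<mu> ^ Suc n)) \<le> Kx * (nrm z / M) * (1/2) ^ N" .
  qed (use k nu c0 t M(1) in auto)
  have "improper_cintegral \<gamma> du.F du.I"
  proof (rule du.inversion[OF g])
    show "- sector (-nu) (pi - arctan k) \<subseteq> du.D"
      using not_sector_D by (auto simp: D_def du.D_def)
  qed
  moreover have "du.I = 2 * complex_of_real pi * \<i> * E (of_real t) z x"
    using E_series[OF z, of "of_real t" x] by (simp add: du.I_def sums_iff)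
  ultimately show ?thesis by (simp add: du.F_def[abs_def])
qed

section \<open>Test functions\<close>

lemma Ck_cont: "Ck k f \<Longrightarrow> continuous_on UNIV f"
  by (cases k) auto

lemma Ck_SucD: "Ck (Suc k) f \<Longrightarrow> Ck k f"
  by (induction k arbitrary: f) (auto dest: Ck_cont)

lemma pderiv_i_eqI: "(f has_derivative f') (at x) \<Longrightarrow> pderiv_i i f x = f' (axis i 1)"
  unfolding pderiv_i_def by (simp add: frechet_derivative_at[symmetric])

lemma pderiv_i_add:
  assumes "f differentiable (at x)" "g differentiable (at x)"
  shows "pderiv_i i (\<lambda>x. f x + g x) x = pderiv_i i f x + pderiv_i i g x"
  using assms unfolding differentiable_def
  by (auto simp: pderiv_i_eqI pderiv_i_eqI[OF has_derivative_add])

lemma pderiv_i_mult: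
  assumes "f differentiable (at x)" "g differentiable (at x)"
  shows "pderiv_i i (\<lambda>x. f x * g x) x = f x * pderiv_i i g x + pderiv_i i f x * g x"
  using assms unfolding differentiable_def
  by (auto simp: pderiv_i_eqI pderiv_i_eqI[OF has_derivative_mult])

lemma pderiv_i_const: "pderiv_i i (\<lambda>_. c) x = 0"
  by (subst pderiv_i_eqI[OF has_derivative_const]) simp

lemma Ck_const: "Ck k (\<lambda>_. c)"
  by (induction k arbitrary: c) (auto simp: pderiv_i_const[abs_def])

lemma Ck_add: "Ck k f \<Longrightarrow> Ck k g \<Longrightarrow> Ck k (\<lambda>x. f x + g x)"
proof (induction k arbitrary: f g)
  case (Suc k)
  have "pderiv_i i (\<lambda>x. f x + g x) = (\<lambda>x. pderiv_i i f x + pderiv_i i g x)" for i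
    using Suc.prems by (intro ext pderiv_i_add) auto
  then show ?case using Suc by (auto intro!: continuous_intros)
qed (auto intro!: continuous_intros)

lemma Ck_mult: "Ck k f \<Longrightarrow> Ck k g \<Longrightarrow> Ck k (\<lambda>x. f x * g x)"
proof (induction k arbitrary: f g)
  case (Suc k)
  have "pderiv_i i (\<lambda>x. f x * g x) = (\<lambda>x. f x * pderiv_i i g x + pderiv_i i f x * g x)" for i
    using Suc.prems by (intro ext pderiv_i_mult) auto
  moreover have "Ck k f" "Ck k g" using Suc.prems Ck_SucD by auto
  ultimately show ?case using Suc by (auto intro!: continuous_intros Ck_add)
qed (auto intro!: continuous_intros)

lemma Ck_prod: "finite S \<Longrightarrow> (\<And>i. i \<in> S \<Longrightarrow> Ck k (f i)) \<Longrightarrow> Ck k (\<lambda>x. \<Prod>i\<in>S. f i x)"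
  by (induction S rule: finite_induct) (auto intro: Ck_const Ck_mult)

lemma smooth_fun_add: "smooth_fun f \<Longrightarrow> smooth_fun g \<Longrightarrow> smooth_fun (\<lambda>x. f x + g x)"
  and smooth_fun_mult: "smooth_fun f \<Longrightarrow> smooth_fun g \<Longrightarrow> smooth_fun (\<lambda>x. f x * g x)"
  by (auto simp: smooth_fun_def Ck_add Ck_mult)

lemma smooth_fun_differentiable: "smooth_fun f \<Longrightarrow> f differentiable (at x)"
  unfolding smooth_fun_def by (metis Ck.simps(2))

lemma smooth_fun_cont: "smooth_fun f \<Longrightarrow> continuous_on UNIV f"
  unfolding smooth_fun_def by (metis Ck.simps(1))

lemma smooth_fun_pderiv_cont: "smooth_fun f \<Longrightarrow> continuous_on UNIV (pderiv_i i f)"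
  unfolding smooth_fun_def by (metis Ck.simps Ck_cont)

text \<open>The classical function exp(-1/t), together with its quotients by powers of t: the linear
  span of this family is closed under differentiation, so smoothness follows by induction with
  \<open>n\<close> arbitrary.\<close>

definition flat :: "nat \<Rightarrow> real \<Rightarrow> real" where
  "flat n t = (if t > 0 then exp (- (1/t)) / t ^ n else 0)"

lemma flat_tendsto_0: "(flat n \<longlongrightarrow> 0) (at 0)"
proof -
  have "((\<lambda>t. inverse t ^ n / exp (inverse t)) \<longlongrightarrow> 0) (at_right (0::real))"
    by (rule filterlim_compose[OF tendsto_power_div_exp_0 filterlim_inverse_at_top_right])
  moreover have "eventually (\<lambda>t. inverse t ^ n / exp (inverse t) = flat n t) (at_right (0::real))"
    by (rule eventually_at_right_less[THEN eventually_mono]) (auto simp: flat_def exp_minus field_simps)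
  ultimately have r: "(flat n \<longlongrightarrow> 0) (at_right 0)" by (rule Lim_transform_eventually)
  have "eventually (\<lambda>t. 0 = flat n t) (at_left (0::real))"
    by (auto simp: flat_def eventually_at_left_real intro: eventually_mono[OF eventually_at_left_real[of "-1"]])
  then have "(flat n \<longlongrightarrow> 0) (at_left 0)" by (rule Lim_transform_eventually[OF tendsto_const])
  with r show ?thesis by (simp add: filterlim_at_split)
qed

text \<open>Only t = 0 is delicate: from the right the difference quotient of \<open>flat n\<close>
  is \<open>flat (n+1)\<close> itself, which tends to 0 there.\<close>

lemma flat_deriv: "(flat n has_real_derivative (flat (n+2) t - n * flat (n+1) t)) (at t)"
proof (cases t "0::real" rule: linorder_cases)
  case less
  have "((\<lambda>_. 0) has_real_derivative 0) (at t)" by simp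
  then have "(flat n has_real_derivative 0) (at t)"
    by (rule has_field_derivative_transform_within_open[of _ _ _ "{..<0}"]) (use less in \<open>auto simp: flat_def\<close>)
  then show ?thesis using less by (simp add: flat_def)
next
  case equal
  have "((\<lambda>h. (flat n (0 + h) - flat n 0) / h) \<longlongrightarrow> 0) (at 0)"
    by (rule Lim_transform_eventually[OF flat_tendsto_0[of "Suc n"]]) (auto simp: flat_def eventually_at_filter)
  then show ?thesis using equal by (simp add: DERIV_def flat_def)
next
  case greater
  have "((\<lambda>t. exp (- (1/t)) / t ^ n) has_real_derivative (flat (n+2) t - n * flat (n+1) t)) (at t)"
    using greater by (auto intro!: derivative_eq_intros simp: flat_def) 
      (cases n; simp add: field_simps power2_eq_square)
  then show ?thesis
    by (rule has_field_derivative_transform_within_open[of _ _ _ "{0<..}"]) (use greater in \<open>auto simp: flat_def\<close>)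
qed

lemma Ck_flat: "Ck k (\<lambda>x::real^'n::finite. flat n (c * (x $ i) + d))"
proof (induction k arbitrary: n)
  have cont: "continuous_on UNIV (\<lambda>x::real^'n. flat n (c * (x $ i) + d))" for n
  proof -
    have "continuous_on UNIV (flat n)" 
      using flat_deriv DERIV_isCont by (blast intro: continuous_at_imp_continuous_on)
    then show ?thesis by (rule continuous_on_compose2) (auto intro!: continuous_intros)
  qed
  case 0
  show ?case using cont by simp
  case (Suc k)
  have der: "((\<lambda>x::real^'n. flat n (c * (x $ i) + d)) has_derivative
     (\<lambda>h. (flat (n+2) (c * (x $ i) + d) - n * flat (n+1) (c * (x $ i) + d)) * (c * h $ i))) (at x)" for x
  proof -
    have "((\<lambda>x::real^'n. c * (x $ i) + d) has_derivative (\<lambda>h. c * h $ i)) (at x)"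
      by (auto intro!: derivative_eq_intros bounded_linear.has_derivative[OF bounded_linear_vec_nth])
    from has_derivative_compose[OF this flat_deriv[unfolded has_field_derivative_def]] show ?thesis by simp
  qed
  have "pderiv_i j (\<lambda>x::real^'n. flat n (c * (x $ i) + d)) = 
    (\<lambda>x. (c * axis j 1 $ i) * (flat (n+2) (c * (x $ i) + d) + (- n) * flat (n+1) (c * (x $ i) + d)))" for j
    by (rule ext) (simp add: pderiv_i_eqI[OF der])
  moreover have "Ck k (\<lambda>x::real^'n. (c * axis j 1 $ i) * (flat (n+2) (c * (x $ i) + d) + (- n) * flat (n+1) (c * (x $ i) + d)))" for j
    by (intro Ck_mult Ck_add Ck_const Suc.IH)
  moreover have "(\<lambda>x::real^'n. flat n (c * (x $ i) + d)) differentiable (at x)" for x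
    using der differentiable_def by blast
  ultimately show ?case using cont by simp
qed

text \<open>A smooth approximation from below of the indicator of \<open>box a b\<close>: the
  argument of each factor is m+1 times the distance to a face, and \<open>flat 0\<close> tends to 1
  at infinity. The affine form of the arguments is that of \<open>Ck_flat\<close>.\<close>

definition bump :: "real^'n::finite \<Rightarrow> real^'n \<Rightarrow> nat \<Rightarrow> real^'n \<Rightarrow> real" where
  "bump a b m x = (\<Prod>i\<in>UNIV. flat 0 (real (Suc m) * (x $ i) + - real (Suc m) * a $ i) * flat 0 (- real (Suc m) * (x $ i) + real (Suc m) * b $ i))"

lemma smooth_fun_bump: "smooth_fun (bump a b m)"
  unfolding smooth_fun_def bump_def[abs_def] by (intro allI Ck_prod Ck_mult Ck_flat) auto

lemma flat_0_bounds: "0 \<le> flat 0 t" "flat 0 t \<le> 1"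
  by (auto simp: flat_def)

lemma bump_eq_0: "x \<notin> box a b \<Longrightarrow> bump a b m x = 0"
proof -
  assume "x \<notin> box a b"
  then obtain i where i: "\<not> (a $ i < x $ i) \<or> \<not> (x $ i < b $ i)" by (auto simp: mem_box_cart)
  have 1: "real (Suc m) * (x $ i) + - real (Suc m) * a $ i = real (Suc m) * (x $ i - a $ i)"
       "- real (Suc m) * (x $ i) + real (Suc m) * b $ i = real (Suc m) * (b $ i - x $ i)" by (simp_all add: algebra_simps)
  have "flat 0 (real (Suc m) * (x $ i) + - real (Suc m) * a $ i) * flat 0 (- real (Suc m) * (x $ i) + real (Suc m) * b $ i) = 0"
    unfolding 1 using i by (auto simp: flat_def zero_less_mult_iff simp del: of_nat_Suc)
  then show ?thesis unfolding bump_def by (intro prod_zero) auto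
qed

lemma bump_bounds: "0 \<le> bump a b m x" "bump a b m x \<le> 1"
  unfolding bump_def using flat_0_bounds
  by (auto intro!: prod_nonneg prod_le_1 mult_nonneg_nonneg mult_le_one)

lemma bump_tendsto: 
  assumes "x \<in> box a b" shows "(\<lambda>m. bump a b m x) \<longlonglongrightarrow> 1"
proof -
  have *: "(\<lambda>m. flat 0 (real (Suc m) * s)) \<longlonglongrightarrow> 1" if "s > 0" for s :: real
  proof -
    have "filterlim (\<lambda>m. real (Suc m) * s) at_top sequentially"
      by (rule filterlim_at_top_mult_tendsto_pos[OF tendsto_const that])
         (rule filterlim_compose[OF filterlim_real_sequentially filterlim_Suc])
    then have "(\<lambda>m. inverse (real (Suc m) * s)) \<longlonglongrightarrow> 0" by (rule tendsto_inverse_0_at_top)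
    then have "(\<lambda>m. exp (- (inverse (real (Suc m) * s)))) \<longlonglongrightarrow> exp (-0)" by (intro tendsto_intros)
    then show ?thesis using that by (simp add: flat_def inverse_eq_divide del: of_nat_Suc)
  qed
  have "(\<lambda>m. bump a b m x) \<longlonglongrightarrow> (\<Prod>i\<in>(UNIV::'a set). 1 * 1)"
    unfolding bump_def
  proof (intro tendsto_prod tendsto_mult)
    fix i
    have ii: "x $ i - a $ i > 0" "b $ i - x $ i > 0" using assms by (auto simp: mem_box_cart)
    show "(\<lambda>m. flat 0 (real (Suc m) * (x $ i) + - real (Suc m) * a $ i)) \<longlonglongrightarrow> 1"
      using *[OF ii(1)] by (simp add: right_diff_distrib del: of_nat_Suc)
    show "(\<lambda>m. flat 0 (- real (Suc m) * (x $ i) + real (Suc m) * b $ i)) \<longlonglongrightarrow> 1"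
      using *[OF ii(2)] by (simp add: right_diff_distrib add.commute del: of_nat_Suc)
  qed
  then show ?thesis by simp
qed

lemma test_fun_bump:
  assumes "cbox a b \<subseteq> \<Omega>" shows "test_fun \<Omega> (bump a b m)"
proof -
  have "{x. bump a b m x \<noteq> 0} \<subseteq> box a b" using bump_eq_0 by blast
  then have sub: "closure {x. bump a b m x \<noteq> 0} \<subseteq> cbox a b"
    using box_subset_cbox by (intro closure_minimal) (auto simp: closed_cbox)
  then have "compact (closure {x. bump a b m x \<noteq> 0})" by (metis closed_closure compact_Int_closed compact_cbox inf.absorb_iff2)
  then show ?thesis unfolding test_fun_def using sub assms smooth_fun_bump by blast
qed

section \<open>From vanishing test integrals to vanishing almost everywhere\<close>

lemma borel_measurable_lebesgue_cont:
  fixes f :: "'a::euclidean_space \<Rightarrow> 'b::{second_countable_topology,topological_space}"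
  shows "continuous_on UNIV f \<Longrightarrow> f \<in> borel_measurable lebesgue"
  by (simp add: measurable_completion borel_measurable_continuous_onI)

lemma sigma_finite_lebesgue: "sigma_finite_measure (lebesgue :: 'a::euclidean_space measure)"
proof -
  obtain A :: "'a set set" where "countable A" "A \<subseteq> sets lborel" "\<Union>A = space lborel" "\<forall>a\<in>A. emeasure lborel a \<noteq> \<infinity>"
    using lborel.sigma_finite_countable by blast
  then show ?thesis by (intro sigma_finite_measure.intro exI[of _ A]) (auto simp: subset_iff)
qed

text \<open>Boxes are an intersection-stable generator of the Borel sets, so the sets with zero
  integral exhaust them; the total integral starts the complement step.\<close>

lemma box_integrals_0_imp_AE_0:
  fixes h :: "'a::euclidean_space \<Rightarrow> complex"
  assumes h: "integrable lebesgue h" and tot: "integral\<^sup>L lebesgue h = 0"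
    and box: "\<And>a b. (LINT x:box a b|lebesgue. h x) = 0"
  shows "AE x in lebesgue. h x = 0"
proof -
  have seti: "set_integrable lebesgue A h" if "A \<in> sets lebesgue" for A
    using that h unfolding set_integrable_def by (rule integrable_mult_indicator)
  have bor: "(LINT x:A|lebesgue. h x) = 0" if A: "A \<in> sets borel" for A
  proof -
    have "Int_stable (range (\<lambda>(a, b). box a b :: 'a set))"
      by (auto simp: Int_stable_def box_Int_box)
    moreover have "range (\<lambda>(a, b). box a b :: 'a set) \<subseteq> Pow UNIV" by auto
    moreover have "A \<in> sigma_sets UNIV (range (\<lambda>(a, b). box a b))" using A unfolding borel_eq_box by simp
    ultimately show ?thesis
    proof (induction rule: sigma_sets_induct_disjoint)
      case (basic A) then show ?case using box by auto
    next
      case empty show ?case by (simp add: set_lebesgue_integral_def)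
    next
      case (compl A)
      then have A: "A \<in> sets lebesgue" by (auto simp: borel_eq_box)
      then have A': "UNIV - A \<in> sets lebesgue" using sets.compl_sets[of A lebesgue] by simp
      have "(LINT x:UNIV|lebesgue. h x) = (LINT x:A|lebesgue. h x) + (LINT x:(UNIV - A)|lebesgue. h x)"
        using set_integral_Un[of A "UNIV - A" lebesgue h] seti[OF A] seti[OF A'] by simp
      then show ?case using compl tot by (simp add: set_lebesgue_integral_def)
    next
      case (union F)
      then have F: "F i \<in> sets lebesgue" for i by (auto simp: borel_eq_box subset_eq)
      have "(LINT x:(\<Union>i. F i)|lebesgue. h x) = (\<Sum>i. LINT x:F i|lebesgue. h x)"
        using union(1) F seti by (intro lebesgue_integral_countable_add) (auto simp: disjoint_family_on_def)
      then show ?case using union by simp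
    qed
  qed
  have "AE x in lebesgue. h x = (\<lambda>_. 0) x"
  proof (rule sigma_finite_measure.density_unique_banach[OF sigma_finite_lebesgue h])
    fix A :: "'a set" assume "A \<in> sets lebesgue"
    \<comment> \<open>A Lebesgue set is a Borel set up to a null set, so the integral over it is
      already known to vanish.\<close>
    then obtain S N N' where A: "A = S \<union> N" "N \<subseteq> N'" "N' \<in> null_sets lborel" "S \<in> sets lborel"
      by (rule sets_completionE)
    have "AE x in lborel. x \<notin> N'" using A(3) by (rule AE_not_in)
    then have "AE x in lebesgue. x \<notin> N'" by (rule AE_completion)
    then have "AE x in lebesgue. indicator A x *\<^sub>R h x = indicator S x *\<^sub>R h x"
      by eventually_elim (use A in \<open>auto simp: indicator_def\<close>)
    then have "(LINT x:A|lebesgue. h x) = (LINT x:S|lebesgue. h x)"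
      unfolding set_lebesgue_integral_def
      by (intro integral_cong_AE) (use h A \<open>A \<in> sets lebesgue\<close> in \<open>auto intro!: borel_measurable_scaleR borel_measurable_indicator\<close>)
    then show "set_lebesgue_integral lebesgue A h = set_lebesgue_integral lebesgue A (\<lambda>_. 0)"
      using bor[of S] A by (simp add: set_lebesgue_integral_def)
  qed simp
  then show ?thesis by simp
qed

text \<open>Bumps converge boundedly to indicators of boxes whose closure lies in
  \<open>\<Omega>\<close>, so the integrals over those boxes vanish. The previous lemma applies to
  \<open>g\<close> cut off to one such box, and countably many of them cover
  \<open>\<Omega>\<close>.\<close>

lemma fundamental_lemma_calculus_of_variations:
  fixes g :: "real^'n::finite \<Rightarrow> complex"
  assumes op: "open \<Omega>" and g: "set_integrable lebesgue \<Omega> g"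
    and test: "\<And>\<phi>. test_fun \<Omega> \<phi> \<Longrightarrow> (LINT x:\<Omega>|lebesgue. g x * complex_of_real (\<phi> x)) = 0"
  shows "AE x in lebesgue. x \<in> \<Omega> \<longrightarrow> g x = 0"
proof -
  define g0 where "g0 = (\<lambda>x. indicator \<Omega> x *\<^sub>R g x)"
  have g0: "integrable lebesgue g0" using g by (simp add: set_integrable_def g0_def)
  have box0: "(LINT x:box a b|lebesgue. g0 x) = 0" if ab: "cbox a b \<subseteq> \<Omega>" for a b
  proof -
    have "(\<lambda>m. \<integral>x. g0 x * complex_of_real (bump a b m x) \<partial>lebesgue) \<longlonglongrightarrow> (\<integral>x. indicator (box a b) x *\<^sub>R g0 x \<partial>lebesgue)"
    proof (rule integral_dominated_convergence[where w="\<lambda>x. norm (g0 x)"])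
      note g0m = borel_measurable_integrable[OF g0]
      show "(\<lambda>x. indicator (box a b) x *\<^sub>R g0 x) \<in> borel_measurable lebesgue"
        using g0m by (intro borel_measurable_scaleR borel_measurable_indicator) auto
      have "bump a b m \<in> borel_measurable lebesgue" for m
        by (rule borel_measurable_lebesgue_cont[OF smooth_fun_cont[OF smooth_fun_bump]])
      then show "(\<lambda>x. g0 x * complex_of_real (bump a b m x)) \<in> borel_measurable lebesgue" for m
        using g0m by (intro borel_measurable_times borel_measurable_of_real) auto
      show "integrable lebesgue (\<lambda>x. norm (g0 x))" using g0 by simp
      show "AE x in lebesgue. (\<lambda>m. g0 x * complex_of_real (bump a b m x)) \<longlonglongrightarrow> indicator (box a b) x *\<^sub>R g0 x"
      proof (intro AE_I2)
        fix x
        show "(\<lambda>m. g0 x * complex_of_real (bump a b m x)) \<longlonglongrightarrow> indicator (box a b) x *\<^sub>R g0 x"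
        proof (cases "x \<in> box a b")
          case True
          have "(\<lambda>m. g0 x * complex_of_real (bump a b m x)) \<longlonglongrightarrow> g0 x * complex_of_real 1"
            by (intro tendsto_intros bump_tendsto[OF True])
          then show ?thesis using True by simp
        qed (simp add: bump_eq_0)
      qed
      show "AE x in lebesgue. norm (g0 x * complex_of_real (bump a b m x)) \<le> norm (g0 x)" for m
        using bump_bounds[of a b m] by (intro AE_I2) (auto simp: norm_mult abs_of_nonneg intro!: mult_left_le)
    qed
    moreover have "(\<integral>x. g0 x * complex_of_real (bump a b m x) \<partial>lebesgue) = 0" for m
      using test[OF test_fun_bump[OF ab]] by (simp add: set_lebesgue_integral_def g0_def)
    ultimately show ?thesis by (simp add: set_lebesgue_integral_def LIMSEQ_const_iff)
  qed
  have boxAE: "AE x in lebesgue. x \<in> box a b \<longrightarrow> g x = 0" if ab: "cbox a b \<subseteq> \<Omega>" for a b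
  proof -
    define h where "h = (\<lambda>x. indicator (box a b) x *\<^sub>R g0 x)"
    have h: "integrable lebesgue h" unfolding h_def using g0 by (intro integrable_mult_indicator) auto
    have "AE x in lebesgue. h x = 0"
    proof (rule box_integrals_0_imp_AE_0[OF h])
      show "integral\<^sup>L lebesgue h = 0" using box0[OF ab] by (simp add: h_def set_lebesgue_integral_def)
      fix c d
      obtain a' b' where I: "box c d \<inter> box a b = box a' b'" by (rule that[OF box_Int_box])
      have "(LINT x:box c d|lebesgue. h x) = (LINT x:box a' b'|lebesgue. g0 x)"
        unfolding h_def set_lebesgue_integral_def I[symmetric] by (intro Bochner_Integration.integral_cong) (auto simp: indicator_def)
      also have "\<dots> = 0"
      \<comment> \<open>A degenerate box is empty although its \<open>cbox\<close> may be nonempty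
        and lie anywhere; only for a nonempty box is \<open>cbox\<close> its closure, hence
        contained in the outer closed box.\<close>
      proof (cases "box a' b' = {}")
        case True
        then show ?thesis by (simp add: set_lebesgue_integral_def)
      next
        case False
        have "cbox a' b' = closure (box a' b')" using closure_box[OF False] by simp
        also have "\<dots> \<subseteq> closure (box a b)" using I by (intro closure_mono) auto
        also have "\<dots> \<subseteq> cbox a b" using box_subset_cbox closed_cbox by (intro closure_minimal)
        finally show ?thesis using box0 ab by auto
      qed
      finally show "(LINT x:box c d|lebesgue. h x) = 0" .
    qed
    then show ?thesis
    proof (rule eventually_mono)
      fix x assume "h x = 0"
      moreover have "box a b \<subseteq> \<Omega>" using ab box_subset_cbox by blast
      ultimately show "x \<in> box a b \<longrightarrow> g x = 0" by (auto simp: h_def g0_def indicator_def)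
    qed
  qed
  obtain \<D> where D: "\<D> \<subseteq> {box a b | a b. cbox a b \<subseteq> \<Omega>}" "countable \<D>" "\<Union>\<D> = \<Union>{box a b | a b. cbox a b \<subseteq> \<Omega>}"
    using Lindelof[of "{box a b | a b. cbox a b \<subseteq> \<Omega>}"] open_box by blast
  have "\<Omega> \<subseteq> \<Union>\<D>"
  proof
    fix x assume "x \<in> \<Omega>"
    then obtain a b where "cbox a b \<subseteq> \<Omega>" "x \<in> box a b" using open_contains_cbox[OF op] by metis
    then show "x \<in> \<Union>\<D>" unfolding D(3) by blast
  qed
  moreover have "AE x in lebesgue. \<forall>X\<in>\<D>. x \<in> X \<longrightarrow> g x = 0"
    unfolding AE_ball_countable[OF D(2)] using D(1) boxAE by blast
  ultimately show ?thesis by (auto elim!: eventually_mono)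
qed

section \<open>Integrals of derivatives of compactly supported functions\<close>

lemma compact_support_bounded:
  fixes f :: "'a::euclidean_space \<Rightarrow> real"
  assumes c: "continuous_on UNIV f" and K: "compact K" and z: "\<And>x. x \<notin> K \<Longrightarrow> f x = 0"
  shows "\<exists>B>0. \<forall>x. \<bar>f x\<bar> \<le> B"
proof -
  have "compact (f ` K)" using c K by (intro compact_continuous_image) (auto intro: continuous_on_subset)
  then have "bounded (f ` K)" by (rule compact_imp_bounded)
  then obtain B where B: "B > 0" "\<And>y. y \<in> f ` K \<Longrightarrow> norm y \<le> B" by (auto simp: bounded_pos)
  have "\<bar>f x\<bar> \<le> B" for x using B z[of x] by (cases "x \<in> K") auto
  then show ?thesis using B(1) by blast
qed

lemma compact_support_integrable:
  fixes f :: "'a::euclidean_space \<Rightarrow> real"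
  assumes c: "continuous_on UNIV f" and K: "compact K" and z: "\<And>x. x \<notin> K \<Longrightarrow> f x = 0"
  shows "integrable lborel f"
proof -
  have "integrable lborel (\<lambda>x. indicator K x *\<^sub>R f x)"
    using K c by (intro borel_integrable_compact) (auto intro: continuous_on_subset)
  moreover have "(\<lambda>x. indicator K x *\<^sub>R f x) = f" using z by (auto simp: indicator_def fun_eq_iff)
  ultimately show ?thesis by simp
qed

lemma has_derivative_along_axis:
  fixes f :: "real^'n::finite \<Rightarrow> real"
  assumes "f differentiable (at (x + s *\<^sub>R axis i 1))"
  shows "((\<lambda>s. f (x + s *\<^sub>R axis i 1)) has_real_derivative pderiv_i i f (x + s *\<^sub>R axis i 1)) (at s)"
proof -
  obtain f' where f': "(f has_derivative f') (at (x + s *\<^sub>R axis i 1))" using assms by (auto simp: differentiable_def)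
  have "((\<lambda>s. x + s *\<^sub>R axis i 1) has_derivative (\<lambda>h. h *\<^sub>R axis i 1)) (at s)"
    by (auto intro!: derivative_eq_intros)
  from has_derivative_compose[OF this f']
  have "((\<lambda>s. f (x + s *\<^sub>R axis i 1)) has_derivative (\<lambda>h. f' (h *\<^sub>R axis i 1))) (at s)" .
  moreover have "f' (h *\<^sub>R axis i 1) = pderiv_i i f (x + s *\<^sub>R axis i 1) * h" for h
    using linear_cmul[OF has_derivative_linear[OF f'], of h "axis i 1"] pderiv_i_eqI[OF f', of i] by simp
  ultimately show ?thesis by (simp add: has_field_derivative_def)
qed

lemma pderiv_i_eq_0_outside:
  assumes "x \<notin> closure {x. f x \<noteq> 0}" shows "pderiv_i i f x = 0"
proof -
  have z: "0 = f y" if "y \<in> - closure {x. f x \<noteq> 0}" for y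
    using that closure_subset[of "{x. f x \<noteq> 0}"] by auto
  have "open (- closure {x. f x \<noteq> 0})" "x \<in> - closure {x. f x \<noteq> 0}" using assms by auto
  from has_derivative_transform_within_open[where f="\<lambda>_. 0" and g=f and t=UNIV, OF has_derivative_const this z]
  have "(f has_derivative (\<lambda>_. 0)) (at x)" .
  from pderiv_i_eqI[OF this] show ?thesis .
qed

text \<open>Difference quotients have integral zero by translation invariance.\<close>

lemma integral_pderiv_0:
  fixes f :: "real^'n::finite \<Rightarrow> real"
  assumes f: "smooth_fun f" and K: "compact (closure {x. f x \<noteq> 0})"
  shows "integral\<^sup>L lebesgue (pderiv_i i f) = 0"
proof -
  define e :: "real^'n" where "e = axis i 1"
  define K where "K = closure {x. f x \<noteq> 0}"
  note cont = smooth_fun_cont[OF f] and pcont = smooth_fun_pderiv_cont[OF f, of i]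
  have pz: "pderiv_i i f x = 0" if "x \<notin> K" for x using pderiv_i_eq_0_outside that by (auto simp: K_def)
  have fz: "f x = 0" if "x \<notin> K" for x using that closure_subset[of "{x. f x \<noteq> 0}"] by (auto simp: K_def)
  have cK: "compact K" using K by (simp add: K_def)
  obtain B where B: "B > 0" "\<And>x. \<bar>pderiv_i i f x\<bar> \<le> B"
    using compact_support_bounded[OF pcont cK pz] by auto
  obtain R where R: "\<And>x. x \<in> K \<Longrightarrow> norm x \<le> R" using compact_imp_bounded[OF cK] by (auto simp: bounded_iff)
  have fi: "integrable lborel f" by (rule compact_support_integrable[OF cont cK fz])
  define d where "d = (\<lambda>n x. real (Suc n) * (f (x + (1 / real (Suc n)) *\<^sub>R e) - f x))"
  have trans: "integrable lborel (\<lambda>x. f (x + c))" "(\<integral>x. f (x + c) \<partial>lborel) = (\<integral>x. f x \<partial>lborel)" for c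
  proof -
    have m: "(+) c \<in> lborel \<rightarrow>\<^sub>M borel" by simp
    have fb: "f \<in> borel_measurable borel" using cont by (rule borel_measurable_continuous_onI)
    have "integrable (distr lborel borel ((+) c)) f" using fi by (simp add: lborel_distr_plus)
    then show "integrable lborel (\<lambda>x. f (x + c))" using integrable_distr_eq[OF m fb] by (simp add: add.commute)
    have "(\<integral>x. f x \<partial>distr lborel borel ((+) c)) = (\<integral>x. f (c + x) \<partial>lborel)" by (rule integral_distr[OF m fb])
    then show "(\<integral>x. f (x + c) \<partial>lborel) = (\<integral>x. f x \<partial>lborel)" by (simp add: lborel_distr_plus add.commute)
  qed
  have d0: "integral\<^sup>L lborel (d n) = 0" for n
    unfolding d_def using trans fi by simp
  \<comment> \<open>The mean value theorem serves twice: continuity of the derivative gives the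
    pointwise limit, its bound gives the domination.\<close>
  have mvt: "\<exists>\<xi>. 0 < \<xi> \<and> \<xi> < 1 / real (Suc n) \<and> d n x = pderiv_i i f (x + \<xi> *\<^sub>R e)" for n x
  proof -
    have "\<exists>z>0. z < 1 / real (Suc n) \<and> f (x + (1 / real (Suc n)) *\<^sub>R e) - f (x + 0 *\<^sub>R e) = (1 / real (Suc n) - 0) * pderiv_i i f (x + z *\<^sub>R e)"
      unfolding e_def by (rule MVT2) (auto intro!: has_derivative_along_axis smooth_fun_differentiable[OF f])
    then show ?thesis unfolding d_def by (auto simp: field_simps)
  qed
  have "(\<lambda>n. integral\<^sup>L lborel (d n)) \<longlonglongrightarrow> integral\<^sup>L lborel (pderiv_i i f)"
  \<comment> \<open>All shifts are shorter than 1, so the quotients vanish outside the ball of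
    radius R + 1 although the support only lies in radius R.\<close>
  proof (rule integral_dominated_convergence[where w="\<lambda>x. indicator (cball 0 (R+1)) x *\<^sub>R B"])
    show "pderiv_i i f \<in> borel_measurable lborel" using borel_measurable_continuous_onI[OF pcont] by simp
    show "d n \<in> borel_measurable lborel" for n
      unfolding d_def using trans(1) fi by (intro borel_measurable_times borel_measurable_diff borel_measurable_const) auto
    show "integrable lborel (\<lambda>x. indicator (cball 0 (R+1)) x *\<^sub>R B)"
      by (intro borel_integrable_compact) auto
    show "AE x in lborel. (\<lambda>n. d n x) \<longlonglongrightarrow> pderiv_i i f x"
    proof (rule AE_I2)
      fix x
      have "\<forall>n. \<exists>\<xi>. 0 < \<xi> \<and> \<xi> < 1 / real (Suc n) \<and> d n x = pderiv_i i f (x + \<xi> *\<^sub>R e)" using mvt by blast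
      from choice[OF this] obtain \<xi> where
        \<xi>: "\<And>n. 0 < \<xi> n \<and> \<xi> n < 1 / real (Suc n) \<and> d n x = pderiv_i i f (x + \<xi> n *\<^sub>R e)" by blast
      have lim: "(\<lambda>n. 1 / real (Suc n)) \<longlonglongrightarrow> 0" using LIMSEQ_inverse_real_of_nat by (simp add: inverse_eq_divide)
      have "norm (\<xi> n) \<le> 1 / real (Suc n)" for n using \<xi>[of n] by (simp del: of_nat_Suc)
      then have "eventually (\<lambda>n. norm (\<xi> n) \<le> 1 / real (Suc n)) sequentially" by (intro always_eventually allI)
      then have "\<xi> \<longlonglongrightarrow> 0" using lim by (rule Lim_null_comparison)
      then have "(\<lambda>n. x + \<xi> n *\<^sub>R e) \<longlonglongrightarrow> x + 0 *\<^sub>R e" by (intro tendsto_intros)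
      from continuous_on_tendsto_compose[OF pcont this]
      have "(\<lambda>n. pderiv_i i f (x + \<xi> n *\<^sub>R e)) \<longlonglongrightarrow> pderiv_i i f x" by simp
      moreover have "(\<lambda>n. d n x) = (\<lambda>n. pderiv_i i f (x + \<xi> n *\<^sub>R e))" using \<xi> by blast
      ultimately show "(\<lambda>n. d n x) \<longlonglongrightarrow> pderiv_i i f x" by simp
    qed
    show "AE x in lborel. norm (d n x) \<le> indicator (cball 0 (R+1)) x *\<^sub>R B" for n
    proof (rule AE_I2)
      fix x
      obtain z where z: "0 < z" "z < 1 / real (Suc n)" "d n x = pderiv_i i f (x + z *\<^sub>R e)" using mvt[of n x] by blast
      show "norm (d n x) \<le> indicator (cball 0 (R+1)) x *\<^sub>R B"
      proof (cases "x + z *\<^sub>R e \<in> K")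
        case True
        have "1 / real (Suc n) \<le> 1" by simp
        then have "z < 1" using z(2) by linarith
        then have "norm (z *\<^sub>R e) \<le> 1" using z(1,2) by (simp add: e_def norm_axis_1)
        moreover have "norm x \<le> norm (x + z *\<^sub>R e) + norm (z *\<^sub>R e)" using norm_triangle_ineq4[of "x + z *\<^sub>R e" "z *\<^sub>R e"] by simp
        ultimately have "norm x \<le> R + 1" using R[OF True] by linarith
        then show ?thesis using z(3) B(2) by (simp add: indicator_def)
      next
        case False
        then show ?thesis using z(3) pz B(1) by (simp add: indicator_def)
      qed
    qed
  qed
  then have "integral\<^sup>L lborel (pderiv_i i f) = 0" using d0 by (simp add: LIMSEQ_const_iff)
  moreover have "pderiv_i i f \<in> borel_measurable lborel" using borel_measurable_continuous_onI[OF pcont] by simp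
  ultimately show ?thesis by (simp add: integral_completion)
qed

section \<open>Weak derivatives\<close>

text \<open>Stated for an arbitrary measure, to be used with Lebesgue measure restricted to
  \<open>\<Omega>\<close>; the set integrals of the problem then become plain integrals.\<close>

definition sqi :: "'a measure \<Rightarrow> ('a \<Rightarrow> complex) \<Rightarrow> bool" where
  "sqi N u \<longleftrightarrow> u \<in> borel_measurable N \<and> integrable N (\<lambda>x. (cmod (u x))\<^sup>2)"

definition nm :: "'a measure \<Rightarrow> ('a \<Rightarrow> complex) \<Rightarrow> real" where
  "nm N u = sqrt (\<integral>x. (cmod (u x))\<^sup>2 \<partial>N)"

lemma sqi_measurable: "sqi N u \<Longrightarrow> u \<in> borel_measurable N"
  and sqi_integrable: "sqi N u \<Longrightarrow> integrable N (\<lambda>x. (cmod (u x))\<^sup>2)"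
  by (auto simp: sqi_def)

lemma sqi_bound:
  assumes "u \<in> borel_measurable N" "integrable N f" "AE x in N. (cmod (u x))\<^sup>2 \<le> f x"
  shows "sqi N u"
  unfolding sqi_def
proof (intro conjI assms(1), rule Bochner_Integration.integrable_bound[OF assms(2)])
  show "(\<lambda>x. (cmod (u x))\<^sup>2) \<in> borel_measurable N" using assms(1) by measurable
  show "AE x in N. norm ((cmod (u x))\<^sup>2) \<le> norm (f x)" using assms(3) by eventually_elim auto
qed

lemma sqi_scale: "sqi N u \<Longrightarrow> sqi N (\<lambda>x. c * u x)"
  by (rule sqi_bound[of _ _ "\<lambda>x. (cmod c)\<^sup>2 * (cmod (u x))\<^sup>2"]) (auto simp: sqi_def norm_mult power_mult_distrib)

lemma sqi_add: assumes "sqi N u" "sqi N w" shows "sqi N (\<lambda>x. u x + w x)"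
proof (rule sqi_bound[of _ _ "\<lambda>x. 2 * (cmod (u x))\<^sup>2 + 2 * (cmod (w x))\<^sup>2"])
  show "(\<lambda>x. u x + w x) \<in> borel_measurable N" using assms by (auto simp: sqi_def)
  show "integrable N (\<lambda>x. 2 * (cmod (u x))\<^sup>2 + 2 * (cmod (w x))\<^sup>2)" using assms by (auto simp: sqi_def)
  have "(cmod (a + b))\<^sup>2 \<le> 2 * (cmod a)\<^sup>2 + 2 * (cmod b)\<^sup>2" for a b
  proof -
    have "(cmod (a + b))\<^sup>2 \<le> (cmod a + cmod b)\<^sup>2" by (intro power_mono norm_triangle_ineq) auto
    also have "\<dots> \<le> 2 * (cmod a)\<^sup>2 + 2 * (cmod b)\<^sup>2"
      using zero_le_power2[of "cmod a - cmod b"] by (simp add: power2_sum power2_diff)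
    finally show ?thesis .
  qed
  then show "AE x in N. (cmod (u x + w x))\<^sup>2 \<le> 2 * (cmod (u x))\<^sup>2 + 2 * (cmod (w x))\<^sup>2" by auto
qed

lemma sqi_diff: assumes "sqi N u" "sqi N w" shows "sqi N (\<lambda>x. u x - w x)"
  using sqi_add[OF assms(1) sqi_scale[OF assms(2), of "-1"]] by simp

lemma sqi_sum: "finite S \<Longrightarrow> (\<And>i. i \<in> S \<Longrightarrow> sqi N (f i)) \<Longrightarrow> sqi N (\<lambda>x. \<Sum>i\<in>S. f i x)"
  by (induction S rule: finite_induct) (auto intro: sqi_add simp: sqi_def[of N "\<lambda>x. 0"])

lemma sqi_cnj: "sqi N u \<Longrightarrow> sqi N (\<lambda>x. cnj (u x))"
  unfolding sqi_def by (auto intro: measurable_compose[OF _ borel_measurable_continuous_onI[OF continuous_on_cnj[OF continuous_on_id]]])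

lemma sqi_mult_bounded:
  assumes "sqi N u" "w \<in> borel_measurable N" "AE x in N. cmod (w x) \<le> B"
  shows "sqi N (\<lambda>x. w x * u x)"
proof (rule sqi_bound[of _ _ "\<lambda>x. B\<^sup>2 * (cmod (u x))\<^sup>2"])
  show "(\<lambda>x. w x * u x) \<in> borel_measurable N" using assms by (auto simp: sqi_def)
  show "integrable N (\<lambda>x. B\<^sup>2 * (cmod (u x))\<^sup>2)" using assms by (auto simp: sqi_def)
  show "AE x in N. (cmod (w x * u x))\<^sup>2 \<le> B\<^sup>2 * (cmod (u x))\<^sup>2"
    using assms(3) by eventually_elim (auto simp: norm_mult power_mult_distrib intro!: mult_right_mono power_mono)
qed

lemma sqi_product:
  assumes "sqi N u" "sqi N w"
  shows "integrable N (\<lambda>x. cmod (u x) * cmod (w x))" "integrable N (\<lambda>x. u x * w x)"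
proof -
  have "cmod a * cmod b \<le> ((cmod a)\<^sup>2 + (cmod b)\<^sup>2) / 2" for a b
    using zero_le_power2[of "cmod a - cmod b"] by (simp add: power2_diff)
  then have le: "cmod (u x) * cmod (w x) \<le> ((cmod (u x))\<^sup>2 + (cmod (w x))\<^sup>2) / 2" for x by auto
  have i: "integrable N (\<lambda>x. ((cmod (u x))\<^sup>2 + (cmod (w x))\<^sup>2) / 2)" using assms by (auto simp: sqi_def)
  have m: "u \<in> borel_measurable N" "w \<in> borel_measurable N" using assms by (auto simp: sqi_def)
  show 1: "integrable N (\<lambda>x. cmod (u x) * cmod (w x))"
    by (rule Bochner_Integration.integrable_bound[OF i]) (use m le in \<open>auto intro!: AE_I2 simp: abs_mult intro: order_trans[OF le]\<close>)
  show "integrable N (\<lambda>x. u x * w x)"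
    by (rule Bochner_Integration.integrable_bound[OF 1]) (use m in \<open>auto simp: norm_mult\<close>)
qed

lemma nm_sq: "(nm N u)\<^sup>2 = (\<integral>x. (cmod (u x))\<^sup>2 \<partial>N)"
  by (simp add: nm_def)

lemma nm_nonneg: "nm N u \<ge> 0"
  by (simp add: nm_def)

text \<open>Integrating \<open>(b |u| - a |w|)\<^sup>2 \<ge> 0\<close> with \<open>a = \<parallel>u\<parallel>\<close> and \<open>b = \<parallel>w\<parallel>\<close>.\<close>

lemma integral_cauchy_schwarz:
  assumes "sqi N u" "sqi N w"
  shows "(\<integral>x. cmod (u x) * cmod (w x) \<partial>N) \<le> nm N u * nm N w"
proof -
  define a b J where "a = nm N u" "b = nm N w" "J = (\<integral>x. cmod (u x) * cmod (w x) \<partial>N)"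
  note iu = sqi_integrable[OF assms(1)] and iw = sqi_integrable[OF assms(2)] and ip = sqi_product(1)[OF assms]
  have key: "2 * (s * r) * J \<le> s\<^sup>2 * a\<^sup>2 + r\<^sup>2 * b\<^sup>2" for s r
  proof -
    have "0 \<le> (\<integral>x. (s * cmod (u x) - r * cmod (w x))\<^sup>2 \<partial>N)" by (rule integral_nonneg_AE) auto
    also have "(\<lambda>x. (s * cmod (u x) - r * cmod (w x))\<^sup>2) = (\<lambda>x. (s\<^sup>2 * (cmod (u x))\<^sup>2 + r\<^sup>2 * (cmod (w x))\<^sup>2) - 2 * (s * r) * (cmod (u x) * cmod (w x)))"
      by (auto simp: power2_diff power_mult_distrib algebra_simps)
    also have "(\<integral>x. (s\<^sup>2 * (cmod (u x))\<^sup>2 + r\<^sup>2 * (cmod (w x))\<^sup>2) - 2 * (s * r) * (cmod (u x) * cmod (w x)) \<partial>N) = s\<^sup>2 * a\<^sup>2 + r\<^sup>2 * b\<^sup>2 - 2 * (s * r) * J"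
      using iu iw ip by (simp add: a_b_J_def nm_sq)
    finally show ?thesis by simp
  qed
  have ab: "a \<ge> 0" "b \<ge> 0" by (auto simp: a_b_J_def nm_nonneg)
  have "J \<le> a * b"
  proof (cases "a = 0 \<or> b = 0")
    case False
    then have "a * b > 0" using ab by auto
    have "J * (a * b) \<le> (a * b) * (a * b)" using key[of b a] by (simp add: power2_eq_square algebra_simps)
    then show ?thesis using \<open>a * b > 0\<close> by (rule mult_right_le_imp_le)
  next
    case True
    have "J \<le> 0"
    proof (rule ccontr)
      assume J: "\<not> J \<le> 0"
      \<comment> \<open>The parameter belonging to the vanishing norm may be chosen freely; with (1
        + c)/J the left side of \<open>key\<close> is 2(1 + c), which exceeds both squared
        norms.\<close>
      define c where "c = a\<^sup>2 + b\<^sup>2"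
      have "2 * ((1 + c) / J) * J \<le> ((1+c)/J)\<^sup>2 * a\<^sup>2 + b\<^sup>2" "2 * ((1 + c) / J) * J \<le> a\<^sup>2 + ((1+c)/J)\<^sup>2 * b\<^sup>2"
        using key[of "(1+c)/J" 1] key[of 1 "(1+c)/J"] by auto
      moreover have "2 * ((1 + c) / J) * J = 2 * (1 + c)" using J by simp
      moreover have "c \<ge> a\<^sup>2" "c \<ge> b\<^sup>2" "c \<ge> 0" by (auto simp: c_def)
      ultimately show False using True by auto
    qed
    then show ?thesis using ab by (meson mult_nonneg_nonneg order_trans)
  qed
  then show ?thesis by (simp add: a_b_J_def)
qed

section \<open>Weak partial derivatives on a bounded open set\<close>

locale bounded_open_set =
  fixes \<Omega> :: "(real^'n::finite) set"
  assumes op: "open \<Omega>" and bd: "bounded \<Omega>"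
begin

definition N where "N = lebesgue_on \<Omega>"

lemma sets_\<Omega>: "\<Omega> \<in> sets lebesgue"
  using op by (simp add: borel_open)

lemma finite_measure_N: "finite_measure N"
  unfolding N_def using bd sets_\<Omega> by (intro finite_measure_lebesgue_on bounded_set_imp_lmeasurable)

lemma integrable_N: "set_integrable lebesgue \<Omega> f \<longleftrightarrow> integrable N f" for f :: "real^'n \<Rightarrow> 'b::{banach,second_countable_topology}"
  unfolding N_def set_integrable_def using sets_\<Omega> integrable_restrict_space[of \<Omega> lebesgue f] by simp

lemma integral_N: "(LINT x:\<Omega>|lebesgue. f x) = integral\<^sup>L N f" for f :: "real^'n \<Rightarrow> 'b::{banach,second_countable_topology}"
  unfolding N_def set_lebesgue_integral_def using sets_\<Omega> integral_restrict_space[of \<Omega> lebesgue f] by simp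

lemma AE_N: "(AE x in lebesgue. x \<in> \<Omega> \<longrightarrow> P x) \<longleftrightarrow> (AE x in N. P x)"
  unfolding N_def using sets_\<Omega> by (subst AE_restrict_space_iff) auto

lemma measurable_N: "set_borel_measurable lebesgue \<Omega> f \<longleftrightarrow> f \<in> borel_measurable N" for f :: "real^'n \<Rightarrow> complex"
  unfolding N_def set_borel_measurable_def using sets_\<Omega> by (subst borel_measurable_restrict_space_iff) auto

lemma L2_N: "L2 \<Omega> u \<longleftrightarrow> sqi N u"
  by (simp add: L2_def sqi_def integrable_N measurable_N)

lemma L2ip_N: "L2ip \<Omega> u w = (\<integral>x. u x * cnj (w x) \<partial>N)"
  by (simp add: L2ip_def integral_N)

lemma L2norm_N: "L2norm \<Omega> u = nm N u"
  by (simp add: L2norm_def nm_def integral_N)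

lemma cont_measurable_N: "continuous_on UNIV f \<Longrightarrow> f \<in> borel_measurable N" for f :: "real^'n \<Rightarrow> 'b::{second_countable_topology,topological_space}"
  unfolding N_def by (intro measurable_restrict_space1 borel_measurable_lebesgue_cont)

lemma sqi_bounded:
  assumes "u \<in> borel_measurable N" "\<And>x. cmod (u x) \<le> B" shows "sqi N u"
proof (rule sqi_bound[OF assms(1), of "\<lambda>_. B\<^sup>2"])
  show "integrable N (\<lambda>_. B\<^sup>2)" using finite_measure.integrable_const[OF finite_measure_N] .
  show "AE x in N. (cmod (u x))\<^sup>2 \<le> B\<^sup>2" using assms(2) by (auto intro!: power_mono)
qed

lemma sqi_integrable_N: "sqi N u \<Longrightarrow> integrable N u"
  using sqi_product(2)[of N u "\<lambda>_. 1"] sqi_bounded[of "\<lambda>_. 1" 1] by simp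

lemma weak_partial_N: "weak_partial \<Omega> u i g \<longleftrightarrow> sqi N g \<and>
     (\<forall>\<phi>. test_fun \<Omega> \<phi> \<longrightarrow> (\<integral>x. u x * complex_of_real (pderiv_i i \<phi> x) \<partial>N) = - (\<integral>x. g x * complex_of_real (\<phi> x) \<partial>N))"
  by (simp add: weak_partial_def L2_N integral_N)

lemma test_fun_facts:
  assumes "test_fun \<Omega> \<phi>"
  shows "sqi N (\<lambda>x. complex_of_real (\<phi> x))" "sqi N (\<lambda>x. complex_of_real (pderiv_i i \<phi> x))"
    "smooth_fun \<phi>" "\<And>x. x \<notin> \<Omega> \<Longrightarrow> \<phi> x = 0" "\<And>x. x \<notin> \<Omega> \<Longrightarrow> pderiv_i i \<phi> x = 0"
proof -
  define K where "K = closure {x. \<phi> x \<noteq> 0}"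
  have K: "compact K" "K \<subseteq> \<Omega>" and sm: "smooth_fun \<phi>" using assms by (auto simp: test_fun_def K_def)
  show "smooth_fun \<phi>" by fact
  have z: "\<phi> x = 0" if "x \<notin> K" for x using that closure_subset[of "{x. \<phi> x \<noteq> 0}"] by (auto simp: K_def)
  have pz: "pderiv_i i \<phi> x = 0" if "x \<notin> K" for x using that pderiv_i_eq_0_outside by (auto simp: K_def)
  show "\<And>x. x \<notin> \<Omega> \<Longrightarrow> \<phi> x = 0" "\<And>x. x \<notin> \<Omega> \<Longrightarrow> pderiv_i i \<phi> x = 0" using z pz K by auto
  obtain B where "\<And>x. \<bar>\<phi> x\<bar> \<le> B" using compact_support_bounded[OF smooth_fun_cont[OF sm] K(1) z] by auto
  then show "sqi N (\<lambda>x. complex_of_real (\<phi> x))"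
    using cont_measurable_N[OF smooth_fun_cont[OF sm]] by (intro sqi_bounded[of _ B]) auto
  obtain B where "\<And>x. \<bar>pderiv_i i \<phi> x\<bar> \<le> B" using compact_support_bounded[OF smooth_fun_pderiv_cont[OF sm] K(1) pz] by auto
  then show "sqi N (\<lambda>x. complex_of_real (pderiv_i i \<phi> x))"
    using cont_measurable_N[OF smooth_fun_pderiv_cont[OF sm]] by (intro sqi_bounded[of _ B]) auto
qed

text \<open>\<open>wd\<close> is an arbitrary choice among weak derivatives. Uniqueness up to null
  sets is what gives it linearity, and that only almost everywhere.\<close>

lemma weak_partial_unique:
  assumes "weak_partial \<Omega> u i g" "weak_partial \<Omega> u i g'"
  shows "AE x in N. g x = g' x"
proof -
  have s: "sqi N g" "sqi N g'" using assms by (auto simp: weak_partial_N)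
  have "AE x in lebesgue. x \<in> \<Omega> \<longrightarrow> g x - g' x = 0"
  proof (rule fundamental_lemma_calculus_of_variations[OF op])
    show "set_integrable lebesgue \<Omega> (\<lambda>x. g x - g' x)"
      unfolding integrable_N using s by (intro sqi_integrable_N sqi_diff)
    fix \<phi> assume t: "test_fun \<Omega> \<phi>"
    have "(\<integral>x. g x * complex_of_real (\<phi> x) \<partial>N) = (\<integral>x. g' x * complex_of_real (\<phi> x) \<partial>N)"
      using assms t by (auto simp: weak_partial_N)
    then show "(LINT x:\<Omega>|lebesgue. (g x - g' x) * complex_of_real (\<phi> x)) = 0"
      unfolding integral_N using sqi_product(2)[OF s(1) test_fun_facts(1)[OF t]] sqi_product(2)[OF s(2) test_fun_facts(1)[OF t]]
      by (simp add: left_diff_distrib)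
  qed
  then show ?thesis unfolding AE_N by eventually_elim simp
qed

lemma wd: "H1 \<Omega> u \<Longrightarrow> weak_partial \<Omega> u i (wd \<Omega> u i)"
  unfolding wd_def H1_def by (metis someI_ex)

lemma wd_sqi: "H1 \<Omega> u \<Longrightarrow> sqi N (wd \<Omega> u i)"
  using wd weak_partial_N by blast

lemma H1_sqi: "H1 \<Omega> u \<Longrightarrow> sqi N u"
  by (simp add: H1_def L2_N)

lemma weak_partial_lincomb:
  assumes u: "sqi N u" "weak_partial \<Omega> u i g" and w: "sqi N w" "weak_partial \<Omega> w i h"
  shows "weak_partial \<Omega> (\<lambda>x. c * u x + d * w x) i (\<lambda>x. c * g x + d * h x)"
  unfolding weak_partial_N
proof (intro conjI allI impI)
  have s: "sqi N g" "sqi N h" using u w by (auto simp: weak_partial_N)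
  then show "sqi N (\<lambda>x. c * g x + d * h x)" by (intro sqi_add sqi_scale)
  fix \<phi> assume t: "test_fun \<Omega> \<phi>"
  note tf = test_fun_facts[OF t]
  have "(\<integral>x. (c * u x + d * w x) * complex_of_real (pderiv_i i \<phi> x) \<partial>N) =
      c * (\<integral>x. u x * complex_of_real (pderiv_i i \<phi> x) \<partial>N) + d * (\<integral>x. w x * complex_of_real (pderiv_i i \<phi> x) \<partial>N)"
    using sqi_product(2)[OF u(1) tf(2)] sqi_product(2)[OF w(1) tf(2)] by (simp add: distrib_right mult.assoc)
  also have "\<dots> = - (c * (\<integral>x. g x * complex_of_real (\<phi> x) \<partial>N) + d * (\<integral>x. h x * complex_of_real (\<phi> x) \<partial>N))"
    using u w t by (simp add: weak_partial_N)
  also have "\<dots> = - (\<integral>x. (c * g x + d * h x) * complex_of_real (\<phi> x) \<partial>N)"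
    using sqi_product(2)[OF s(1) tf(1)] sqi_product(2)[OF s(2) tf(1)] by (simp add: distrib_right mult.assoc)
  finally show "(\<integral>x. (c * u x + d * w x) * complex_of_real (pderiv_i i \<phi> x) \<partial>N) = - (\<integral>x. (c * g x + d * h x) * complex_of_real (\<phi> x) \<partial>N)" .
qed

lemma H1_lincomb:
  assumes "H1 \<Omega> u" "H1 \<Omega> w"
  shows "H1 \<Omega> (\<lambda>x. c * u x + d * w x)"
  unfolding H1_def L2_N using weak_partial_lincomb[OF H1_sqi[OF assms(1)] wd[OF assms(1)] H1_sqi[OF assms(2)] wd[OF assms(2)]] H1_sqi assms
  by (auto intro!: sqi_add sqi_scale)

lemma wd_lincomb:
  assumes "H1 \<Omega> u" "H1 \<Omega> w"
  shows "AE x in N. wd \<Omega> (\<lambda>x. c * u x + d * w x) i x = c * wd \<Omega> u i x + d * wd \<Omega> w i x"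
  by (rule weak_partial_unique[OF wd[OF H1_lincomb[OF assms]] weak_partial_lincomb[OF H1_sqi[OF assms(1)] wd[OF assms(1)] H1_sqi[OF assms(2)] wd[OF assms(2)]]])

text \<open>The product of the two test functions has compact support, so the integral of its
  derivative vanishes; the product rule does the rest.\<close>

lemma weak_partial_test_fun:
  assumes t: "test_fun \<Omega> \<phi>"
  shows "weak_partial \<Omega> (\<lambda>x. complex_of_real (\<phi> x)) i (\<lambda>x. complex_of_real (pderiv_i i \<phi> x))"
  unfolding weak_partial_N
proof (intro conjI allI impI)
  show "sqi N (\<lambda>x. complex_of_real (pderiv_i i \<phi> x))" by (rule test_fun_facts[OF t])
  fix \<psi> assume t': "test_fun \<Omega> \<psi>"
  note f = test_fun_facts[OF t] and f' = test_fun_facts[OF t']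
  have sm: "smooth_fun (\<lambda>x. \<phi> x * \<psi> x)" by (rule smooth_fun_mult[OF f(3) f'(3)])
  have "closure {x. \<phi> x * \<psi> x \<noteq> 0} \<subseteq> closure {x. \<phi> x \<noteq> 0}" by (rule closure_mono) auto
  then have "compact (closure {x. \<phi> x * \<psi> x \<noteq> 0})"
    using t compact_Int_closed[of "closure {x. \<phi> x \<noteq> 0}" "closure {x. \<phi> x * \<psi> x \<noteq> 0}"] by (simp add: test_fun_def Int_absorb1)
  from integral_pderiv_0[OF sm this]
  have "integral\<^sup>L lebesgue (pderiv_i i (\<lambda>x. \<phi> x * \<psi> x)) = 0" .
  moreover have pd: "pderiv_i i (\<lambda>x. \<phi> x * \<psi> x) = (\<lambda>x. \<phi> x * pderiv_i i \<psi> x + pderiv_i i \<phi> x * \<psi> x)"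
    using f(3) f'(3) smooth_fun_differentiable by (intro ext pderiv_i_mult) auto
  moreover have "(\<lambda>x. indicator \<Omega> x *\<^sub>R (\<phi> x * pderiv_i i \<psi> x + pderiv_i i \<phi> x * \<psi> x)) = (\<lambda>x. \<phi> x * pderiv_i i \<psi> x + pderiv_i i \<phi> x * \<psi> x)"
    using f(4,5) by (intro ext) (auto simp: indicator_def)
  ultimately have "(LINT x:\<Omega>|lebesgue. \<phi> x * pderiv_i i \<psi> x + pderiv_i i \<phi> x * \<psi> x) = 0"
    unfolding set_lebesgue_integral_def by (simp only:)
  then have "(\<integral>x. \<phi> x * pderiv_i i \<psi> x + pderiv_i i \<phi> x * \<psi> x \<partial>N) = 0" by (simp add: integral_N)
  then have "(\<integral>x. complex_of_real (\<phi> x) * complex_of_real (pderiv_i i \<psi> x) + complex_of_real (pderiv_i i \<phi> x) * complex_of_real (\<psi> x) \<partial>N) = 0"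
    using integral_complex_of_real[of N "\<lambda>x. \<phi> x * pderiv_i i \<psi> x + pderiv_i i \<phi> x * \<psi> x"] by simp
  then have "(\<integral>x. complex_of_real (\<phi> x) * complex_of_real (pderiv_i i \<psi> x) \<partial>N) + (\<integral>x. complex_of_real (pderiv_i i \<phi> x) * complex_of_real (\<psi> x) \<partial>N) = 0"
    using sqi_product(2)[OF f(1) f'(2)] sqi_product(2)[OF f(2) f'(1)] by simp
  then show "(\<integral>x. complex_of_real (\<phi> x) * complex_of_real (pderiv_i i \<psi> x) \<partial>N) = - (\<integral>x. complex_of_real (pderiv_i i \<phi> x) * complex_of_real (\<psi> x) \<partial>N)"
    by (simp add: eq_neg_iff_add_eq_0)
qed

definition cpd :: "(real^'n \<Rightarrow> complex) \<Rightarrow> 'n \<Rightarrow> real^'n \<Rightarrow> complex" where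
  "cpd \<phi> i x = Complex (pderiv_i i (\<lambda>x. Re (\<phi> x)) x) (pderiv_i i (\<lambda>x. Im (\<phi> x)) x)"

lemma ctest_fun_weak:
  assumes "ctest_fun \<Omega> \<phi>"
  shows "sqi N \<phi>" "weak_partial \<Omega> \<phi> i (cpd \<phi> i)" "H1 \<Omega> \<phi>"
proof -
  have t: "test_fun \<Omega> (\<lambda>x. Re (\<phi> x))" "test_fun \<Omega> (\<lambda>x. Im (\<phi> x))" using assms by (auto simp: ctest_fun_def)
  have e: "\<phi> = (\<lambda>x. 1 * complex_of_real (Re (\<phi> x)) + \<i> * complex_of_real (Im (\<phi> x)))" by (auto simp: complex_eq_iff)
  show 1: "sqi N \<phi>" by (subst e) (intro sqi_add sqi_scale test_fun_facts(1) t)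
  have e': "cpd \<phi> i = (\<lambda>x. 1 * complex_of_real (pderiv_i i (\<lambda>x. Re (\<phi> x)) x) + \<i> * complex_of_real (pderiv_i i (\<lambda>x. Im (\<phi> x)) x))" for i
    by (auto simp: complex_eq_iff cpd_def)
  show 2: "weak_partial \<Omega> \<phi> i (cpd \<phi> i)" for i
    unfolding e' by (subst e) (intro weak_partial_lincomb weak_partial_test_fun test_fun_facts(1) t)
  show "H1 \<Omega> \<phi>" using 1 2 by (auto simp: H1_def L2_N)
qed

text \<open>The squared modulus, unlike the modulus, is smooth. It is a real test function against
  which a weak derivative may be tested directly.\<close>

lemma ctest_fun_norm_sq:
  assumes "ctest_fun \<Omega> \<phi>"
  shows "test_fun \<Omega> (\<lambda>x. (cmod (\<phi> x))\<^sup>2)"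
    "complex_of_real (pderiv_i i (\<lambda>x. (cmod (\<phi> x))\<^sup>2) x) = cpd \<phi> i x * cnj (\<phi> x) + \<phi> x * cnj (cpd \<phi> i x)"
proof -
  define r s where "r = (\<lambda>x. Re (\<phi> x))" "s = (\<lambda>x. Im (\<phi> x))"
  have t: "test_fun \<Omega> r" "test_fun \<Omega> s" using assms by (auto simp: ctest_fun_def r_s_def)
  have sm: "smooth_fun r" "smooth_fun s" using t by (auto simp: test_fun_def)
  have e: "(\<lambda>x. (cmod (\<phi> x))\<^sup>2) = (\<lambda>x. r x * r x + s x * s x)" by (simp add: r_s_def cmod_power2 flip: power2_eq_square)
  have "{x. r x * r x + s x * s x \<noteq> 0} \<subseteq> {x. r x \<noteq> 0} \<union> {x. s x \<noteq> 0}" by auto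
  then have c: "closure {x. r x * r x + s x * s x \<noteq> 0} \<subseteq> closure {x. r x \<noteq> 0} \<union> closure {x. s x \<noteq> 0}"
    by (rule order_trans[OF closure_mono]) simp
  have "compact (closure {x. r x \<noteq> 0} \<union> closure {x. s x \<noteq> 0})" using t by (auto simp: test_fun_def)
  then have "compact (closure {x. r x * r x + s x * s x \<noteq> 0})" 
    using compact_Int_closed[OF _ closed_closure[of "{x. r x * r x + s x * s x \<noteq> 0}"], of "closure {x. r x \<noteq> 0} \<union> closure {x. s x \<noteq> 0}"]
    unfolding Int_absorb1[OF c] by blast
  moreover have "closure {x. r x * r x + s x * s x \<noteq> 0} \<subseteq> \<Omega>" using c t by (auto simp: test_fun_def)
  ultimately show "test_fun \<Omega> (\<lambda>x. (cmod (\<phi> x))\<^sup>2)"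
    unfolding e test_fun_def using sm by (auto intro!: smooth_fun_add smooth_fun_mult)
  note d = smooth_fun_differentiable[OF sm(1), of x] smooth_fun_differentiable[OF sm(2), of x]
  have "pderiv_i i (\<lambda>x. r x * r x + s x * s x) x = (r x * pderiv_i i r x + pderiv_i i r x * r x) + (s x * pderiv_i i s x + pderiv_i i s x * s x)"
    by (subst pderiv_i_add, (intro differentiable_mult d)+, simp only: pderiv_i_mult d)
  then show "complex_of_real (pderiv_i i (\<lambda>x. (cmod (\<phi> x))\<^sup>2) x) = cpd \<phi> i x * cnj (\<phi> x) + \<phi> x * cnj (cpd \<phi> i x)"
    unfolding e by (simp add: complex_eq_iff cpd_def r_s_def[symmetric]) (simp add: r_s_def algebra_simps)
qed

end

section \<open>Integration by parts against a squared modulus\<close>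

context bounded_open_set
begin

lemma H1norm_bounds:
  "H1norm \<Omega> u \<ge> 0" "nm N u \<le> H1norm \<Omega> u" "nm N (wd \<Omega> u i) \<le> H1norm \<Omega> u"
proof -
  have s: "(\<Sum>i\<in>UNIV. (L2norm \<Omega> (wd \<Omega> u i))\<^sup>2) \<ge> 0" by (simp add: sum_nonneg)
  show "H1norm \<Omega> u \<ge> 0" using s by (simp add: H1norm_def)
  have "sqrt ((nm N u)\<^sup>2) \<le> H1norm \<Omega> u" unfolding H1norm_def L2norm_N[symmetric] using s by (intro real_sqrt_le_mono) simp
  then show "nm N u \<le> H1norm \<Omega> u" using nm_nonneg by simp
  have "(L2norm \<Omega> (wd \<Omega> u i))\<^sup>2 \<le> (\<Sum>i\<in>UNIV. (L2norm \<Omega> (wd \<Omega> u i))\<^sup>2)"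
    by (rule member_le_sum) auto
  then have "sqrt ((nm N (wd \<Omega> u i))\<^sup>2) \<le> H1norm \<Omega> u" unfolding H1norm_def L2norm_N[symmetric] by (intro real_sqrt_le_mono) (simp add: add_increasing)
  then show "nm N (wd \<Omega> u i) \<le> H1norm \<Omega> u" using nm_nonneg by simp
qed

definition L4_emb :: "real \<Rightarrow> bool" where
  "L4_emb s0 \<longleftrightarrow> (\<forall>z. H1 \<Omega> z \<longrightarrow> set_integrable lebesgue \<Omega> (\<lambda>x. (cmod (z x)) ^ 4) \<and>
        root 4 (LINT x:\<Omega>|lebesgue. (cmod (z x)) ^ 4) \<le> s0 * H1norm \<Omega> z)"

text \<open>The L4 embedding is used in this form: e times e is in L2, so its product with a merely
  square integrable weak derivative can be handled by the Cauchy-Schwarz inequality.\<close>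

lemma sqi_square:
  assumes "L4_emb s0" "H1 \<Omega> e"
  shows "sqi N (\<lambda>x. e x * e x)" "nm N (\<lambda>x. e x * e x) \<le> (s0 * H1norm \<Omega> e)\<^sup>2"
proof -
  have i: "integrable N (\<lambda>x. (cmod (e x)) ^ 4)" and r: "root 4 (\<integral>x. (cmod (e x)) ^ 4 \<partial>N) \<le> s0 * H1norm \<Omega> e"
    using assms by (auto simp: L4_emb_def integrable_N integral_N)
  have e4: "(cmod (e x * e x))\<^sup>2 = (cmod (e x)) ^ 4" for x
    by (simp add: norm_mult power2_eq_square power4_eq_xxxx)
  show "sqi N (\<lambda>x. e x * e x)" unfolding sqi_def e4 using i sqi_measurable[OF H1_sqi[OF assms(2)]] by auto
  define Q where "Q = (\<integral>x. (cmod (e x)) ^ 4 \<partial>N)"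
  have Q: "Q \<ge> 0" unfolding Q_def by (rule integral_nonneg_AE) auto
  have "Q = (root 4 Q) ^ 4" using Q by simp
  also have "\<dots> \<le> (s0 * H1norm \<Omega> e) ^ 4" using r Q by (intro power_mono) (auto simp: Q_def)
  also have "\<dots> = ((s0 * H1norm \<Omega> e)\<^sup>2)\<^sup>2" by (simp add: power4_eq_xxxx power2_eq_square)
  finally have "sqrt Q \<le> (s0 * H1norm \<Omega> e)\<^sup>2" by (intro real_le_lsqrt) auto
  then show "nm N (\<lambda>x. e x * e x) \<le> (s0 * H1norm \<Omega> e)\<^sup>2" unfolding nm_def e4 Q_def[symmetric] .
qed

text \<open>Here \<open>z + e\<close> stands for the approximating test function and
  \<open>dz + q\<close> for its derivative. The right side is arranged as products of two square
  integrable factors, with e*e counted as one: in that term no factor e can be traded for the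
  bounded z.\<close>

lemma weak_product_perturbation:
  fixes G w z e dz q :: complex
  assumes w: "cmod w \<le> K" and z: "cmod z \<le> B"
  shows "cmod ((G * z * cnj z + w * (dz * cnj z + z * cnj dz)) -
       (G * ((z + e) * cnj (z + e)) + w * ((dz + q) * cnj (z + e) + (z + e) * cnj (dz + q))))
     \<le> cmod G * cmod (e * e) + 2 * B * (cmod G * cmod e) + 2 * K * (cmod q * cmod e + cmod q * cmod z + cmod dz * cmod e)"
proof -
  define X where "X = e * cnj e + e * cnj z + z * cnj e"
  define Y where "Y = q * cnj e + q * cnj z + dz * cnj e"
  have K: "K \<ge> 0" using w norm_ge_zero order_trans by blast
  have eq: "(G * z * cnj z + w * (dz * cnj z + z * cnj dz)) -
       (G * ((z + e) * cnj (z + e)) + w * ((dz + q) * cnj (z + e) + (z + e) * cnj (dz + q))) = - (G * X + w * (Y + cnj Y))"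
    by (simp add: X_def Y_def algebra_simps)
  have "cmod X \<le> cmod e * cmod e + cmod e * cmod z + cmod z * cmod e"
    unfolding X_def by (rule order_trans[OF norm_triangle_ineq] add_mono order_trans[OF norm_triangle_ineq] | simp add: norm_mult)+
  also have "\<dots> \<le> cmod (e * e) + 2 * B * cmod e" using mult_right_mono[OF z, of "cmod e"] by (simp add: norm_mult algebra_simps)
  finally have X: "cmod X \<le> cmod (e * e) + 2 * B * cmod e" .
  have Y: "cmod Y \<le> cmod q * cmod e + cmod q * cmod z + cmod dz * cmod e"
    unfolding Y_def by (rule order_trans[OF norm_triangle_ineq] add_mono order_trans[OF norm_triangle_ineq] | simp add: norm_mult)+
  have "cmod (Y + cnj Y) \<le> 2 * cmod Y" using norm_triangle_ineq[of Y "cnj Y"] by simp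
  then have "cmod w * cmod (Y + cnj Y) \<le> K * (2 * (cmod q * cmod e + cmod q * cmod z + cmod dz * cmod e))"
    using w K Y by (intro mult_mono) auto
  moreover have "cmod G * cmod X \<le> cmod G * (cmod (e * e) + 2 * B * cmod e)" using X by (intro mult_left_mono) auto
  moreover have "cmod (G * X + w * (Y + cnj Y)) \<le> cmod G * cmod X + cmod w * cmod (Y + cnj Y)"
    using norm_triangle_ineq[of "G * X" "w * (Y + cnj Y)"] by (simp only: norm_mult)
  ultimately show ?thesis unfolding eq norm_minus_cancel by (simp add: algebra_simps)
qed

text \<open>The weak derivative of \<open>w\<close> is tested against \<open>|\<phi>\<^sub>n|\<^sup>2\<close>, where \<open>\<phi>\<^sub>n\<close> are test functions
  approximating \<open>z\<close> in \<open>H\<^sup>1\<close>, hence also in \<open>L\<^sup>4\<close>.\<close>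

lemma integration_by_parts:
  assumes w: "H1 \<Omega> w" and K: "AE x in N. cmod (w x) \<le> K" "K \<ge> 0"
    and z: "H10 \<Omega> z" "\<And>x. cmod (z x) \<le> B" and emb: "L4_emb s0"
  shows "(\<integral>x. wd \<Omega> w i x * z x * cnj (z x) + w x * (wd \<Omega> z i x * cnj (z x) + z x * cnj (wd \<Omega> z i x)) \<partial>N) = 0"
proof -
  have H1z: "H1 \<Omega> z" using z by (simp add: H10_def)
  obtain \<phi> where \<phi>: "\<And>n. ctest_fun \<Omega> (\<phi> n)" "(\<lambda>n. H1norm \<Omega> (\<lambda>x. \<phi> n x - z x)) \<longlonglongrightarrow> 0"
    using z(1) by (auto simp: H10_def)
  define G dz where "G = wd \<Omega> w i" and "dz = wd \<Omega> z i"
  define e q h where "e = (\<lambda>n x. \<phi> n x - z x)" and "q = (\<lambda>n. wd \<Omega> (e n) i)" and "h = (\<lambda>n. H1norm \<Omega> (e n))"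
  define T0 where "T0 = (\<lambda>x. G x * z x * cnj (z x) + w x * (dz x * cnj (z x) + z x * cnj (dz x)))"
  define T where "T = (\<lambda>n x. G x * (\<phi> n x * cnj (\<phi> n x)) + w x * (cpd (\<phi> n) i x * cnj (\<phi> n x) + \<phi> n x * cnj (cpd (\<phi> n) i x)))"
  have H1e: "H1 \<Omega> (e n)" for n
    using H1_lincomb[OF ctest_fun_weak(3)[OF \<phi>(1)] H1z, of 1 n "-1"] by (simp add: e_def)
  have sq: "sqi N G" "sqi N dz" "sqi N (e n)" "sqi N (q n)" "sqi N z" "sqi N w" "sqi N (\<phi> n)" "sqi N (cpd (\<phi> n) i)" for n
    using wd_sqi[OF w] wd_sqi[OF H1z] H1_sqi[OF H1e] wd_sqi[OF H1e] H1_sqi[OF H1z] H1_sqi[OF w] ctest_fun_weak[OF \<phi>(1)]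
    by (auto simp: G_def dz_def q_def weak_partial_N)
  have AEq: "AE x in N. cpd (\<phi> n) i x = dz x + q n x" for n
  proof -
    have "AE x in N. wd \<Omega> (\<lambda>x. 1 * \<phi> n x + (-1) * z x) i x = 1 * wd \<Omega> (\<phi> n) i x + (-1) * wd \<Omega> z i x"
      by (rule wd_lincomb[OF ctest_fun_weak(3)[OF \<phi>(1)] H1z])
    moreover have "AE x in N. wd \<Omega> (\<phi> n) i x = cpd (\<phi> n) i x"
      by (rule weak_partial_unique[OF wd[OF ctest_fun_weak(3)[OF \<phi>(1)]] ctest_fun_weak(2)[OF \<phi>(1)]])
    ultimately show ?thesis by eventually_elim (simp add: q_def e_def dz_def)
  qed
  have zm: "z \<in> borel_measurable N" using sq by (simp add: sqi_measurable)
  have izz: "integrable N (\<lambda>x. G x * z x * cnj (z x))"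
    using sqi_product(2)[OF sqi_mult_bounded[OF sq(1) zm AE_I2] sqi_cnj[OF sq(5)], of B] z(2) by (simp add: mult_ac)
  have iw: "integrable N (\<lambda>x. w x * (a x * cnj (b x) + b x * cnj (a x)))" if "sqi N a" "sqi N b" for a b
  proof -
    have "integrable N (\<lambda>x. (w x * a x) * cnj (b x))" "integrable N (\<lambda>x. (w x * b x) * cnj (a x))"
      using sqi_product(2)[OF sqi_mult_bounded[OF _ sqi_measurable[OF sq(6)] K(1)] sqi_cnj] that by auto
    then show ?thesis by (simp add: distrib_left mult_ac)
  qed
  have iT0: "integrable N T0" unfolding T0_def using izz iw[OF sq(2,5)] by (rule Bochner_Integration.integrable_add)
  have tphi: "\<phi> n x * cnj (\<phi> n x) = complex_of_real ((cmod (\<phi> n x))\<^sup>2)" for n x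
    by (simp add: complex_norm_square[symmetric])
  have iGT: "integrable N (\<lambda>x. G x * complex_of_real ((cmod (\<phi> n x))\<^sup>2))" for n
    using sqi_product(2)[OF sq(1) test_fun_facts(1)[OF ctest_fun_norm_sq(1)[OF \<phi>(1)]]] .
  have iT: "integrable N (T n)" for n
    unfolding T_def using iGT[of n] iw[OF sq(8) sq(7), of n n] by (intro Bochner_Integration.integrable_add) (simp_all add: tphi)
  have T_0: "integral\<^sup>L N (T n) = 0" for n
  proof -
    have "(\<integral>x. w x * complex_of_real (pderiv_i i (\<lambda>x. (cmod (\<phi> n x))\<^sup>2) x) \<partial>N) = - (\<integral>x. G x * complex_of_real ((cmod (\<phi> n x))\<^sup>2) \<partial>N)"
      using wd[OF w, of i] ctest_fun_norm_sq(1)[OF \<phi>(1), of n] by (simp add: weak_partial_N G_def)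
    then show ?thesis unfolding T_def tphi
      using iGT[of n] iw[OF sq(8) sq(7), of n n] by (simp add: ctest_fun_norm_sq(2)[OF \<phi>(1)])
  qed
  \<comment> \<open>The integral of \<open>T n\<close> is zero, so that of \<open>T0\<close> is
    bounded by the perturbation alone. Every summand carries the factor \<open>h n\<close>, the H1
    distance from \<open>z\<close> to the test function.\<close>
  have bnd: "cmod (integral\<^sup>L N T0) \<le> nm N G * (s0 * h n)\<^sup>2 + 2 * B * (nm N G * h n) + 2 * K * (h n * h n + h n * nm N z + nm N dz * h n)" for n
  proof -
    define F where "F = (\<lambda>x. cmod (G x) * cmod (e n x * e n x) + 2 * B * (cmod (G x) * cmod (e n x)) +
        2 * K * (cmod (q n x) * cmod (e n x) + cmod (q n x) * cmod (z x) + cmod (dz x) * cmod (e n x)))"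
    note see = sqi_square[OF emb H1e[of n]]
    note ints = sqi_product(1)[OF sq(1) see(1)] sqi_product(1)[OF sq(1) sq(3)[of n]] sqi_product(1)[OF sq(4)[of n] sq(3)[of n]]
       sqi_product(1)[OF sq(4)[of n] sq(5)] sqi_product(1)[OF sq(2) sq(3)[of n]]
    have iF: "integrable N F" unfolding F_def using ints by auto
    have "integral\<^sup>L N T0 = (\<integral>x. T0 x - T n x \<partial>N)" using iT0 iT T_0 by simp
    also have "cmod \<dots> \<le> (\<integral>x. cmod (T0 x - T n x) \<partial>N)" by (rule integral_norm_bound)
    also have "\<dots> \<le> (\<integral>x. F x \<partial>N)"
    proof (rule integral_mono_AE)
      show "integrable N (\<lambda>x. cmod (T0 x - T n x))" using iT0 iT by simp
      show "integrable N F" by fact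
      show "AE x in N. cmod (T0 x - T n x) \<le> F x"
        using AEq[of n] K(1)
      proof eventually_elim
        case (elim x)
        have "\<phi> n x = z x + e n x" by (simp add: e_def)
        then show ?case unfolding T0_def T_def F_def elim(1)
          using weak_product_perturbation[OF elim(2) z(2)[of x], of "G x" "dz x" "e n x" "q n x"] by (simp only:)
      qed
    qed
    also have "\<dots> = (\<integral>x. cmod (G x) * cmod (e n x * e n x) \<partial>N) + 2 * B * (\<integral>x. cmod (G x) * cmod (e n x) \<partial>N) +
        2 * K * ((\<integral>x. cmod (q n x) * cmod (e n x) \<partial>N) + (\<integral>x. cmod (q n x) * cmod (z x) \<partial>N) + (\<integral>x. cmod (dz x) * cmod (e n x) \<partial>N))"
      unfolding F_def using ints by simp
    also have "\<dots> \<le> nm N G * (s0 * h n)\<^sup>2 + 2 * B * (nm N G * h n) + 2 * K * (h n * h n + h n * nm N z + nm N dz * h n)"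
    proof -
      have B: "B \<ge> 0" using z(2) norm_ge_zero order_trans by blast
      have hb: "h n \<ge> 0" "nm N (e n) \<le> h n" "nm N (q n) \<le> h n" using H1norm_bounds by (auto simp: h_def q_def)
      have cs: "(\<integral>x. cmod (a x) * cmod (b x) \<partial>N) \<le> A' * B'" if "sqi N a" "sqi N b" "nm N a \<le> A'" "nm N b \<le> B'" for a b A' B'
        using integral_cauchy_schwarz[OF that(1,2)] mult_mono[OF that(3,4) order_trans[OF nm_nonneg that(3)] nm_nonneg] by linarith
      show ?thesis
        using hb see(2) K(2) B
        by (intro add_mono mult_left_mono cs sq see(1) order_refl) (auto simp: h_def)
    qed
    finally show ?thesis .
  qed
  have "h \<longlonglongrightarrow> 0" using \<phi>(2) by (simp add: h_def e_def)
  then have "(\<lambda>n. nm N G * (s0 * h n)\<^sup>2 + 2 * B * (nm N G * h n) + 2 * K * (h n * h n + h n * nm N z + nm N dz * h n))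
     \<longlonglongrightarrow> nm N G * (s0 * 0)\<^sup>2 + 2 * B * (nm N G * 0) + 2 * K * (0 * 0 + 0 * nm N z + nm N dz * 0)"
    by (intro tendsto_intros)
  then have "cmod (integral\<^sup>L N T0) \<le> nm N G * (s0 * 0)\<^sup>2 + 2 * B * (nm N G * 0) + 2 * K * (0 * 0 + 0 * nm N z + nm N dz * 0)"
    by (rule LIMSEQ_le_const) (use bnd in blast)
  then show ?thesis by (simp add: T0_def G_def dz_def)
qed

section \<open>Coercivity of the form\<close>

lemma cmod_vgrad_le: "(cmod (\<Sum>i\<in>UNIV. complex_of_real (v $ i) * d i))\<^sup>2 \<le> (norm v)\<^sup>2 * (\<Sum>i\<in>UNIV. (cmod (d i))\<^sup>2)"
  for v :: "real^'n" and d :: "'n \<Rightarrow> complex"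
proof -
  have "cmod (\<Sum>i\<in>UNIV. complex_of_real (v $ i) * d i) \<le> (\<Sum>i\<in>UNIV. \<bar>v $ i\<bar> * \<bar>cmod (d i)\<bar>)"
    by (rule sum_norm_le) (simp add: norm_mult)
  also have "\<dots> \<le> L2_set (\<lambda>i. v $ i) UNIV * L2_set (\<lambda>i. cmod (d i)) UNIV" by (rule L2_set_mult_ineq)
  finally have "(cmod (\<Sum>i\<in>UNIV. complex_of_real (v $ i) * d i))\<^sup>2 \<le> (L2_set (\<lambda>i. v $ i) UNIV * L2_set (\<lambda>i. cmod (d i)) UNIV)\<^sup>2"
    by (rule power_mono) simp
  also have "\<dots> = (norm v)\<^sup>2 * (\<Sum>i\<in>UNIV. (cmod (d i))\<^sup>2)"
    by (simp add: power_mult_distrib norm_vec_def L2_set_def sum_nonneg)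
  finally show ?thesis .
qed

lemma sqi_vgrad: "H1 \<Omega> u \<Longrightarrow> sqi N (vgrad \<Omega> v u)"
  unfolding vgrad_def by (intro sqi_sum sqi_scale wd_sqi) auto

lemma L2ip_self: "L2ip \<Omega> u u = of_real ((nm N u)\<^sup>2)"
proof -
  have "L2ip \<Omega> u u = (\<integral>x. complex_of_real ((cmod (u x))\<^sup>2) \<partial>N)" by (simp add: L2ip_N complex_norm_square[symmetric])
  then show ?thesis by (simp only: integral_complex_of_real nm_sq)
qed

text \<open>The bound \<open>B\<close> on z serves integrability and the limit in the integration by
  parts. The lower bound is free of it, hence the same for all functions and all meshes.\<close>

lemma aform_coercive:
  assumes w: "H1 \<Omega> w" and K: "AE x in N. cmod (w x) \<le> K" "K \<ge> 0"
    and z: "H10 \<Omega> z" "\<And>x. cmod (z x) \<le> B" and emb: "L4_emb s0" and eta: "\<eta> > 0"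
  shows "3/4 * \<eta> * (grad_norm \<Omega> z)\<^sup>2 + (\<nu>0 - K\<^sup>2 * (norm v)\<^sup>2 / \<eta>) * (nm N z)\<^sup>2 \<le> Re (aform \<Omega> \<eta> v \<nu>0 w z z)"
proof -
  have H1z: "H1 \<Omega> z" using z by (simp add: H10_def)
  define dz G where "dz = wd \<Omega> z" and "G = wd \<Omega> w"
  have sq: "sqi N (dz i)" "sqi N (G i)" "sqi N z" "sqi N w" for i
    using wd_sqi[OF H1z] wd_sqi[OF w] H1_sqi[OF H1z] H1_sqi[OF w] by (auto simp: dz_def G_def)
  have zm: "z \<in> borel_measurable N" and wm: "w \<in> borel_measurable N" using sq by (auto simp: sqi_measurable)
  have i1: "integrable N (\<lambda>x. w x * dz i x * cnj (z x))" for i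
    by (rule sqi_product(2)[OF sqi_mult_bounded[OF sq(1) wm K(1)] sqi_cnj[OF sq(3)]])
  have i2: "integrable N (\<lambda>x. G i x * z x * cnj (z x))" for i
    using sqi_product(2)[OF sqi_mult_bounded[OF sq(2) zm AE_I2] sqi_cnj[OF sq(3)], of B] z(2) by (simp add: mult_ac)
  have i3: "integrable N (\<lambda>x. w x * z x * cnj (dz i x))" for i
    by (rule sqi_product(2)[OF sqi_mult_bounded[OF sq(3) wm K(1)] sqi_cnj[OF sq(1)]])
  have parts: "(\<integral>x. w x * dz i x * cnj (z x) \<partial>N) + (\<integral>x. G i x * z x * cnj (z x) \<partial>N) = - (\<integral>x. w x * z x * cnj (dz i x) \<partial>N)" for i
  proof -
    have "(\<integral>x. G i x * z x * cnj (z x) + (w x * dz i x * cnj (z x) + w x * z x * cnj (dz i x)) \<partial>N) = 0"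
      using integration_by_parts[OF w K z emb, of i] by (simp add: dz_def G_def distrib_left mult.assoc)
    then have "(\<integral>x. G i x * z x * cnj (z x) \<partial>N) + ((\<integral>x. w x * dz i x * cnj (z x) \<partial>N) + (\<integral>x. w x * z x * cnj (dz i x) \<partial>N)) = 0"
      using i1[of i] i2[of i] i3[of i] by simp
    then show ?thesis by (simp add: eq_neg_iff_add_eq_0 add_ac)
  qed
  define W where "W = vgrad \<Omega> v z"
  have t2: "L2ip \<Omega> (\<lambda>x. w x * vgrad \<Omega> v z x) z = (\<Sum>i\<in>UNIV. complex_of_real (v $ i) * (\<integral>x. w x * dz i x * cnj (z x) \<partial>N))"
  proof -
    have "L2ip \<Omega> (\<lambda>x. w x * vgrad \<Omega> v z x) z = (\<integral>x. (\<Sum>i\<in>UNIV. complex_of_real (v $ i) * (w x * dz i x * cnj (z x))) \<partial>N)"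
      by (simp add: L2ip_N vgrad_def dz_def sum_distrib_left sum_distrib_right mult_ac)
    then show ?thesis using i1 by simp
  qed
  have t3: "L2ip \<Omega> (\<lambda>x. vgrad \<Omega> v w x * z x) z = (\<Sum>i\<in>UNIV. complex_of_real (v $ i) * (\<integral>x. G i x * z x * cnj (z x) \<partial>N))"
  proof -
    have "L2ip \<Omega> (\<lambda>x. vgrad \<Omega> v w x * z x) z = (\<integral>x. (\<Sum>i\<in>UNIV. complex_of_real (v $ i) * (G i x * z x * cnj (z x))) \<partial>N)"
      by (simp add: L2ip_N vgrad_def G_def sum_distrib_left sum_distrib_right mult_ac)
    then show ?thesis using i2 by simp
  qed
  have "L2ip \<Omega> (\<lambda>x. w x * vgrad \<Omega> v z x) z + L2ip \<Omega> (\<lambda>x. vgrad \<Omega> v w x * z x) z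
     = - (\<Sum>i\<in>UNIV. complex_of_real (v $ i) * (\<integral>x. w x * z x * cnj (dz i x) \<partial>N))"
    unfolding t2 t3 sum.distrib[symmetric] distrib_left[symmetric] parts by (simp add: sum_negf)
  also have "(\<Sum>i\<in>UNIV. complex_of_real (v $ i) * (\<integral>x. w x * z x * cnj (dz i x) \<partial>N))
     = (\<integral>x. (\<Sum>i\<in>UNIV. complex_of_real (v $ i) * (w x * z x * cnj (dz i x))) \<partial>N)" using i3 by simp
  also have "(\<lambda>x. \<Sum>i\<in>UNIV. complex_of_real (v $ i) * (w x * z x * cnj (dz i x))) = (\<lambda>x. w x * z x * cnj (W x))"
    by (auto simp: W_def vgrad_def dz_def sum_distrib_left mult_ac)
  finally have sum23: "L2ip \<Omega> (\<lambda>x. w x * vgrad \<Omega> v z x) z + L2ip \<Omega> (\<lambda>x. vgrad \<Omega> v w x * z x) z = - (\<integral>x. w x * z x * cnj (W x) \<partial>N)" .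
  have iW: "integrable N (\<lambda>x. w x * z x * cnj (W x))"
    by (rule sqi_product(2)[OF sqi_mult_bounded[OF sq(3) wm K(1)] sqi_cnj[OF sqi_vgrad[OF H1z, of v, folded W_def]]])
  define g where "g = (\<lambda>x. \<Sum>i\<in>UNIV. (cmod (dz i x))\<^sup>2)"
  have ig: "integrable N g" unfolding g_def using sq(1) by (auto simp: sqi_def)
  have intg: "integral\<^sup>L N g = (grad_norm \<Omega> z)\<^sup>2"
    unfolding g_def grad_norm_def using sq(1) by (simp add: sqi_def L2norm_N nm_sq sum_nonneg dz_def)
  have "cmod (\<integral>x. w x * z x * cnj (W x) \<partial>N) \<le> (\<integral>x. cmod (w x * z x * cnj (W x)) \<partial>N)" by (rule integral_norm_bound)
  also have "\<dots> \<le> (\<integral>x. \<eta>/4 * g x + K\<^sup>2 * (norm v)\<^sup>2 / \<eta> * (cmod (z x))\<^sup>2 \<partial>N)"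
  proof (rule integral_mono_AE)
    show "integrable N (\<lambda>x. cmod (w x * z x * cnj (W x)))" using iW by simp
    show "integrable N (\<lambda>x. \<eta>/4 * g x + K\<^sup>2 * (norm v)\<^sup>2 / \<eta> * (cmod (z x))\<^sup>2)" using ig sqi_integrable[OF sq(3)] by simp
    show "AE x in N. cmod (w x * z x * cnj (W x)) \<le> \<eta>/4 * g x + K\<^sup>2 * (norm v)\<^sup>2 / \<eta> * (cmod (z x))\<^sup>2"
      using K(1)
    proof eventually_elim
      case (elim x)
      define m where "m = norm v"
      define s where "s = sqrt (g x)"
      have g0: "g x \<ge> 0" by (simp add: g_def sum_nonneg)
      have "(cmod (W x))\<^sup>2 \<le> m\<^sup>2 * g x" unfolding W_def vgrad_def g_def dz_def m_def by (rule cmod_vgrad_le)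
      also have "\<dots> = (m * s)\<^sup>2" using g0 by (simp add: power_mult_distrib s_def)
      finally have "cmod (W x) \<le> m * s" by (rule power2_le_imp_le) (simp add: m_def s_def g0)
      then have "cmod (w x * z x * cnj (W x)) \<le> K * cmod (z x) * (m * s)"
        using elim K(2) by (simp add: norm_mult mult_mono)
      also have "\<dots> \<le> \<eta>/4 * s\<^sup>2 + K\<^sup>2 * m\<^sup>2 / \<eta> * (cmod (z x))\<^sup>2"
      proof -
        \<comment> \<open>Young's inequality, weighted so that it costs eta/4 of the gradient term;
          three quarters of it remain, which later gives the factor 2/3.\<close>
        have "0 \<le> (\<eta> * s / 2 - K * m * cmod (z x))\<^sup>2 / \<eta>" using eta by simp
        also have "\<dots> = \<eta>/4 * s\<^sup>2 + K\<^sup>2 * m\<^sup>2 / \<eta> * (cmod (z x))\<^sup>2 - K * cmod (z x) * (m * s)"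
          using eta by (simp add: power2_eq_square field_simps)
        finally show ?thesis by simp
      qed
      finally show ?case using g0 by (simp add: s_def m_def)
    qed
  qed
  also have "\<dots> = \<eta>/4 * (grad_norm \<Omega> z)\<^sup>2 + K\<^sup>2 * (norm v)\<^sup>2 / \<eta> * (nm N z)\<^sup>2"
    using ig sqi_integrable[OF sq(3)] by (simp add: intg nm_sq)
  finally have le: "cmod (\<integral>x. w x * z x * cnj (W x) \<partial>N) \<le> \<eta>/4 * (grad_norm \<Omega> z)\<^sup>2 + K\<^sup>2 * (norm v)\<^sup>2 / \<eta> * (nm N z)\<^sup>2" .
  have "aform \<Omega> \<eta> v \<nu>0 w z z = of_real (\<eta> * (grad_norm \<Omega> z)\<^sup>2) + - (\<integral>x. w x * z x * cnj (W x) \<partial>N) + of_real (\<nu>0 * (nm N z)\<^sup>2)"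
  proof -
    have "(\<Sum>i\<in>UNIV. L2ip \<Omega> (wd \<Omega> z i) (wd \<Omega> z i)) = of_real ((grad_norm \<Omega> z)\<^sup>2)"
      unfolding L2ip_self grad_norm_def by (simp add: L2norm_N sum_nonneg)
    then show ?thesis unfolding aform_def sum23[symmetric] by (simp add: L2ip_self)
  qed
  then have "Re (aform \<Omega> \<eta> v \<nu>0 w z z) = \<eta> * (grad_norm \<Omega> z)\<^sup>2 - Re (\<integral>x. w x * z x * cnj (W x) \<partial>N) + \<nu>0 * (nm N z)\<^sup>2"
    by simp
  then show ?thesis using le complex_Re_le_cmod[of "\<integral>x. w x * z x * cnj (W x) \<partial>N"] by (simp add: algebra_simps)
qed

section \<open>Linearity of the form and definiteness of the inner product\<close>

lemma L2ip_lincomb: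
  assumes "sqi N u" "sqi N w" "sqi N y"
  shows "L2ip \<Omega> (\<lambda>x. c * u x + d * w x) y = c * L2ip \<Omega> u y + d * L2ip \<Omega> w y"
  unfolding L2ip_N using sqi_product(2)[OF assms(1) sqi_cnj[OF assms(3)]] sqi_product(2)[OF assms(2) sqi_cnj[OF assms(3)]]
  by (simp add: distrib_right mult.assoc)

lemma L2ip_cong_AE:
  assumes "AE x in N. u x = w x" "u \<in> borel_measurable N" "w \<in> borel_measurable N" "sqi N y"
  shows "L2ip \<Omega> u y = L2ip \<Omega> w y"
  unfolding L2ip_N
proof (rule integral_cong_AE)
  have "(\<lambda>x. cnj (y x)) \<in> borel_measurable N" using sqi_cnj[OF assms(4)] by (rule sqi_measurable)
  then show "(\<lambda>x. u x * cnj (y x)) \<in> borel_measurable N" "(\<lambda>x. w x * cnj (y x)) \<in> borel_measurable N"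
    using assms by (auto intro: borel_measurable_times)
  show "AE x in N. u x * cnj (y x) = w x * cnj (y x)" using assms(1) by eventually_elim simp
qed

text \<open>Linearity needs care: \<open>wd\<close> is linear only almost everywhere, and the
  integral of a nonintegrable function is 0 by convention, so every term needs its integrability.
  The bounds on w, u and u' provide it for the two first-order terms.\<close>

lemma aform_lincomb:
  assumes w: "H1 \<Omega> w" and K: "AE x in N. cmod (w x) \<le> K"
    and u: "H1 \<Omega> u" "\<And>x. cmod (u x) \<le> B" and u': "H1 \<Omega> u'" "\<And>x. cmod (u' x) \<le> B'" and y: "H1 \<Omega> y"
  shows "aform \<Omega> \<eta> v \<nu>0 w (\<lambda>x. c * u x + d * u' x) y = c * aform \<Omega> \<eta> v \<nu>0 w u y + d * aform \<Omega> \<eta> v \<nu>0 w u' y"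
proof -
  define z where "z = (\<lambda>x. c * u x + d * u' x)"
  have z: "H1 \<Omega> z" unfolding z_def by (rule H1_lincomb[OF u(1) u'(1)])
  note wm = sqi_measurable[OF H1_sqi[OF w]]
  have um: "u \<in> borel_measurable N" "u' \<in> borel_measurable N" 
    using sqi_measurable[OF H1_sqi[OF u(1)]] sqi_measurable[OF H1_sqi[OF u'(1)]] by simp_all
  have sy: "sqi N y" using H1_sqi y by auto
  have AEd: "AE x in N. wd \<Omega> z i x = c * wd \<Omega> u i x + d * wd \<Omega> u' i x" for i
    unfolding z_def by (rule wd_lincomb[OF u(1) u'(1)])
  have 1: "L2ip \<Omega> (wd \<Omega> z i) (wd \<Omega> y i) = c * L2ip \<Omega> (wd \<Omega> u i) (wd \<Omega> y i) + d * L2ip \<Omega> (wd \<Omega> u' i) (wd \<Omega> y i)" for i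
  proof -
    have "L2ip \<Omega> (wd \<Omega> z i) (wd \<Omega> y i) = L2ip \<Omega> (\<lambda>x. c * wd \<Omega> u i x + d * wd \<Omega> u' i x) (wd \<Omega> y i)"
      by (rule L2ip_cong_AE[OF AEd sqi_measurable[OF wd_sqi[OF z]] sqi_measurable[OF sqi_add[OF sqi_scale sqi_scale]]])
         (use wd_sqi u u' y in auto)
    then show ?thesis using L2ip_lincomb wd_sqi u u' y by simp
  qed
  have swv: "sqi N (\<lambda>x. w x * vgrad \<Omega> v f x)" if "H1 \<Omega> f" for f
    by (rule sqi_mult_bounded[OF sqi_vgrad[OF that] wm K])
  have AEv: "AE x in N. vgrad \<Omega> v z x = c * vgrad \<Omega> v u x + d * vgrad \<Omega> v u' x"
  proof -
    have "AE x in N. \<forall>i\<in>UNIV. wd \<Omega> z i x = c * wd \<Omega> u i x + d * wd \<Omega> u' i x"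
      using AEd by (subst AE_finite_all) auto
    then show ?thesis
      by eventually_elim (simp add: vgrad_def sum_distrib_left sum.distrib distrib_left mult_ac)
  qed
  have 2: "L2ip \<Omega> (\<lambda>x. w x * vgrad \<Omega> v z x) y = c * L2ip \<Omega> (\<lambda>x. w x * vgrad \<Omega> v u x) y + d * L2ip \<Omega> (\<lambda>x. w x * vgrad \<Omega> v u' x) y"
  proof -
    have "L2ip \<Omega> (\<lambda>x. w x * vgrad \<Omega> v z x) y = L2ip \<Omega> (\<lambda>x. c * (w x * vgrad \<Omega> v u x) + d * (w x * vgrad \<Omega> v u' x)) y"
    proof (rule L2ip_cong_AE[OF _ sqi_measurable[OF swv[OF z]] sqi_measurable[OF sqi_add[OF sqi_scale sqi_scale]] sy])
      show "AE x in N. w x * vgrad \<Omega> v z x = c * (w x * vgrad \<Omega> v u x) + d * (w x * vgrad \<Omega> v u' x)"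
        using AEv by eventually_elim (simp add: algebra_simps)
    qed (use swv u u' in auto)
    then show ?thesis using L2ip_lincomb[OF swv[OF u(1)] swv[OF u'(1)] sy] by simp
  qed
  have svu: "sqi N (\<lambda>x. vgrad \<Omega> v w x * u x)" "sqi N (\<lambda>x. vgrad \<Omega> v w x * u' x)"
    using sqi_mult_bounded[OF sqi_vgrad[OF w] um(1) AE_I2, of B v] sqi_mult_bounded[OF sqi_vgrad[OF w] um(2) AE_I2, of B' v] u(2) u'(2)
    by (simp_all add: mult.commute)
  have 3: "L2ip \<Omega> (\<lambda>x. vgrad \<Omega> v w x * z x) y = c * L2ip \<Omega> (\<lambda>x. vgrad \<Omega> v w x * u x) y + d * L2ip \<Omega> (\<lambda>x. vgrad \<Omega> v w x * u' x) y"
  proof -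
    have "(\<lambda>x. vgrad \<Omega> v w x * z x) = (\<lambda>x. c * (vgrad \<Omega> v w x * u x) + d * (vgrad \<Omega> v w x * u' x))"
      by (simp add: z_def algebra_simps)
    then show ?thesis using L2ip_lincomb[OF svu sy, of c d] by (simp only:)
  qed
  have 4: "L2ip \<Omega> z y = c * L2ip \<Omega> u y + d * L2ip \<Omega> u' y"
    unfolding z_def using L2ip_lincomb H1_sqi u u' y by blast
  show ?thesis unfolding z_def[symmetric] aform_def 1 2 3 4
    by (simp add: sum.distrib sum_distrib_left algebra_simps)
qed

text \<open>If the norm were zero, the set where u is nonzero would be both open and negligible,
  hence empty.\<close>

lemma L2ip_pos:
  assumes c: "continuous_on UNIV u" and z: "\<And>x. x \<notin> \<Omega> \<Longrightarrow> u x = 0" and s: "sqi N u" and ne: "u \<noteq> (\<lambda>_. 0)"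
  shows "nm N u > 0"
proof (rule ccontr)
  assume "\<not> ?thesis"
  then have "nm N u = 0" using nm_nonneg[of N u] by simp
  then have "(\<integral>x. (cmod (u x))\<^sup>2 \<partial>N) = 0" using nm_sq[of N u] by simp
  then have "AE x in N. (cmod (u x))\<^sup>2 = 0"
    using integral_nonneg_eq_0_iff_AE[OF sqi_integrable[OF s]] by simp
  then have "AE x in lebesgue. x \<in> \<Omega> \<longrightarrow> u x = 0" unfolding AE_N by simp
  then have "AE x in lebesgue. x \<notin> {x. u x \<noteq> 0}" by eventually_elim (use z in auto)
  moreover have o: "open {x. u x \<noteq> 0}" using c by (intro open_Collect_neq) auto
  then have "{x. u x \<noteq> 0} \<in> sets lebesgue" by (simp add: borel_open)
  ultimately have "{x. u x \<noteq> 0} \<in> null_sets lebesgue"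
    using AE_iff_null[of lebesgue "\<lambda>x. x \<notin> {x. u x \<noteq> 0}"] by simp
  then have "negligible {x. u x \<noteq> 0}" by (simp add: negligible_iff_null_sets)
  with o have "{x. u x \<noteq> 0} = {}" using open_not_negligible by blast
  then show False using ne by auto
qed

end

section \<open>The discrete operator as a sectorial operator\<close>

lemma (in bounded_open_set) fin_dim_ip_L2ip:
  assumes fd: "fin_dim_space V"
    and V: "\<And>u. u \<in> V \<Longrightarrow> H10 \<Omega> u \<and> continuous_on UNIV u \<and> (\<forall>x. x \<notin> \<Omega> \<longrightarrow> u x = 0)"
  shows "fin_dim_ip V (L2ip \<Omega>)"
proof
  have s: "sqi N u" if "u \<in> V" for u using V[OF that] H1_sqi by (simp add: H10_def)
  show "\<exists>B. finite B \<and> B \<subseteq> V \<and> V = {(\<lambda>x. \<Sum>b\<in>B. c b * b x) | c. True}"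
    using fd by (simp add: fin_dim_space_def)
  show "L2ip \<Omega> (\<lambda>x. u x + w x) y = L2ip \<Omega> u y + L2ip \<Omega> w y" if "u \<in> V" "w \<in> V" "y \<in> V" for u w y
    using L2ip_lincomb[of u w y 1 1] that s by simp
  show "L2ip \<Omega> (\<lambda>x. c * u x) y = c * L2ip \<Omega> u y" if "u \<in> V" "y \<in> V" for u y c
    using L2ip_lincomb[of u u y c 0] that s by simp
  show "L2ip \<Omega> y u = cnj (L2ip \<Omega> u y)" for u y
    unfolding L2ip_N using Bochner_Integration.integral_cnj[of N "\<lambda>x. u x * cnj (y x)"] by (simp add: mult.commute)
  show "0 < Re (L2ip \<Omega> u u)" if "u \<in> V" "u \<noteq> (\<lambda>_. 0)" for u
    using L2ip_pos[of u] V[OF that(1)] s[OF that(1)] that(2) by (simp add: L2ip_self)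
qed

lemma (in fin_dim_ip) ip_eq_imp_eq:
  assumes "u \<in> V" "w \<in> V" "\<And>y. y \<in> V \<Longrightarrow> ip u y = ip w y"
  shows "u = w"
proof -
  have "(\<lambda>x. u x - w x) \<in> V" using V_diff assms by blast
  moreover from this have "ip (\<lambda>x. u x - w x) (\<lambda>x. u x - w x) = 0" using ip_diff assms by simp
  ultimately have "(\<lambda>x. u x - w x) = (\<lambda>_. 0)" using ip_pos by force
  then show ?thesis by (auto simp: fun_eq_iff)
qed

text \<open>The three parameters of \<open>sectorial_op\<close> obtained here do not depend on
  \<open>V\<close>; uniformity in the mesh size is decided at this point.\<close>

lemma (in bounded_open_set) sectorial_op_L2ip:
  assumes fd: "fin_dim_space V"
    and V: "\<And>u. u \<in> V \<Longrightarrow> H10 \<Omega> u \<and> continuous_on UNIV u \<and> (\<forall>x. x \<notin> \<Omega> \<longrightarrow> u x = 0)"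
    and A_in: "\<And>u. u \<in> V \<Longrightarrow> A u \<in> V"
    and A: "\<And>u y. u \<in> V \<Longrightarrow> y \<in> V \<Longrightarrow> L2ip \<Omega> (\<lambda>x. - A u x) y = aform \<Omega> \<eta> v \<nu>0 w u y"
    and w: "H1 \<Omega> w" and K: "AE x in N. cmod (w x) \<le> K" "K \<ge> 0"
    and emb: "L4_emb s0" and eta: "\<eta> > 0" and alpha: "\<alpha> > 0"
    and alpha_bound: "\<And>u y. H10 \<Omega> u \<Longrightarrow> H10 \<Omega> y \<Longrightarrow>
        cmod (aform \<Omega> \<eta> v \<nu>0 w u y) \<le> \<alpha> * grad_norm \<Omega> u * grad_norm \<Omega> y"
    and nu: "\<nu> > 0" "\<nu> \<le> \<nu>0 - K\<^sup>2 * (norm v)\<^sup>2 / \<eta>"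
  shows "sectorial_op V (L2ip \<Omega>) A \<nu> (3 * \<eta> * \<nu> / (4 * \<alpha>)) (2 * \<alpha> / \<eta>)"
proof -
  interpret fin_dim_ip V "L2ip \<Omega>" by (rule fin_dim_ip_L2ip[OF fd V])
  have bounded: "\<exists>B. \<forall>x. cmod (u x) \<le> B" if "u \<in> V" for u
  proof -
    have "compact (u ` closure \<Omega>)" using V[OF that] bd
      by (intro compact_continuous_image) (auto intro: continuous_on_subset simp: compact_closure)
    then obtain B where B: "B > 0" "\<And>y. y \<in> u ` closure \<Omega> \<Longrightarrow> norm y \<le> B"
      using compact_imp_bounded[of "u ` closure \<Omega>"] by (auto simp: bounded_pos)
    have "cmod (u x) \<le> B" for x
      using B V[OF that] closure_subset[of \<Omega>] by (cases "x \<in> \<Omega>") (auto simp: subset_iff)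
    then show ?thesis by blast
  qed
  have H1V: "H1 \<Omega> u" if "u \<in> V" for u using V[OF that] by (simp add: H10_def)
  have ipA: "L2ip \<Omega> (A u) y = - aform \<Omega> \<eta> v \<nu>0 w u y" if "u \<in> V" "y \<in> V" for u y
    using A[OF that] ip_scale[OF A_in[OF that(1)] that(2), of "-1"] by simp
  \<comment> \<open>\<open>A\<close> is given only through the form, so its linearity is recovered
    by testing both sides against all of \<open>V\<close>.\<close>
  have A_lin: "A (\<lambda>x. c * u x + d * u' x) = (\<lambda>x. c * A u x + d * A u' x)" if u: "u \<in> V" "u' \<in> V" for c d u u'
  proof (rule ip_eq_imp_eq)
    have z: "(\<lambda>x. c * u x + d * u' x) \<in> V" by (intro V_add V_scale u)
    show "A (\<lambda>x. c * u x + d * u' x) \<in> V" using A_in z by blast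
    show "(\<lambda>x. c * A u x + d * A u' x) \<in> V" by (intro V_add V_scale A_in u)
    fix y assume y: "y \<in> V"
    obtain B B' where "\<And>x. cmod (u x) \<le> B" "\<And>x. cmod (u' x) \<le> B'" using bounded u by meson
    then have "aform \<Omega> \<eta> v \<nu>0 w (\<lambda>x. c * u x + d * u' x) y = c * aform \<Omega> \<eta> v \<nu>0 w u y + d * aform \<Omega> \<eta> v \<nu>0 w u' y"
      using aform_lincomb[OF w K(1) H1V[OF u(1)] _ H1V[OF u(2)] _ H1V[OF y]] by blast
    then show "L2ip \<Omega> (A (\<lambda>x. c * u x + d * u' x)) y = L2ip \<Omega> (\<lambda>x. c * A u x + d * A u' x) y"
      using ip_add[OF V_scale[OF A_in[OF u(1)]] V_scale[OF A_in[OF u(2)]] y, of c d] ip_scale[OF A_in[OF u(1)] y] ip_scale[OF A_in[OF u(2)] y]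
        ipA[OF z y] ipA[OF u(1) y] ipA[OF u(2) y] by simp
  qed
  show ?thesis
  proof
    show "A u \<in> V" if "u \<in> V" for u using A_in[OF that] .
    show "A (\<lambda>x. u x + u' x) = (\<lambda>x. A u x + A u' x)" if "u \<in> V" "u' \<in> V" for u u'
      using A_lin[OF that, of 1 1] by simp
    show "A (\<lambda>x. c * u x) = (\<lambda>x. c * A u x)" if "u \<in> V" for u c
      using A_lin[OF that that, of c 0] by simp
    show "0 < \<nu>" "0 < 3 * \<eta> * \<nu> / (4 * \<alpha>)" "0 < 2 * \<alpha> / \<eta>" using nu eta alpha by auto
    fix u assume u: "u \<in> V"
    define a n g where "a = aform \<Omega> \<eta> v \<nu>0 w u u" and "n = Re (L2ip \<Omega> u u)" and "g = (grad_norm \<Omega> u)\<^sup>2"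
    have a: "L2ip \<Omega> (A u) u = - a" using ipA[OF u u] by (simp add: a_def)
    have n: "n = (nm N u)\<^sup>2" by (simp add: n_def L2ip_self)
    obtain B where B: "\<And>x. cmod (u x) \<le> B" using bounded u by meson
    have "3/4 * \<eta> * g + (\<nu>0 - K\<^sup>2 * (norm v)\<^sup>2 / \<eta>) * n \<le> Re a"
      unfolding a_def n g_def by (rule aform_coercive[where z=u, OF w K _ B emb eta]) (use V[OF u] in blast)
    moreover have "\<nu> * n \<le> (\<nu>0 - K\<^sup>2 * (norm v)\<^sup>2 / \<eta>) * n" using nu(2) by (intro mult_right_mono) (simp_all add: n)
    ultimately have Re_a: "3/4 * \<eta> * g \<le> Re a - \<nu> * n" by simp
    have "cmod a \<le> \<alpha> * g"
      using alpha_bound[of u u] V[OF u] by (simp add: a_def g_def power2_eq_square mult.assoc)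
    then have cm: "Re a \<le> \<alpha> * g" "\<bar>Im a\<bar> \<le> \<alpha> * g"
      using complex_Re_le_cmod[of a] abs_Im_le_cmod[of a] by linarith+
    have g: "3/4 * \<eta> * g \<ge> 0" using eta by (simp add: g_def)
    \<comment> \<open>Coercivity and boundedness of the form together replace Poincare's inequality:
      the gradient norm controls the L2 norm with constant nu/alpha. Times 3 eta/4 this is the
      gap.\<close>
    have "\<nu> * n \<le> \<alpha> * g" using Re_a cm(1) g by linarith
    then have "3 * \<eta> / (4 * \<alpha>) * (\<nu> * n) \<le> 3 * \<eta> / (4 * \<alpha>) * (\<alpha> * g)" using eta alpha by (intro mult_left_mono) auto
    also have "\<dots> = 3/4 * \<eta> * g" using alpha by simp
    finally have "3 * \<eta> * \<nu> / (4 * \<alpha>) * n \<le> Re a - \<nu> * n" using Re_a by simp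
    then show "3 * \<eta> * \<nu> / (4 * \<alpha>) * Re (L2ip \<Omega> u u) \<le> - Re (L2ip \<Omega> (A u) u) - \<nu> * Re (L2ip \<Omega> u u)"
      unfolding n_def[symmetric] a by simp
    \<comment> \<open>The opening k = 2 alpha/eta corresponds to coercivity with eta/2. The
      available 3 eta/4 gives the slope 4 alpha/(3 eta), which is 2/3 of k.\<close>
    have "\<alpha> * g = 2/3 * (2 * \<alpha> / \<eta>) * (3/4 * \<eta> * g)" using eta by simp
    also have "\<dots> \<le> 2/3 * (2 * \<alpha> / \<eta>) * (Re a - \<nu> * n)" using Re_a eta alpha by (intro mult_left_mono) auto
    finally have "\<bar>Im a\<bar> \<le> 2/3 * (2 * \<alpha> / \<eta>) * (Re a - \<nu> * n)" using cm(2) by linarith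
    then show "\<bar>Im (L2ip \<Omega> (A u) u)\<bar> \<le> 2/3 * (2 * \<alpha> / \<eta>) * (- Re (L2ip \<Omega> (A u) u) - \<nu> * Re (L2ip \<Omega> u u))"
      unfolding n_def[symmetric] a by simp
  qed
qed


theorem mainTheorem5:
  fixes \<Omega> :: "(real^'n::finite) set"
    and \<eta> \<nu>0 s0 Ca \<alpha>1 \<nu>hat \<theta>0 :: real
    and v :: "real^'n"
    and fs ys :: "real^'n \<Rightarrow> complex"
    and V :: "real \<Rightarrow> (real^'n \<Rightarrow> complex) set"
    and A :: "real \<Rightarrow> (real^'n \<Rightarrow> complex) \<Rightarrow> (real^'n \<Rightarrow> complex)"
  assumes dim: "CARD('n) \<le> 3"
    and dom: "open \<Omega>" "connected \<Omega>" "bounded \<Omega>" "\<Omega> \<noteq> {}" "smooth_boundary \<Omega>"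
    and eta: "\<eta> > 0"
    and fs: "L2 \<Omega> fs"
    and ys: "H2 \<Omega> ys" "H10 \<Omega> ys"
    and ys_eq: "AE x in lebesgue. x \<in> \<Omega> \<longrightarrow>
        - complex_of_real \<eta> * laplace \<Omega> ys x + ys x * vgrad \<Omega> v ys x
        + complex_of_real \<nu>0 * ys x = fs x"
    and s0: "\<forall>z. H1 \<Omega> z \<longrightarrow> set_integrable lebesgue \<Omega> (\<lambda>x. (cmod (z x)) ^ 4) \<and>
        root 4 (LINT x:\<Omega>|lebesgue. (cmod (z x)) ^ 4) \<le> s0 * H1norm \<Omega> z"
    and Ca: "\<forall>z. H2 \<Omega> z \<and> H10 \<Omega> z \<longrightarrow>
        (AE x in lebesgue. x \<in> \<Omega> \<longrightarrow>
           cmod (z x) \<le> Ca * sqrt (H1norm \<Omega> z) * sqrt (H2norm \<Omega> z))"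
    and nuhat_def: "\<nu>hat = \<nu>0 - (norm v)\<^sup>2 / \<eta> * (Ca\<^sup>2 + s0 ^ 4) * (H2norm \<Omega> ys)\<^sup>2"
    and nuhat_pos: "\<nu>hat > 0"
    and alpha1: "\<alpha>1 > 0"
    and alpha1_bound: "\<forall>z \<phi>. H10 \<Omega> z \<and> H10 \<Omega> \<phi> \<longrightarrow>
        cmod (aform \<Omega> \<eta> v \<nu>0 ys z \<phi>) \<le> \<alpha>1 * grad_norm \<Omega> z * grad_norm \<Omega> \<phi>"
    and theta0_def: "\<theta>0 = pi - arctan (2 * \<alpha>1 / \<eta>)"
    and Vh: "\<forall>h>0. fin_dim_space (V h) \<and>
        (\<forall>u\<in>V h. H10 \<Omega> u \<and> continuous_on UNIV u \<and> (\<forall>x. x \<notin> \<Omega> \<longrightarrow> u x = 0))"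
    and Ah: "\<forall>h>0. (\<forall>z\<in>V h. A h z \<in> V h) \<and>
        (\<forall>z\<in>V h. \<forall>\<phi>\<in>V h. L2ip \<Omega> (\<lambda>x. - A h z x) \<phi> = aform \<Omega> \<eta> v \<nu>0 ys z \<phi>)"
  shows
    \<comment> \<open>(a)\<close>
    "(\<forall>h>0. spectrum_on (V h) (A h) \<subseteq> sector (-\<nu>hat) \<theta>0) \<and>
     (\<exists>C>0. \<forall>h>0. \<forall>\<mu>. \<mu> \<notin> sector (-\<nu>hat) \<theta>0 \<and> \<mu> \<noteq> complex_of_real (-\<nu>hat) \<longrightarrow>
        opnorm_le \<Omega> (V h) (resolvent_on (V h) (A h) \<mu>) (C / cmod (\<mu> + complex_of_real \<nu>hat)))
     \<and>
    \<comment> \<open>(b)\<close>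
     (\<exists>\<delta>>0. \<exists>M. \<forall>h>0. \<forall>\<zeta>. \<zeta> \<noteq> 0 \<and> \<bar>Arg \<zeta>\<bar> \<le> \<delta> \<and> cmod \<zeta> \<le> 1 \<longrightarrow>
        opnorm_le \<Omega> (V h) (op_exp (A h) \<zeta>) M) \<and>
     (\<forall>h>0. \<forall>t>0. \<forall>\<gamma>. curve_in \<gamma> (- sector (-\<nu>hat) \<theta>0) \<longrightarrow>
        (\<forall>z\<in>V h. \<forall>x. improper_cintegral \<gamma>
            (\<lambda>\<mu>. exp (\<mu> * complex_of_real t) * resolvent_on (V h) (A h) \<mu> z x)
            (2 * complex_of_real pi * \<i> * op_exp (A h) (complex_of_real t) z x)))
     \<and>
    \<comment> \<open>(c)\<close>
     (\<exists>C>0. \<forall>h>0. \<forall>t>0.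
        opnorm_le \<Omega> (V h) (op_exp (A h) (complex_of_real t)) (C * exp (- \<nu>hat * t)))"
proof -
  interpret bounded_open_set \<Omega> using dom by unfold_locales auto
  define Y where "Y = H2norm \<Omega> ys"
  define k where "k = 2 * \<alpha>1 / \<eta>"
  define c0 where "c0 = 3 * \<eta> * \<nu>hat / (4 * \<alpha>1)"
  have k: "k > 0" using alpha1 eta by (simp add: k_def)
  have th: "\<theta>0 = pi - arctan k" by (simp add: theta0_def k_def)
  have H1ys: "H1 \<Omega> ys" using ys(2) by (simp add: H10_def)
  have Y: "H1norm \<Omega> ys \<le> Y" unfolding Y_def H1norm_def H2norm_def by (intro real_sqrt_le_mono) (simp add: sum_nonneg)
  have Y0: "Y \<ge> 0" using Y H1norm_bounds(1)[of ys] by linarith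
  \<comment> \<open>Agmon's bound with the H1 norm replaced by the larger H2 norm; the absolute
    value appears because the sign of \<open>Ca\<close> is not assumed.\<close>
  have K: "AE x in N. cmod (ys x) \<le> \<bar>Ca\<bar> * Y"
  proof -
    have "AE x in N. cmod (ys x) \<le> Ca * sqrt (H1norm \<Omega> ys) * sqrt Y"
      using Ca ys unfolding AE_N[symmetric] Y_def by blast
    then show ?thesis
    proof eventually_elim
      case (elim x)
      have "sqrt (H1norm \<Omega> ys) * sqrt Y \<le> sqrt Y * sqrt Y" using Y Y0 by (intro mult_right_mono) auto
      then have "sqrt (H1norm \<Omega> ys) * sqrt Y \<le> Y" using Y0 by simp
      then have "\<bar>Ca\<bar> * (sqrt (H1norm \<Omega> ys) * sqrt Y) \<le> \<bar>Ca\<bar> * Y" by (intro mult_left_mono) auto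
      moreover have "Ca * (sqrt (H1norm \<Omega> ys) * sqrt Y) \<le> \<bar>Ca\<bar> * (sqrt (H1norm \<Omega> ys) * sqrt Y)"
        using H1norm_bounds(1)[of ys] Y0 by (intro mult_right_mono) auto
      ultimately show ?case using elim by (simp add: mult.assoc)
    qed
  qed
  \<comment> \<open>The two sides differ exactly by the nonnegative \<open>s0 ^ 4\<close>
    term.\<close>
  have nu_le: "\<nu>hat \<le> \<nu>0 - (\<bar>Ca\<bar> * Y)\<^sup>2 * (norm v)\<^sup>2 / \<eta>"
  proof -
    have "0 \<le> (norm v)\<^sup>2 / \<eta> * s0 ^ 4 * Y\<^sup>2" using eta by simp
    then show ?thesis unfolding nuhat_def Y_def[symmetric] by (simp add: power_mult_distrib algebra_simps add_divide_distrib)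
  qed
  have sec: "sectorial_op (V h) (L2ip \<Omega>) (A h) \<nu>hat c0 k" if h: "h > 0" for h
    unfolding c0_def k_def
  proof (rule sectorial_op_L2ip[where w=ys and K="\<bar>Ca\<bar> * Y" and ?\<nu>0.0=\<nu>0 and v=v and ?s0.0=s0])
    show "fin_dim_space (V h)" using Vh h by blast
    show "\<And>u. u \<in> V h \<Longrightarrow> H10 \<Omega> u \<and> continuous_on UNIV u \<and> (\<forall>x. x \<notin> \<Omega> \<longrightarrow> u x = 0)" using Vh h by blast
    show "\<And>u. u \<in> V h \<Longrightarrow> A h u \<in> V h" using Ah h by blast
    show "\<And>u y. u \<in> V h \<Longrightarrow> y \<in> V h \<Longrightarrow> L2ip \<Omega> (\<lambda>x. - A h u x) y = aform \<Omega> \<eta> v \<nu>0 ys u y" using Ah h by blast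
    show "L4_emb s0" using s0 unfolding L4_emb_def by blast
    show "\<And>u y. H10 \<Omega> u \<Longrightarrow> H10 \<Omega> y \<Longrightarrow> cmod (aform \<Omega> \<eta> v \<nu>0 ys u y) \<le> \<alpha>1 * grad_norm \<Omega> u * grad_norm \<Omega> y"
      using alpha1_bound by blast
  qed (use H1ys K Y0 eta alpha1 nuhat_pos nu_le in auto)
  note fin = sectorial_op.axioms(1)[OF sec]
  have nrm: "L2norm \<Omega> u = fin_dim_ip.nrm (L2ip \<Omega>) u" if "h > 0" for h :: real and u
    using fin_dim_ip.nrm_def[OF fin[OF that]] by (simp add: L2norm_N L2ip_self nm_nonneg)
  have res: "resolvent_on (V h) (A h) = sectorial_op.R (V h) (A h)" if "h > 0" for h
    by (intro ext) (simp add: resolvent_on_def sectorial_op.R_def[OF sec[OF that]] sectorial_op.S_def[OF sec[OF that]])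
  \<comment> \<open>\<open>op_exp\<close> is a pointwise infinite sum, meaningful only if the series
    converges; \<open>E_series\<close> supplies the convergence together with the value.\<close>
  have oexp: "op_exp (A h) \<zeta> z = sectorial_op.E (V h) (L2ip \<Omega>) (A h) \<zeta> z" if "h > 0" "z \<in> V h" for h \<zeta> z
    using sectorial_op.E_series[OF sec[OF that(1)] that(2)] by (auto simp: op_exp_def sums_iff)
  define C where "C = ((k+1) * (3 + 2*k)) / k"
  have a1: "spectrum_on (V h) (A h) \<subseteq> sector (-\<nu>hat) \<theta>0" if h: "h > 0" for h
  proof -
    interpret sectorial_op "V h" "L2ip \<Omega>" "A h" \<nu>hat c0 k by (rule sec[OF h])
    show ?thesis using bij_D[OF not_sector_D] by (auto simp: spectrum_on_def S_def th)
  qed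
  have a2: "\<exists>C>0. \<forall>h>0. \<forall>\<mu>. \<mu> \<notin> sector (-\<nu>hat) \<theta>0 \<and> \<mu> \<noteq> complex_of_real (-\<nu>hat) \<longrightarrow>
        opnorm_le \<Omega> (V h) (resolvent_on (V h) (A h) \<mu>) (C / cmod (\<mu> + complex_of_real \<nu>hat))"
    unfolding opnorm_le_def
  proof (intro exI[of _ C] conjI allI impI ballI)
    show "C > 0" using k by (simp add: C_def)
    fix h :: real and \<mu> z
    assume h: "h > 0" and mu: "\<mu> \<notin> sector (-\<nu>hat) \<theta>0 \<and> \<mu> \<noteq> complex_of_real (-\<nu>hat)" and z: "z \<in> V h"
    show "L2norm \<Omega> (resolvent_on (V h) (A h) \<mu> z) \<le> C / cmod (\<mu> + complex_of_real \<nu>hat) * L2norm \<Omega> z"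
      unfolding nrm[OF h] res[OF h] C_def using sectorial_op.R_bound[OF sec[OF h] _ _ z] mu th by simp
  qed
  have b1: "\<exists>\<delta>>0. \<exists>M. \<forall>h>0. \<forall>\<zeta>. \<zeta> \<noteq> 0 \<and> \<bar>Arg \<zeta>\<bar> \<le> \<delta> \<and> cmod \<zeta> \<le> 1 \<longrightarrow> opnorm_le \<Omega> (V h) (op_exp (A h) \<zeta>) M"
    unfolding opnorm_le_def
  \<comment> \<open>The bound M = 1 works because the semigroup is contractive throughout this
    sector.\<close>
  proof (rule exI[of _ "arctan (3 / (2*k))"], intro exI[of _ 1] conjI allI impI ballI)
    show "arctan (3 / (2*k)) > 0" using k by simp
    fix h :: real and \<zeta> z
    assume h: "h > 0" and ze: "\<zeta> \<noteq> 0 \<and> \<bar>Arg \<zeta>\<bar> \<le> arctan (3 / (2*k)) \<and> cmod \<zeta> \<le> 1" and z: "z \<in> V h"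
    show "L2norm \<Omega> (op_exp (A h) \<zeta> z) \<le> 1 * L2norm \<Omega> z"
      unfolding nrm[OF h] oexp[OF h z] using sectorial_op.E_sector_bound[OF sec[OF h] z] ze by simp
  qed
  have b2: "improper_cintegral \<gamma> (\<lambda>\<mu>. exp (\<mu> * complex_of_real t) * resolvent_on (V h) (A h) \<mu> z x)
            (2 * complex_of_real pi * \<i> * op_exp (A h) (complex_of_real t) z x)"
    if "h > 0" "t > 0" "curve_in \<gamma> (- sector (-\<nu>hat) \<theta>0)" "z \<in> V h" for h t \<gamma> z x
    unfolding res[OF that(1)] oexp[OF that(1,4)]
    using sectorial_op.dunford_formula[OF sec[OF that(1)] that(4,2)] that(3) by (simp add: th)
  have c: "\<exists>C>0. \<forall>h>0. \<forall>t>0. opnorm_le \<Omega> (V h) (op_exp (A h) (complex_of_real t)) (C * exp (- \<nu>hat * t))"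
    unfolding opnorm_le_def
  proof (intro exI[of _ 1] conjI allI impI ballI)
    fix h t :: real and z
    assume h: "h > 0" and t: "t > 0" and z: "z \<in> V h"
    show "L2norm \<Omega> (op_exp (A h) (complex_of_real t) z) \<le> 1 * exp (- \<nu>hat * t) * L2norm \<Omega> z"
      unfolding nrm[OF h] oexp[OF h z] using sectorial_op.E_decay[OF sec[OF h] z t] by simp
  qed simp
  show ?thesis
    by (intro conjI allI impI ballI a1 a2 b1 b2 c)
qed

end
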